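(* Let $k,l$ be non-negative integers with $k<l$ and $(k,l)\neq(0,1)$. Then there are values of $\zeta\in\mathbb{C}$ such that the equation $$-f''(x)+\left(x^l-x^k\zeta\right)^2f(x)=0,\qquad x\in\mathbb{R},$$ has a solution $f\in L^\infty(\mathbb{R})$ with $f\not\equiv 0$. As a consequence, the differential operator $$P=\frac{\partial^2}{\partial x^2}+\left(x^k\frac{\partial}{\partial y}-x^l\frac{\partial}{\partial t}\right)^2$$ on $\mathbb{R}^3$ (with coordinates $(x,y,t)$) is not analytic hypoelliptic.
   Context: A differential operator $P$ is analytic hypoelliptic on an open set $\Omega$ if for any real-analytic function $f$ on some open set $U\subset\Omega$, all the solutions $u$ of $Pu=f$ are real-analytic on $U$. *)

theory Defs
  imports "HOL-Analysis.Analysis" "HOL-Probability.Essential_Supremum"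
begin

definition classical_solution :: "nat \<Rightarrow> nat \<Rightarrow> complex \<Rightarrow> (real \<Rightarrow> complex) \<Rightarrow> bool" where
  "classical_solution k l \<zeta> f \<longleftrightarrow>
     (\<exists>f' f''. (\<forall>x. (f has_vector_derivative f' x) (at x)) \<and>
               (\<forall>x. (f' has_vector_derivative f'' x) (at x)) \<and>
               (\<forall>x. - f'' x + (of_real (x ^ l) - of_real (x ^ k) * \<zeta>)\<^sup>2 * f x = 0))"

definition L_infinity :: "(real \<Rightarrow> complex) set" where
  "L_infinity = {f \<in> borel_measurable lborel. esssup lborel (\<lambda>x. ereal (cmod (f x))) < \<infinity>}"


definition partial :: "'n::finite \<Rightarrow> (real ^ 'n \<Rightarrow> complex) \<Rightarrow> real ^ 'n \<Rightarrow> complex" where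
  "partial i \<phi> = (\<lambda>p. frechet_derivative \<phi> (at p) (axis i 1))"

definition partials :: "'n::finite list \<Rightarrow> (real ^ 'n \<Rightarrow> complex) \<Rightarrow> real ^ 'n \<Rightarrow> complex" where
  "partials is \<phi> = foldr partial is \<phi>"

text \<open>Differentiability of every iterated partial derivative entails continuity of all of
  them, so this is exactly the class of smooth functions on the whole space.\<close>

definition smooth :: "(real ^ 'n::finite \<Rightarrow> complex) \<Rightarrow> bool" where
  "smooth \<phi> \<longleftrightarrow> (\<forall>is p. partials is \<phi> differentiable (at p))"

definition support :: "(real ^ 'n::finite \<Rightarrow> complex) \<Rightarrow> (real ^ 'n) set" where
  "support \<phi> = closure {p. \<phi> p \<noteq> 0}"

definition test_functions :: "(real ^ 'n::finite) set \<Rightarrow> (real ^ 'n \<Rightarrow> complex) set" where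
  "test_functions U = {\<phi>. smooth \<phi> \<and> compact (support \<phi>) \<and> support \<phi> \<subseteq> U}"

text \<open>Functionals are total functions in HOL; only their values on the test functions of the
  open set under consideration are ever relevant.\<close>

type_synonym 'n functional = "(real ^ 'n \<Rightarrow> complex) \<Rightarrow> complex"

definition distribution_on :: "(real ^ 'n::finite) set \<Rightarrow> 'n functional \<Rightarrow> bool" where
  "distribution_on U u \<longleftrightarrow>
     (\<forall>\<phi>\<in>test_functions U. \<forall>\<psi>\<in>test_functions U. u (\<lambda>p. \<phi> p + \<psi> p) = u \<phi> + u \<psi>) \<and>
     (\<forall>c. \<forall>\<phi>\<in>test_functions U. u (\<lambda>p. c * \<phi> p) = c * u \<phi>) \<and>
     (\<forall>K. compact K \<and> K \<subseteq> U \<longrightarrow>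
        (\<exists>C N. \<forall>\<phi>\<in>test_functions U. support \<phi> \<subseteq> K \<longrightarrow>
           cmod (u \<phi>) \<le> C * (\<Sum>is | length is \<le> N. SUP p. cmod (partials is \<phi> p))))"

definition eq_distr_on ::
    "(real ^ 'n::finite) set \<Rightarrow> 'n functional \<Rightarrow> 'n functional \<Rightarrow> bool" where
  "eq_distr_on U u v \<longleftrightarrow> (\<forall>\<phi>\<in>test_functions U. u \<phi> = v \<phi>)"

definition distr_of :: "(real ^ 'n::finite) set \<Rightarrow> (real ^ 'n \<Rightarrow> complex) \<Rightarrow> 'n functional" where
  "distr_of U g = (\<lambda>\<phi>. LINT p:U|lborel. g p * \<phi> p)"

definition distr_partial :: "'n::finite \<Rightarrow> 'n functional \<Rightarrow> 'n functional" where
  "distr_partial i u = (\<lambda>\<phi>. - u (partial i \<phi>))"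

definition distr_mult :: "(real ^ 'n::finite \<Rightarrow> complex) \<Rightarrow> 'n functional \<Rightarrow> 'n functional" where
  "distr_mult a u = (\<lambda>\<phi>. u (\<lambda>p. a p * \<phi> p))"

definition real_analytic_on :: "(real ^ 'n::finite \<Rightarrow> complex) \<Rightarrow> (real ^ 'n) set \<Rightarrow> bool" where
  "real_analytic_on g U \<longleftrightarrow>
     (\<forall>p\<in>U. \<exists>r>0. \<exists>a :: ('n \<Rightarrow> nat) \<Rightarrow> complex. \<forall>q\<in>ball p r.
        ((\<lambda>\<alpha>. a \<alpha> * of_real (\<Prod>i\<in>UNIV. (q $ i - p $ i) ^ \<alpha> i)) has_sum g q) UNIV)"

text \<open>A differential operator is represented by its action on distributions; solutions are
  distributions, and a distribution is real-analytic if it is given by a real-analytic function.\<close>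

definition analytic_hypoelliptic_on ::
    "('n::finite functional \<Rightarrow> 'n functional) \<Rightarrow> (real ^ 'n) set \<Rightarrow> bool" where
  "analytic_hypoelliptic_on P \<Omega> \<longleftrightarrow>
     (\<forall>U f u. open U \<and> U \<subseteq> \<Omega> \<and> real_analytic_on f U \<and>
        distribution_on U u \<and> eq_distr_on U (P u) (distr_of U f) \<longrightarrow>
        (\<exists>g. real_analytic_on g U \<and> eq_distr_on U u (distr_of U g)))"

text \<open>Coordinates \<open>(x, y, t)\<close> on \<open>real ^ 3\<close> are the components \<open>1\<close>, \<open>2\<close>, \<open>3\<close>.
  \<open>vector_field k l\<close> is \<open>x\<^sup>k \<partial>\<^sub>y - x\<^sup>l \<partial>\<^sub>t\<close>.\<close>

definition vector_field :: "nat \<Rightarrow> nat \<Rightarrow> 3 functional \<Rightarrow> 3 functional" where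
  "vector_field k l u = (\<lambda>\<phi>.
     distr_mult (\<lambda>p. of_real ((p $ 1) ^ k)) (distr_partial 2 u) \<phi> -
     distr_mult (\<lambda>p. of_real ((p $ 1) ^ l)) (distr_partial 3 u) \<phi>)"

definition P_op :: "nat \<Rightarrow> nat \<Rightarrow> 3 functional \<Rightarrow> 3 functional" where
  "P_op k l u = (\<lambda>\<phi>.
     distr_partial 1 (distr_partial 1 u) \<phi> + vector_field k l (vector_field k l u) \<phi>)"

end

theory Submission
  imports Defs "HOL-Complex_Analysis.Conformal_Mappings"
begin

text \<open>Up to sign, \<open>connection l k \<zeta>\<close> is the Wronskian of the two solutions of \<open>f'' = (x\<^sup>l - \<zeta> x\<^sup>k)\<^sup>2 f\<close> that decay at \<open>+\<infinity>\<close> and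
  at \<open>-\<infinity>\<close>. It is entire in \<open>\<zeta>\<close> and of finite order, so without zeros it would be the exponential of a
  polynomial. In all cases but \<open>k = 0\<close> with \<open>l\<close> odd, rotating and rescaling \<open>x\<close> shows that it has a
  nonzero limit along the imaginary axis, which makes the exponential constant; in the remaining
  case it is even and of order less than \<open>2\<close>. Either way it is constant, but it is unbounded on the real axis. At a
  zero \<open>\<zeta>\<close> the two solutions are proportional and give a bounded solution \<open>f\<close>.

  For the operator, with \<open>M = \<bar>\<zeta>\<bar> + 1\<close> the superposition over \<open>n\<close> of
  \<open>exp (\<i> n\<^sup>l\<^sup>+\<^sup>1 t + \<i> \<zeta> n\<^sup>k\<^sup>+\<^sup>1 y - M n\<^sup>k\<^sup>+\<^sup>1) f (n x)\<close> is a solution of \<open>P u = 0\<close> for \<open>\<bar>y\<bar> < 1\<close>, and since \<open>k < l\<close> the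
  \<open>t\<close>-derivatives at \<open>0\<close> of \<open>u\<close> (or of \<open>\<partial>\<^sub>x u\<close>, if \<open>f 0 = 0\<close>) grow too fast for analyticity.\<close>

section \<open>Entire solutions\<close>

text \<open>The excluded cases come from explicit formulas. On the imaginary axis the limit of
  \<open>connection\<close> is a nonzero multiple of \<open>cos 0\<close> or of
  \<open>cos (pi / (2 * (k + 1)))\<close>, according to the parity of \<open>l + k\<close>; it
  vanishes exactly for \<open>k = 0\<close> with \<open>l\<close> odd. The order is at most
  \<open>(l + 1) / (l - k)\<close>, hence at most \<open>3 / 2\<close> for \<open>k = 0\<close> and
  \<open>l \<ge> 2\<close>. For \<open>(k, l) = (0, 1)\<close> the order 2 leaves room for a
  Gaussian, which is what a translation of \<open>x\<close> by \<zeta> produces.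

  The obstacle is that rotating \<open>x\<close> leads off the real line. Asymptotics in complex
  sectors are avoided: all estimates stay on a real half line, and a complex dilation acts only on
  the coefficients of \<open>p * z ^ l + q * z ^ k\<close>, where the identity theorem extends the
  law for real dilations. This is why two free coefficients are carried along, and why the estimates
  must be uniform as \<open>p\<close> tends to 0.

  On the positive real axis unboundedness has a classical source:
  \<open>x ^ l - \<zeta> * x ^ k\<close> is negative up to a turning point, and its negative
  integral there makes the amplitude exponentially large.\<close>

fun sol_coeff :: "nat \<Rightarrow> nat \<Rightarrow> complex \<Rightarrow> complex \<Rightarrow> complex \<Rightarrow> complex \<Rightarrow> nat \<Rightarrow> complex" where
  "sol_coeff l k p q c0 c1 0 = c0"
| "sol_coeff l k p q c0 c1 (Suc 0) = c1"
| "sol_coeff l k p q c0 c1 (Suc (Suc n)) =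
    ((if 2 * l \<le> n then p\<^sup>2 * sol_coeff l k p q c0 c1 (n - 2 * l) else 0) +
     (if l + k \<le> n then 2 * p * q * sol_coeff l k p q c0 c1 (n - (l + k)) else 0) +
     (if 2 * k \<le> n then q\<^sup>2 * sol_coeff l k p q c0 c1 (n - 2 * k) else 0)) / of_nat ((n + 1) * (n + 2))"

text \<open>The entire solution of \<open>y'' = (p * z ^ l + q * z ^ k)^2 * y\<close> with
  \<open>y 0 = c0\<close> and \<open>y' 0 = c1\<close>; \<open>dsol\<close> is its derivative. The
  three terms of the recursion are those of the expanded square.\<close>

definition sol :: "nat \<Rightarrow> nat \<Rightarrow> complex \<Rightarrow> complex \<Rightarrow> complex \<Rightarrow> complex \<Rightarrow> complex \<Rightarrow> complex" where
  "sol l k p q c0 c1 z = (\<Sum>n. sol_coeff l k p q c0 c1 n * z ^ n)"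

definition dsol :: "nat \<Rightarrow> nat \<Rightarrow> complex \<Rightarrow> complex \<Rightarrow> complex \<Rightarrow> complex \<Rightarrow> complex \<Rightarrow> complex" where
  "dsol l k p q c0 c1 z = (\<Sum>n. diffs (sol_coeff l k p q c0 c1) n * z ^ n)"

text \<open>One step of the recursion multiplies the weighted bound by at most
  \<open>K / ((m + 1) * (m + 2))\<close>, so only the steps with \<open>m < N0\<close> can enlarge
  it; the exponent \<open>min n N0\<close> counts them. The bound is uniform over all parameters of
  norm at most \<open>M\<close>, on which the holomorphic dependence on \<open>p\<close> and
  \<open>q\<close> rests.\<close>

lemma sol_coeff_bound:
  fixes M R :: real
  assumes "M \<ge> 0" "R \<ge> 0"
  shows "\<exists>B\<ge>0. \<forall>p q c0 c1 n. norm p \<le> M \<and> norm q \<le> M \<and> norm c0 \<le> M \<and> norm c1 \<le> M \<longrightarrow>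
           norm (sol_coeff l k p q c0 c1 n) * R ^ n \<le> B"
proof -
  define K where "K = M^2 * (R^(2*l+2) + 2 * R^(l+k+2) + R^(2*k+2))"
  have K0: "K \<ge> 0" unfolding K_def using assms by auto
  obtain N0 :: nat where N0: "K \<le> real N0" using real_arch_simple by blast
  define B0 where "B0 = M * (1 + R)"
  have B0: "B0 \<ge> 0" unfolding B0_def using assms by auto
  have main: "norm (sol_coeff l k p q c0 c1 n) * R ^ n \<le> B0 * (1 + K) ^ (min n N0)"
    if h: "norm p \<le> M" "norm q \<le> M" "norm c0 \<le> M" "norm c1 \<le> M" for p q c0 c1 n
  proof (induction n rule: less_induct)
    case (less n)
    consider "n = 0" | "n = 1" | m where "n = Suc (Suc m)"
      by (metis One_nat_def not0_implies_Suc)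
    then show ?case
    proof cases
      case 1
      then show ?thesis using h assms unfolding B0_def
        by (simp add: algebra_simps) (smt (verit) mult_nonneg_nonneg)
    next
      case 2
      have "norm c1 * R \<le> M * (1 + R)" using h assms by (intro mult_mono) auto
      also have "\<dots> \<le> B0 * (1 + K) ^ (min n N0)" unfolding B0_def[symmetric]
        using mult_left_mono[of 1 "(1 + K) ^ (min n N0)" B0] K0 B0 by simp
      finally show ?thesis using 2 by simp
    next
      case 3
      define T where "T = B0 * (1 + K) ^ (min m N0)"
      have T0: "T \<ge> 0" unfolding T_def using B0 K0 by simp
      have IH: "norm (sol_coeff l k p q c0 c1 i) * R ^ i \<le> T" if "i \<le> m" for i
      proof -
        have "norm (sol_coeff l k p q c0 c1 i) * R ^ i \<le> B0 * (1 + K) ^ (min i N0)"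
          using less[of i] that 3 by auto
        also have "\<dots> \<le> T" unfolding T_def using that B0 K0
          by (intro mult_left_mono power_increasing) auto
        finally show ?thesis .
      qed
      have aux: "norm (if j \<le> m then x * sol_coeff l k p q c0 c1 (m - j) else 0) * R ^ (m + 2)
                   \<le> X * R ^ (j + 2) * T" if "norm x \<le> X" for x j X
      proof (cases "j \<le> m")
        case True
        have "R ^ (m + 2) = R ^ (j + 2) * R ^ (m - j)" using True
          by (simp flip: power_add)
        then have "norm (if j \<le> m then x * sol_coeff l k p q c0 c1 (m - j) else 0) * R ^ (m + 2)
           = norm x * R ^ (j + 2) * (norm (sol_coeff l k p q c0 c1 (m - j)) * R ^ (m - j))"
          using True by (simp add: norm_mult)
        also have "\<dots> \<le> X * R ^ (j + 2) * T"
          using IH[of "m - j"] that assms T0 order_trans[OF norm_ge_zero that] by (intro mult_mono) auto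
        finally show ?thesis .
      next
        case False
        then show ?thesis using that T0 assms order_trans[OF norm_ge_zero that] by simp
      qed
      define S where "S = (if 2 * l \<le> m then p\<^sup>2 * sol_coeff l k p q c0 c1 (m - 2 * l) else 0) +
     (if l + k \<le> m then 2 * p * q * sol_coeff l k p q c0 c1 (m - (l + k)) else 0) +
     (if 2 * k \<le> m then q\<^sup>2 * sol_coeff l k p q c0 c1 (m - 2 * k) else 0)"
      have "norm S * R ^ (m + 2) \<le> norm (if 2 * l \<le> m then p\<^sup>2 * sol_coeff l k p q c0 c1 (m - 2 * l) else 0) * R ^ (m + 2)
         + norm (if l + k \<le> m then 2 * p * q * sol_coeff l k p q c0 c1 (m - (l + k)) else 0) * R ^ (m + 2)
         + norm (if 2 * k \<le> m then q\<^sup>2 * sol_coeff l k p q c0 c1 (m - 2 * k) else 0) * R ^ (m + 2)"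
        unfolding S_def distrib_right[symmetric] using assms
        by (intro mult_right_mono order_trans[OF norm_triangle_ineq add_right_mono[OF norm_triangle_ineq]]) simp
      also have "\<dots> \<le> M^2 * R ^ (2*l + 2) * T + (2 * M^2) * R ^ (l + k + 2) * T + M^2 * R ^ (2*k + 2) * T"
      proof (intro add_mono aux)
        show "norm (p\<^sup>2) \<le> M\<^sup>2" "norm (q\<^sup>2) \<le> M\<^sup>2" using h by (auto simp: norm_power intro: power_mono)
        show "norm (2 * p * q) \<le> 2 * M\<^sup>2" using h assms
          by (auto simp: norm_mult power2_eq_square intro!: mult_mono)
      qed
      also have "\<dots> = K * T"
      proof -
        have "M^2 * a * T + (2 * M^2) * b * T + M^2 * c * T = M^2 * (a + 2 * b + c) * T" for a b c
          by (simp add: algebra_simps)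
        then show ?thesis unfolding K_def .
      qed
      finally have S: "norm S * R ^ (m + 2) \<le> K * T" .
      have eq: "norm (sol_coeff l k p q c0 c1 n) * R ^ n = norm S * R ^ (m + 2) / (real (m+1) * real (m+2))"
        unfolding 3 sol_coeff.simps S_def[symmetric] norm_divide norm_of_nat times_divide_eq_left
        by (simp only: add_2_eq_Suc' of_nat_mult)
      also have "\<dots> \<le> K * T / (real (m+1) * real (m+2))" using S by (rule divide_right_mono) simp
      also have "\<dots> \<le> B0 * (1 + K) ^ (min n N0)"
      proof (cases "m < N0")
        case True
        have "K * T / (real (m+1) * real (m+2)) \<le> K * T / 1"
        proof (intro divide_left_mono)
          show "1 \<le> real (m+1) * real (m+2)" by (simp add: algebra_simps)
        qed (use K0 T0 in auto)
        also have "\<dots> \<le> (1 + K) * T" using T0 by (simp add: algebra_simps)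
        also have "\<dots> = B0 * (1 + K) ^ (m + 1)" unfolding T_def using True by simp
        also have "\<dots> \<le> B0 * (1 + K) ^ (min n N0)" using True 3 B0 K0
          by (intro mult_left_mono power_increasing) auto
        finally show ?thesis .
      next
        case False
        have "real m + 1 \<le> real (m+1) * real (m+2)" by (simp add: algebra_simps)
        then have "K \<le> real (m+1) * real (m+2)" using False N0 by linarith
        then have "K * T \<le> real (m+1) * real (m+2) * T" using T0 by (rule mult_right_mono)
        then have "K * T / (real (m+1) * real (m+2)) \<le> T"
          by (subst pos_divide_le_eq) (auto simp: mult.commute simp del: of_nat_Suc of_nat_add)
        also have "T = B0 * (1 + K) ^ (min n N0)" unfolding T_def using False 3 by simp
        finally show ?thesis .
      qed
      finally show ?thesis .
    qed
  qed
  have "norm (sol_coeff l k p q c0 c1 n) * R ^ n \<le> B0 * (1 + K) ^ N0"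
    if h: "norm p \<le> M" "norm q \<le> M" "norm c0 \<le> M" "norm c1 \<le> M" for p q c0 c1 n
  proof -
    have "B0 * (1 + K) ^ (min n N0) \<le> B0 * (1 + K) ^ N0" using B0 K0
      by (intro mult_left_mono power_increasing) auto
    then show ?thesis using main[OF h] order_trans by blast
  qed
  moreover have "B0 * (1 + K) ^ N0 \<ge> 0" using B0 K0 by simp
  ultimately show ?thesis by blast
qed

text \<open>A bound at radius \<open>4 * r + 1\<close> leaves \<open>(1/4) ^ n\<close> at radius
  \<open>r\<close>, and a factor \<open>(1/2) ^ n\<close> of it pays for
  \<open>n + 1 \<le> 2 ^ n\<close> in the differentiated series. One majorant thus serves
  \<open>sol\<close> and \<open>dsol\<close>.\<close>

lemma sol_coeff_geometric_bound:
  fixes M r :: real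
  assumes "M \<ge> 0" "r \<ge> 0"
  shows "\<exists>B\<ge>0. \<forall>p q c0 c1 n z. norm p \<le> M \<and> norm q \<le> M \<and> norm c0 \<le> M \<and> norm c1 \<le> M \<and> norm z \<le> r \<longrightarrow>
           norm (sol_coeff l k p q c0 c1 n * z ^ n) \<le> B * (1/2) ^ n \<and>
           norm (diffs (sol_coeff l k p q c0 c1) n * z ^ n) \<le> B * (1/2) ^ n"
proof -
  obtain B where B: "B \<ge> 0" "\<And>p q c0 c1 n. norm p \<le> M \<and> norm q \<le> M \<and> norm c0 \<le> M \<and> norm c1 \<le> M \<Longrightarrow>
           norm (sol_coeff l k p q c0 c1 n) * (4 * r + 1) ^ n \<le> B"
    using sol_coeff_bound[of M "4 * r + 1" l k] assms by auto
  show ?thesis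
  proof (intro exI[of _ B] conjI allI impI; (elim conjE)?)
    show "B \<ge> 0" by fact
    fix p q c0 c1 z :: complex and n :: nat
    assume h: "norm p \<le> M" "norm q \<le> M" "norm c0 \<le> M" "norm c1 \<le> M" "norm z \<le> r"
    have z4: "norm z ^ m \<le> (4 * r + 1) ^ m * (1/4) ^ m" for m
      unfolding power_mult_distrib[symmetric] using h by (intro power_mono) auto
    have "norm (sol_coeff l k p q c0 c1 n * z ^ n) \<le> norm (sol_coeff l k p q c0 c1 n) * ((4 * r + 1) ^ n * (1/4) ^ n)"
      unfolding norm_mult norm_power by (intro mult_left_mono z4) auto
    also have "\<dots> \<le> B * (1/4) ^ n" using B(2)[of p q c0 c1 n] h by (simp add: mult.assoc[symmetric] mult_right_mono)
    also have "\<dots> \<le> B * (1/2) ^ n" using B(1) by (intro mult_left_mono power_mono) auto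
    finally show "norm (sol_coeff l k p q c0 c1 n * z ^ n) \<le> B * (1/2) ^ n" .
    have two: "real (Suc n) \<le> 2 ^ n" by (induction n) auto
    have "norm (diffs (sol_coeff l k p q c0 c1) n * z ^ n) = real (Suc n) * norm (sol_coeff l k p q c0 c1 (Suc n)) * norm z ^ n"
      by (simp add: diffs_def norm_mult norm_power del: of_nat_Suc)
    also have "\<dots> \<le> 2 ^ n * norm (sol_coeff l k p q c0 c1 (Suc n)) * ((4 * r + 1) ^ n * (1/4) ^ n)"
      using two z4[of n] by (intro mult_mono) auto
    also have "\<dots> = (norm (sol_coeff l k p q c0 c1 (Suc n)) * (4 * r + 1) ^ n) * (2 ^ n * (1/4) ^ n)" by simp
    also have "2 ^ n * (1/4) ^ n = (1/2 :: real) ^ n" by (simp flip: power_mult_distrib)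
    also have "norm (sol_coeff l k p q c0 c1 (Suc n)) * (4 * r + 1) ^ n \<le> norm (sol_coeff l k p q c0 c1 (Suc n)) * (4 * r + 1) ^ Suc n"
      using assms by (intro mult_left_mono power_increasing) auto
    also have "\<dots> \<le> B" using B(2)[of p q c0 c1 "Suc n"] h by simp
    finally show "norm (diffs (sol_coeff l k p q c0 c1) n * z ^ n) \<le> B * (1/2) ^ n" by (simp add: mult_right_mono)
  qed
qed

lemma summable_sol_coeff: "summable (\<lambda>n. sol_coeff l k p q c0 c1 n * z ^ n)"
proof -
  define M where "M = norm p + norm q + norm c0 + norm c1"
  have "norm p \<le> M" "norm q \<le> M" "norm c0 \<le> M" "norm c1 \<le> M" "M \<ge> 0" unfolding M_def by auto
  then obtain B where B: "\<And>n. norm (sol_coeff l k p q c0 c1 n * z ^ n) \<le> B * (1/2) ^ n"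
    using sol_coeff_geometric_bound[of M "norm z" l k] by (metis norm_ge_zero order_refl)
  have "summable (\<lambda>n. B * (1/2) ^ n)" by (rule summable_mult[OF summable_geometric]) simp
  then show ?thesis by (rule summable_comparison_test') (rule B)
qed

lemma summable_diffs_sol_coeff: "summable (\<lambda>n. diffs (sol_coeff l k p q c0 c1) n * z ^ n)"
  by (rule termdiff_converges_all) (rule summable_sol_coeff)

lemma sol_has_field_derivative:
  "(sol l k p q c0 c1 has_field_derivative dsol l k p q c0 c1 z) (at z)"
  unfolding sol_def[abs_def] dsol_def
  by (rule termdiffs_strong_converges_everywhere) (rule summable_sol_coeff)

lemma sums_shift:
  fixes f :: "nat \<Rightarrow> complex"
  assumes "summable (\<lambda>n. f n * z ^ n)"
  shows "(\<lambda>n. (if m \<le> n then c * f (n - m) else 0) * z ^ n) sums (c * z ^ m * (\<Sum>n. f n * z ^ n))"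
proof -
  have "(\<lambda>n. c * z ^ m * (f n * z ^ n)) sums (c * z ^ m * (\<Sum>n. f n * z ^ n))"
    using assms by (intro sums_mult summable_sums)
  also have "(\<lambda>n. c * z ^ m * (f n * z ^ n)) = (\<lambda>n. (if m \<le> n + m then c * f (n + m - m) else 0) * z ^ (n + m))"
    by (auto simp: power_add)
  finally show ?thesis
    using sums_iff_shift[of "\<lambda>n. (if m \<le> n then c * f (n - m) else 0) * z ^ n" m] by simp
qed

lemma dsol_has_field_derivative:
  "(dsol l k p q c0 c1 has_field_derivative (p * z ^ l + q * z ^ k)\<^sup>2 * sol l k p q c0 c1 z) (at z)"
proof -
  let ?c = "sol_coeff l k p q c0 c1"
  have "(dsol l k p q c0 c1 has_field_derivative (\<Sum>n. diffs (diffs ?c) n * z ^ n)) (at z)"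
    unfolding dsol_def[abs_def]
    by (rule termdiffs_strong_converges_everywhere) (rule summable_diffs_sol_coeff)
  moreover have "(\<Sum>n. diffs (diffs ?c) n * z ^ n) = (p * z ^ l + q * z ^ k)\<^sup>2 * sol l k p q c0 c1 z"
  proof -
    have d: "diffs (diffs ?c) n = (if 2 * l \<le> n then p\<^sup>2 * ?c (n - 2 * l) else 0) +
     (if l + k \<le> n then 2 * p * q * ?c (n - (l + k)) else 0) +
     (if 2 * k \<le> n then q\<^sup>2 * ?c (n - 2 * k) else 0)" for n
    proof -
      have "of_nat (n + 1) * of_nat (n + 2) \<noteq> (0 :: complex)"
        by (metis add_is_0 mult_eq_0_iff of_nat_eq_0_iff one_neq_zero zero_neq_numeral)
      then have "of_nat (Suc n) * (of_nat (Suc (Suc n)) * (X / of_nat ((n + 1) * (n + 2)))) = X" for X :: complex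
        by (simp del: of_nat_Suc of_nat_add add: field_simps) (simp add: algebra_simps)
      then show ?thesis unfolding diffs_def sol_coeff.simps .
    qed
    have "(\<lambda>n. diffs (diffs ?c) n * z ^ n) sums (p\<^sup>2 * z ^ (2 * l) * sol l k p q c0 c1 z +
        2 * p * q * z ^ (l + k) * sol l k p q c0 c1 z + q\<^sup>2 * z ^ (2 * k) * sol l k p q c0 c1 z)"
      unfolding d distrib_right[of _ _ "z ^ _"] sol_def by (intro sums_add sums_shift summable_sol_coeff)
    moreover have "p\<^sup>2 * z ^ (2 * l) = (p * z ^ l)\<^sup>2" "q\<^sup>2 * z ^ (2 * k) = (q * z ^ k)\<^sup>2"
      by (simp_all add: power_mult_distrib power_mult[symmetric] mult.commute)
    moreover have "2 * p * q * z ^ (l + k) = 2 * (p * z ^ l) * (q * z ^ k)" by (simp add: power_add)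
    ultimately show ?thesis
      by (simp only: sums_iff power2_sum[of "p * z ^ l" "q * z ^ k"] distrib_right) (simp only: ac_simps)
  qed
  ultimately show ?thesis by simp
qed

lemma sol_0 [simp]: "sol l k p q c0 c1 0 = c0"
  unfolding sol_def by (simp add: powser_zero)

lemma dsol_0 [simp]: "dsol l k p q c0 c1 0 = c1"
  unfolding dsol_def by (simp add: powser_zero diffs_def)

lemma sol_coeff_linear:
  "sol_coeff l k p q (s * c0 + t * d0) (s * c1 + t * d1) n = s * sol_coeff l k p q c0 c1 n + t * sol_coeff l k p q d0 d1 n"
proof (induction l k p q c0 c1 n rule: sol_coeff.induct)
  case (3 l k p q c0 c1 n)
  have fin: "(s * a1 + t * b1) + (s * a2 + t * b2) + (s * a3 + t * b3) = s * (a1 + a2 + a3) + t * (b1 + b2 + b3)" 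
    for a1 a2 a3 b1 b2 b3 :: complex by (simp add: algebra_simps)
  have e: "(if b then x * (s * u + t * v) else 0) = s * (if b then x * u else 0) + t * (if b then x * v else 0)"
    for b and x u v :: complex by (simp add: algebra_simps)
  have IH: "(if 2 * l \<le> n then p\<^sup>2 * sol_coeff l k p q (s * c0 + t * d0) (s * c1 + t * d1) (n - 2 * l) else 0)
      = (if 2 * l \<le> n then p\<^sup>2 * (s * sol_coeff l k p q c0 c1 (n - 2 * l) + t * sol_coeff l k p q d0 d1 (n - 2 * l)) else 0)"
     "(if l + k \<le> n then 2 * p * q * sol_coeff l k p q (s * c0 + t * d0) (s * c1 + t * d1) (n - (l + k)) else 0)
      = (if l + k \<le> n then 2 * p * q * (s * sol_coeff l k p q c0 c1 (n - (l + k)) + t * sol_coeff l k p q d0 d1 (n - (l + k))) else 0)"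
     "(if 2 * k \<le> n then q\<^sup>2 * sol_coeff l k p q (s * c0 + t * d0) (s * c1 + t * d1) (n - 2 * k) else 0)
      = (if 2 * k \<le> n then q\<^sup>2 * (s * sol_coeff l k p q c0 c1 (n - 2 * k) + t * sol_coeff l k p q d0 d1 (n - 2 * k)) else 0)"
    using 3 by auto
  show ?case unfolding sol_coeff.simps IH unfolding e fin by (simp only: add_divide_distrib[of "s * _"] times_divide_eq_right)
qed auto

lemma sol_linear:
  "sol l k p q (s * c0 + t * d0) (s * c1 + t * d1) z = s * sol l k p q c0 c1 z + t * sol l k p q d0 d1 z"
  "dsol l k p q (s * c0 + t * d0) (s * c1 + t * d1) z = s * dsol l k p q c0 c1 z + t * dsol l k p q d0 d1 z"
proof -
  have "(\<lambda>n. s * (sol_coeff l k p q c0 c1 n * z ^ n) + t * (sol_coeff l k p q d0 d1 n * z ^ n)) sums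
     (s * sol l k p q c0 c1 z + t * sol l k p q d0 d1 z)"
    unfolding sol_def by (intro sums_add sums_mult summable_sums summable_sol_coeff)
  then show "sol l k p q (s * c0 + t * d0) (s * c1 + t * d1) z = s * sol l k p q c0 c1 z + t * sol l k p q d0 d1 z"
    unfolding sol_def sol_coeff_linear by (simp add: sums_iff algebra_simps)
  have "(\<lambda>n. s * (diffs (sol_coeff l k p q c0 c1) n * z ^ n) + t * (diffs (sol_coeff l k p q d0 d1) n * z ^ n)) sums
     (s * dsol l k p q c0 c1 z + t * dsol l k p q d0 d1 z)"
    unfolding dsol_def by (intro sums_add sums_mult summable_sums summable_diffs_sol_coeff)
  then show "dsol l k p q (s * c0 + t * d0) (s * c1 + t * d1) z = s * dsol l k p q c0 c1 z + t * dsol l k p q d0 d1 z"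
    unfolding dsol_def diffs_def sol_coeff_linear by (simp add: sums_iff algebra_simps)
qed

text \<open>Substitution of \<open>c * z\<close> for \<open>z\<close>. The equation sees only
  \<open>p^2\<close>, \<open>p * q\<close> and \<open>q^2\<close>, so the hypotheses fix just these.
  This covers the reflection \<open>c = - 1\<close> as well as positive dilations, since
  \<open>(p, q)\<close> matters only up to a common sign.\<close>

lemma sol_coeff_scale:
  assumes "c ^ (2*l + 2) * p\<^sup>2 = p'\<^sup>2" "c ^ (l + k + 2) * (p * q) = p' * q'" "c ^ (2*k + 2) * q\<^sup>2 = q'\<^sup>2"
  shows "sol_coeff l k p' q' c0 (c * c1) n = c ^ n * sol_coeff l k p q c0 c1 n"
  using assms
proof (induction l k p q c0 c1 n rule: sol_coeff.induct)
  case (3 l k p q c0 c1 n)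
  have aux: "(if j \<le> n then x' * (c ^ (n - j) * y) else 0) = c ^ (n + 2) * (if j \<le> n then x * y else 0)"
    if "c ^ (j + 2) * x = x'" for j x x' y
  proof (cases "j \<le> n")
    case True
    then have "c ^ (n + 2) = c ^ (j + 2) * c ^ (n - j)" by (simp flip: power_add)
    then show ?thesis using True that[symmetric] by (simp del: power_Suc add_2_eq_Suc' add_2_eq_Suc)
  qed simp
  have "sol_coeff l k p' q' c0 (c * c1) (Suc (Suc n)) = 
    ((if 2 * l \<le> n then p'\<^sup>2 * (c ^ (n - 2 * l) * sol_coeff l k p q c0 c1 (n - 2 * l)) else 0) +
     (if l + k \<le> n then 2 * p' * q' * (c ^ (n - (l + k)) * sol_coeff l k p q c0 c1 (n - (l + k))) else 0) +
     (if 2 * k \<le> n then q'\<^sup>2 * (c ^ (n - 2 * k) * sol_coeff l k p q c0 c1 (n - 2 * k)) else 0)) / of_nat ((n + 1) * (n + 2))"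
    using 3 by simp
  also have "\<dots> = c ^ (n + 2) * sol_coeff l k p q c0 c1 (Suc (Suc n))"
    unfolding aux[of "2 * l" "p\<^sup>2" "p'\<^sup>2", OF 3(4)] aux[of "2 * k" "q\<^sup>2" "q'\<^sup>2", OF 3(6)] sol_coeff.simps(3)
    by (subst aux[of "l + k" "2 * p * q" "2 * p' * q'"])
      (use 3(5) in \<open>simp add: mult.assoc mult.left_commute, simp only: distrib_left times_divide_eq_right\<close>)
  finally show ?case by simp
qed auto

lemma sol_scale:
  assumes "c ^ (2*l + 2) * p\<^sup>2 = p'\<^sup>2" "c ^ (l + k + 2) * (p * q) = p' * q'" "c ^ (2*k + 2) * q\<^sup>2 = q'\<^sup>2"
  shows "sol l k p' q' c0 (c * c1) z = sol l k p q c0 c1 (c * z)"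
    "dsol l k p' q' c0 (c * c1) z = c * dsol l k p q c0 c1 (c * z)"
proof -
  show "sol l k p' q' c0 (c * c1) z = sol l k p q c0 c1 (c * z)"
    unfolding sol_def sol_coeff_scale[OF assms] by (simp add: power_mult_distrib mult_ac)
  show "dsol l k p' q' c0 (c * c1) z = c * dsol l k p q c0 c1 (c * z)"
    unfolding dsol_def diffs_def sol_coeff_scale[OF assms]
    by (subst suminf_mult[OF summable_diffs_sol_coeff[unfolded diffs_def], symmetric])
      (simp add: power_mult_distrib mult_ac)
qed

lemma sol_coeff_Reals:
  assumes "p \<in> \<real>" "q \<in> \<real>" "c0 \<in> \<real>" "c1 \<in> \<real>"
  shows "sol_coeff l k p q c0 c1 n \<in> \<real>"
  using assms
proof (induction l k p q c0 c1 n rule: sol_coeff.induct)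
  case (3 l k p q c0 c1 n)
  then have "2 * l \<le> n \<Longrightarrow> sol_coeff l k p q c0 c1 (n - 2 * l) \<in> \<real>" "l + k \<le> n \<Longrightarrow> sol_coeff l k p q c0 c1 (n - (l + k)) \<in> \<real>"
     "2 * k \<le> n \<Longrightarrow> sol_coeff l k p q c0 c1 (n - 2 * k) \<in> \<real>" by auto
  then show ?case unfolding sol_coeff.simps using 3(4-7)
    by (intro Reals_divide Reals_add) (auto intro!: Reals_mult Reals_power simp del: of_nat_mult of_nat_add)
qed auto

lemma sol_Reals:
  assumes "p \<in> \<real>" "q \<in> \<real>" "c0 \<in> \<real>" "c1 \<in> \<real>" "z \<in> \<real>"
  shows "sol l k p q c0 c1 z \<in> \<real>" "dsol l k p q c0 c1 z \<in> \<real>"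
proof -
  have *: "(\<Sum>n. f n) \<in> \<real>" if "summable f" "\<And>n. f n \<in> \<real>" for f :: "nat \<Rightarrow> complex"
    using bounded_linear.suminf[OF bounded_linear_Im that(1)] that(2)
    by (simp add: complex_is_Real_iff)
  have c: "sol_coeff l k p q c0 c1 n \<in> \<real>" for n using assms by (intro sol_coeff_Reals)
  show "sol l k p q c0 c1 z \<in> \<real>" unfolding sol_def
    by (intro * summable_sol_coeff Reals_mult Reals_power c assms)
  have "diffs (sol_coeff l k p q c0 c1) n \<in> \<real>" for n
    unfolding diffs_def by (intro Reals_mult c Reals_of_nat)
  then show "dsol l k p q c0 c1 z \<in> \<real>" unfolding dsol_def
    by (intro * summable_diffs_sol_coeff Reals_mult Reals_power assms)
qed


section \<open>Continuous and holomorphic dependence of the solutions on the coefficients\<close>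

text \<open>The point \<open>z\<close> is fixed and the limit is uniform in the parameter
  \<open>w\<close>: the partial sums are polynomials in \<open>P w\<close> and \<open>Q w\<close>,
  so continuity and holomorphy in \<open>w\<close> pass to the limit.\<close>

lemma uniform_limit_sol:
  assumes "\<And>w. w \<in> S \<Longrightarrow> norm (P w) \<le> M" "\<And>w. w \<in> S \<Longrightarrow> norm (Q w) \<le> M"
  shows "uniform_limit S (\<lambda>n w. \<Sum>i<n. sol_coeff l k (P w) (Q w) c0 c1 i * z ^ i) (\<lambda>w. sol l k (P w) (Q w) c0 c1 z) sequentially"
    "uniform_limit S (\<lambda>n w. \<Sum>i<n. diffs (sol_coeff l k (P w) (Q w) c0 c1) i * z ^ i) (\<lambda>w. dsol l k (P w) (Q w) c0 c1 z) sequentially"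
proof -
  define M' where "M' = max 0 M + norm c0 + norm c1"
  have M': "M' \<ge> 0" "norm c0 \<le> M'" "norm c1 \<le> M'" "M \<le> M'"
    unfolding M'_def using norm_ge_zero[of c0] norm_ge_zero[of c1] by (auto simp del: norm_ge_zero)
  obtain B where B: "B \<ge> 0" "\<And>p q n. norm p \<le> M' \<Longrightarrow> norm q \<le> M' \<Longrightarrow>
           norm (sol_coeff l k p q c0 c1 n * z ^ n) \<le> B * (1/2) ^ n \<and>
           norm (diffs (sol_coeff l k p q c0 c1) n * z ^ n) \<le> B * (1/2) ^ n"
    using sol_coeff_geometric_bound[of M' "norm z" l k] M' by (metis norm_ge_zero order_refl)
  have sm: "summable (\<lambda>n. B * (1/2) ^ n)" by (rule summable_mult[OF summable_geometric]) simp
  have w: "norm (P w) \<le> M'" "norm (Q w) \<le> M'" if "w \<in> S" for w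
    using assms[OF that] M' by linarith+
  show "uniform_limit S (\<lambda>n w. \<Sum>i<n. sol_coeff l k (P w) (Q w) c0 c1 i * z ^ i) (\<lambda>w. sol l k (P w) (Q w) c0 c1 z) sequentially"
    unfolding sol_def using B(2) w by (intro Weierstrass_m_test[OF _ sm]) blast
  show "uniform_limit S (\<lambda>n w. \<Sum>i<n. diffs (sol_coeff l k (P w) (Q w) c0 c1) i * z ^ i) (\<lambda>w. dsol l k (P w) (Q w) c0 c1 z) sequentially"
    unfolding dsol_def using B(2) w by (intro Weierstrass_m_test[OF _ sm]) blast
qed

lemma sol_coeff_continuous:
  fixes P Q :: "'a::topological_space \<Rightarrow> complex"
  assumes "continuous_on S P" "continuous_on S Q"
  shows "continuous_on S (\<lambda>w. sol_coeff l k (P w) (Q w) c0 c1 n)"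
proof (induction n rule: less_induct)
  case (less n)
  consider "n = 0" | "n = 1" | m where "n = Suc (Suc m)"
    by (metis One_nat_def not0_implies_Suc)
  then show ?case
  proof cases
    case 3
    have IH: "continuous_on S (\<lambda>w. sol_coeff l k (P w) (Q w) c0 c1 (m - j))" for j using less[of "m - j"] 3 by simp
    have ifc: "continuous_on S (\<lambda>w. if b then f w else 0)" if "continuous_on S f" for b and f :: "'a \<Rightarrow> complex"
      using that by (cases b) auto
    have "of_nat ((m + 1) * (m + 2)) \<noteq> (0 :: complex)" by (simp only: of_nat_eq_0_iff) simp
    then show ?thesis unfolding 3 sol_coeff.simps
      by (intro continuous_on_divide continuous_on_add ifc continuous_on_mult continuous_on_power
          continuous_on_const IH assms ballI)
  qed (auto intro!: continuous_intros)
qed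

lemma sol_coeff_holomorphic:
  assumes "P holomorphic_on S" "Q holomorphic_on S"
  shows "(\<lambda>w. sol_coeff l k (P w) (Q w) c0 c1 n) holomorphic_on S"
proof (induction n rule: less_induct)
  case (less n)
  consider "n = 0" | "n = 1" | m where "n = Suc (Suc m)"
    by (metis One_nat_def not0_implies_Suc)
  then show ?case
  proof cases
    case 3
    have IH: "(\<lambda>w. sol_coeff l k (P w) (Q w) c0 c1 (m - j)) holomorphic_on S" for j using less[of "m - j"] 3 by simp
    have ifc: "(\<lambda>w. if b then f w else 0) holomorphic_on S" if "f holomorphic_on S" for b and f :: "complex \<Rightarrow> complex"
      using that by (cases b) auto
    have "of_nat ((m + 1) * (m + 2)) \<noteq> (0 :: complex)" by (simp only: of_nat_eq_0_iff) simp
    then show ?thesis unfolding 3 sol_coeff.simps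
      by (intro holomorphic_on_divide holomorphic_on_add ifc holomorphic_on_mult holomorphic_on_power
          holomorphic_on_const IH assms)
  qed auto
qed

lemma bounded_pair:
  fixes P Q :: "'a::topological_space \<Rightarrow> complex"
  assumes "compact S" "continuous_on S P" "continuous_on S Q"
  obtains M where "\<And>w. w \<in> S \<Longrightarrow> norm (P w) \<le> M" "\<And>w. w \<in> S \<Longrightarrow> norm (Q w) \<le> M"
proof -
  have "bounded (P ` S)" "bounded (Q ` S)"
    using assms compact_continuous_image compact_imp_bounded by blast+
  then obtain a b where "\<forall>x\<in>P ` S. norm x \<le> a" "\<forall>x\<in>Q ` S. norm x \<le> b" unfolding bounded_iff by blast
  then show ?thesis by (intro that[of "max a b"]) force+
qed

lemma sol_continuous:
  fixes P Q :: "'a::topological_space \<Rightarrow> complex"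
  assumes "compact S" "continuous_on S P" "continuous_on S Q"
  shows "continuous_on S (\<lambda>w. sol l k (P w) (Q w) c0 c1 z)"
    "continuous_on S (\<lambda>w. dsol l k (P w) (Q w) c0 c1 z)"
proof -
  obtain M where M: "\<And>w. w \<in> S \<Longrightarrow> norm (P w) \<le> M" "\<And>w. w \<in> S \<Longrightarrow> norm (Q w) \<le> M"
    using bounded_pair[OF assms] by blast
  show "continuous_on S (\<lambda>w. sol l k (P w) (Q w) c0 c1 z)"
    by (rule uniform_limit_theorem[OF _ uniform_limit_sol(1)[OF M]])
      (auto intro!: always_eventually continuous_intros sol_coeff_continuous assms)
  show "continuous_on S (\<lambda>w. dsol l k (P w) (Q w) c0 c1 z)"
    by (rule uniform_limit_theorem[OF _ uniform_limit_sol(2)[OF M]])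
      (auto intro!: always_eventually continuous_intros sol_coeff_continuous assms simp: diffs_def simp del: of_nat_Suc)
qed

lemma sol_holomorphic:
  assumes "open S" "P holomorphic_on S" "Q holomorphic_on S"
  shows "(\<lambda>w. sol l k (P w) (Q w) c0 c1 z) holomorphic_on S"
    "(\<lambda>w. dsol l k (P w) (Q w) c0 c1 z) holomorphic_on S"
proof -
  have M: "\<exists>d>0. cball w d \<subseteq> S \<and> (\<exists>M. (\<forall>v\<in>cball w d. norm (P v) \<le> M) \<and> (\<forall>v\<in>cball w d. norm (Q v) \<le> M))"
    if w: "w \<in> S" for w
  proof -
    obtain d where d: "d > 0" "cball w d \<subseteq> S" using assms(1) w open_contains_cball by blast
    obtain M where "\<And>v. v \<in> cball w d \<Longrightarrow> norm (P v) \<le> M" "\<And>v. v \<in> cball w d \<Longrightarrow> norm (Q v) \<le> M"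
      using bounded_pair[of "cball w d" P Q] assms(2,3) d(2)
      by (metis compact_cball continuous_on_subset holomorphic_on_imp_continuous_on)
    then show ?thesis using d by blast
  qed
  show "(\<lambda>w. sol l k (P w) (Q w) c0 c1 z) holomorphic_on S"
  proof (rule holomorphic_uniform_sequence[OF assms(1)])
    show "(\<lambda>w. \<Sum>i<n. sol_coeff l k (P w) (Q w) c0 c1 i * z ^ i) holomorphic_on S" for n
      by (intro holomorphic_intros sol_coeff_holomorphic assms)
    show "\<exists>d>0. cball w d \<subseteq> S \<and> uniform_limit (cball w d) (\<lambda>n w. \<Sum>i<n. sol_coeff l k (P w) (Q w) c0 c1 i * z ^ i)
        (\<lambda>w. sol l k (P w) (Q w) c0 c1 z) sequentially" if "w \<in> S" for w
      using M[OF that] uniform_limit_sol(1)[of "cball w _" P _ Q] by meson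
  qed
  show "(\<lambda>w. dsol l k (P w) (Q w) c0 c1 z) holomorphic_on S"
  proof (rule holomorphic_uniform_sequence[OF assms(1)])
    show "(\<lambda>w. \<Sum>i<n. diffs (sol_coeff l k (P w) (Q w) c0 c1) i * z ^ i) holomorphic_on S" for n
      unfolding diffs_def by (intro holomorphic_intros sol_coeff_holomorphic assms)
    show "\<exists>d>0. cball w d \<subseteq> S \<and> uniform_limit (cball w d) (\<lambda>n w. \<Sum>i<n. diffs (sol_coeff l k (P w) (Q w) c0 c1) i * z ^ i)
        (\<lambda>w. dsol l k (P w) (Q w) c0 c1 z) sequentially" if "w \<in> S" for w
      using M[OF that] uniform_limit_sol(2)[of "cball w _" P _ Q] by meson
  qed
qed

section \<open>Real-variable tools for energy estimates\<close>

lemma has_real_derivative_norm_power2: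
  fixes z :: "real \<Rightarrow> complex"
  assumes "(z has_vector_derivative z') (at x)"
  shows "((\<lambda>x. (norm (z x))\<^sup>2) has_real_derivative 2 * (z x \<bullet> z')) (at x)"
proof -
  have "((\<lambda>x. z x \<bullet> z x) has_derivative (\<lambda>h. z x \<bullet> (h *\<^sub>R z') + (h *\<^sub>R z') \<bullet> z x)) (at x)"
    using assms unfolding has_vector_derivative_def by (intro has_derivative_inner)
  then show ?thesis
    unfolding has_field_derivative_def power2_norm_eq_inner
    by (rule has_derivative_eq_rhs) (simp add: fun_eq_iff inner_commute algebra_simps)
qed

lemma convergent_at_top_rate:
  fixes f :: "real \<Rightarrow> complex"
  assumes X: "X > 0" and K: "\<And>x y. X \<le> x \<Longrightarrow> x \<le> y \<Longrightarrow> norm (f y - f x) \<le> K / x"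
  obtains L where "(f \<longlongrightarrow> L) at_top" "\<And>x. X \<le> x \<Longrightarrow> norm (f x - L) \<le> K / x"
proof -
  have K0: "K \<ge> 0" using K[of X X] X by (simp add: zero_le_divide_iff)
  have Kl: "((\<lambda>x. K / x) \<longlongrightarrow> 0) at_top"
    by real_asymp
  have "Cauchy (\<lambda>n. f (real n))"
  proof (rule CauchyI)
    fix e :: real assume e: "e > 0"
    obtain N where N: "\<And>x. x \<ge> N \<Longrightarrow> norm (K / x) < e / 2"
      using order_tendstoD(2)[OF tendsto_norm_zero[OF Kl], of "e / 2"] e unfolding eventually_at_top_linorder by auto
    define M where "M = nat \<lceil>max N X\<rceil>"
    have M: "real n \<ge> N" "real n \<ge> X" if "n \<ge> M" for n using that unfolding M_def by linarith+
    have "norm (f (real m) - f (real n)) < e" if "m \<ge> M" "n \<ge> M" for m n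
    proof -
      have a: "norm (f (real n) - f (real M)) < e / 2" if "n \<ge> M" for n
        using K[of "real M" "real n"] M(1)[of M] M(2)[of M] N[of "real M"] that abs_ge_self[of "K / real M"]
        by (simp del: abs_divide)
      have "f (real m) - f (real n) = (f (real m) - f (real M)) - (f (real n) - f (real M))" by simp
      then show ?thesis using a[OF that(1)] a[OF that(2)] norm_triangle_ineq4 by (smt (verit) field_sum_of_halves)
    qed
    then show "\<exists>M. \<forall>m\<ge>M. \<forall>n\<ge>M. norm (f (real m) - f (real n)) < e" by blast
  qed
  then obtain L where L: "(\<lambda>n. f (real n)) \<longlonglongrightarrow> L" using Cauchy_convergent_iff convergent_def by blast
  have rate: "norm (f x - L) \<le> K / x" if "X \<le> x" for x
  proof -
    have "(\<lambda>n. norm (f (real n) - f x)) \<longlonglongrightarrow> norm (L - f x)" by (intro tendsto_intros L)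
    moreover have "eventually (\<lambda>n. norm (f (real n) - f x) \<le> K / x) sequentially"
    proof -
      have "eventually (\<lambda>n. real n \<ge> x) sequentially" by real_asymp
      then show ?thesis by eventually_elim (use K that in auto)
    qed
    ultimately have "norm (L - f x) \<le> K / x" using tendsto_upperbound by fastforce
    then show ?thesis by (simp add: norm_minus_commute)
  qed
  have "((\<lambda>x. f x - L) \<longlongrightarrow> 0) at_top"
  proof (rule Lim_null_comparison[OF _ Kl])
    show "eventually (\<lambda>x. norm (f x - L) \<le> K / x) at_top"
      unfolding eventually_at_top_linorder using rate by blast
  qed
  then have "(f \<longlongrightarrow> L) at_top" by (simp add: LIM_zero_iff)
  then show ?thesis using rate that by blast
qed

lemma DERIV_mult_exp:
  fixes f g :: "real \<Rightarrow> real"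
  assumes "(f has_real_derivative F) (at t)" "(g has_real_derivative G) (at t)"
  shows "((\<lambda>t. f t * exp (g t)) has_real_derivative F * exp (g t) + exp (g t) * G * f t) (at t)"
  using DERIV_mult[OF assms(1) DERIV_fun_exp[OF assms(2)]] by (simp add: mult_ac)

section \<open>Liouville--Green asymptotics\<close>

text \<open>An undamped and a damped component, coupled by an integrable perturbation that acts on
  their sum. The locale separates the real-variable estimates from the differential equation, for
  which \<open>e\<close> will be the frequency and \<open>b\<close> the error term of the
  approximation.\<close>

locale lg_system =
  fixes z1 z2 b e :: "real \<Rightarrow> complex" and X C :: real
  assumes X: "X > 0" and C: "C \<ge> 0"
    and z1: "\<And>x. X \<le> x \<Longrightarrow> (z1 has_vector_derivative - b x * (z1 x + z2 x)) (at x)"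
    and z2: "\<And>x. X \<le> x \<Longrightarrow> (z2 has_vector_derivative - 2 * e x * z2 x + b x * (z1 x + z2 x)) (at x)"
    and e: "\<And>x. X \<le> x \<Longrightarrow> Re (e x) \<ge> 0"
    and b: "\<And>x. X \<le> x \<Longrightarrow> norm (b x) \<le> C / x\<^sup>2"
begin

definition energy where "energy x = (norm (z1 x))\<^sup>2 + (norm (z2 x))\<^sup>2"

lemma energy_nonneg: "energy x \<ge> 0" unfolding energy_def by simp

lemma inner_b:
  assumes "X \<le> x" shows "\<bar>w \<bullet> (b x * (z1 x + z2 x))\<bar> \<le> C / x\<^sup>2 * (norm w * (norm (z1 x) + norm (z2 x)))"
proof -
  have "\<bar>w \<bullet> (b x * (z1 x + z2 x))\<bar> \<le> norm w * (norm (b x) * norm (z1 x + z2 x))"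
    using Cauchy_Schwarz_ineq2[of w "b x * (z1 x + z2 x)"] by (simp add: norm_mult)
  also have "\<dots> \<le> norm w * (C / x\<^sup>2 * (norm (z1 x) + norm (z2 x)))"
    using b[OF assms] C by (intro mult_left_mono mult_mono norm_triangle_ineq) auto
  finally show ?thesis by (simp only: mult.left_commute mult.assoc)
qed

lemma inner_e: "w \<bullet> (- 2 * v * w) = - 2 * Re v * (norm w)\<^sup>2"
  unfolding cmod_power2 by (simp add: inner_complex_def power2_eq_square algebra_simps)

lemma two_mult_le: "(norm (z1 x) + norm (z2 x))\<^sup>2 \<le> 2 * energy x"
  unfolding energy_def by (smt (verit) power2_diff power2_sum zero_le_power2)

lemma deriv_z1_sq:
  assumes "X \<le> x"
  obtains D where "((\<lambda>x. (norm (z1 x))\<^sup>2) has_real_derivative D) (at x)"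
     "\<bar>D\<bar> \<le> 2 * (C / x\<^sup>2 * (norm (z1 x) * (norm (z1 x) + norm (z2 x))))"
proof -
  have *: "z1 x \<bullet> (- b x * (z1 x + z2 x)) = - (z1 x \<bullet> (b x * (z1 x + z2 x)))" by simp
  show ?thesis
    using that[OF has_real_derivative_norm_power2[OF z1[OF assms]]] inner_b[OF assms, of "z1 x"]
    unfolding * by simp
qed

lemma deriv_z2_sq:
  assumes "X \<le> x"
  obtains D where "((\<lambda>x. (norm (z2 x))\<^sup>2) has_real_derivative D) (at x)"
     "\<bar>D + 4 * Re (e x) * (norm (z2 x))\<^sup>2\<bar> \<le> 2 * (C / x\<^sup>2 * (norm (z2 x) * (norm (z1 x) + norm (z2 x))))"
proof -
  have "z2 x \<bullet> (- 2 * e x * z2 x + b x * (z1 x + z2 x)) + 2 * Re (e x) * (norm (z2 x))\<^sup>2 = z2 x \<bullet> (b x * (z1 x + z2 x))"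
    unfolding inner_add_right inner_e by simp
  then have "2 * (z2 x \<bullet> (- 2 * e x * z2 x + b x * (z1 x + z2 x))) + 4 * Re (e x) * (norm (z2 x))\<^sup>2 = 2 * (z2 x \<bullet> (b x * (z1 x + z2 x)))"
    by simp
  then show ?thesis
    using that[OF has_real_derivative_norm_power2[OF z2[OF assms]]] inner_b[OF assms, of "z2 x"] by simp
qed

text \<open>Because \<open>Re (e x) \<ge> 0\<close>, only the coupling feeds the energy: its
  derivative is at most \<open>4 * C / x^2\<close> times itself. The integrating factor
  \<open>exp (4 * C / x)\<close> stays between 1 and its value at \<open>X\<close>.\<close>

lemma energy_bound:
  assumes "X \<le> x"
  shows "energy x \<le> energy X * exp (4 * C / X)"
proof -
  have "energy x * exp (4 * C / x) \<le> energy X * exp (4 * C / X)"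
  proof (rule DERIV_nonpos_imp_nonincreasing[OF assms])
    fix t assume t: "X \<le> t" "t \<le> x"
    have t0: "t > 0" using t X by linarith
    obtain D1 where D1: "((\<lambda>x. (norm (z1 x))\<^sup>2) has_real_derivative D1) (at t)"
     "\<bar>D1\<bar> \<le> 2 * (C / t\<^sup>2 * (norm (z1 t) * (norm (z1 t) + norm (z2 t))))" using deriv_z1_sq[OF t(1)] .
    obtain D2 where D2: "((\<lambda>x. (norm (z2 x))\<^sup>2) has_real_derivative D2) (at t)"
     "\<bar>D2 + 4 * Re (e t) * (norm (z2 t))\<^sup>2\<bar> \<le> 2 * (C / t\<^sup>2 * (norm (z2 t) * (norm (z1 t) + norm (z2 t))))"
      using deriv_z2_sq[OF t(1)] .
    have "D2 \<le> 2 * (C / t\<^sup>2 * (norm (z2 t) * (norm (z1 t) + norm (z2 t))))"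
      using D2(2) e[OF t(1)] by (smt (verit) mult_nonneg_nonneg zero_le_power2)
    moreover have "2 * (g * (a * (a + c))) + 2 * (g * (c * (a + c))) = 2 * g * (a + c)\<^sup>2" for g a c :: real
      by (simp add: power2_eq_square algebra_simps)
    ultimately have "D1 + D2 \<le> 2 * (C / t\<^sup>2) * (norm (z1 t) + norm (z2 t))\<^sup>2"
      using D1(2) by (smt (verit))
    also have "\<dots> \<le> 2 * (C / t\<^sup>2) * (2 * energy t)" using two_mult_le C by (intro mult_left_mono) auto
    finally have D: "D1 + D2 \<le> 4 * C / t\<^sup>2 * energy t" by simp
    have "((\<lambda>t. energy t * exp (4 * C / t)) has_real_derivative
        (D1 + D2) * exp (4 * C / t) + exp (4 * C / t) * (- (4 * C / t\<^sup>2)) * energy t) (at t)"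
      unfolding energy_def using t0 
      by (intro DERIV_mult_exp DERIV_add D1(1) D2(1)) (auto intro!: derivative_eq_intros simp: power2_eq_square)
    moreover have "(D1 + D2) * exp (4 * C / t) + exp (4 * C / t) * (- (4 * C / t\<^sup>2)) * energy t \<le> 0"
      using mult_right_mono[OF D, of "exp (4 * C / t)"] by (simp add: algebra_simps)
    ultimately show "\<exists>y. ((\<lambda>t. energy t * exp (4 * C / t)) has_real_derivative y) (at t) \<and> y \<le> 0" by blast
  qed
  moreover have "energy x * 1 \<le> energy x * exp (4 * C / x)" using energy_nonneg C X assms by (intro mult_left_mono) auto
  ultimately show ?thesis by linarith
qed

text \<open>The derivative of \<open>z1\<close> is bounded by a constant over \<open>t^2\<close>,
  whose primitive gives the rate \<open>1 / x\<close>. The constant knows the solution only through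
  its energy at \<open>X\<close>, the source of all later uniformity in parameters.\<close>

lemma z1_rate:
  assumes "X \<le> x" "x \<le> y"
  shows "norm (z1 y - z1 x) \<le> C * sqrt (2 * energy X * exp (4 * C / X)) / x"
proof -
  define S where "S = sqrt (2 * energy X * exp (4 * C / X))"
  have S: "norm (z1 t) + norm (z2 t) \<le> S" if "X \<le> t" for t
    unfolding S_def using two_mult_le[of t] energy_bound[OF that] by (intro real_le_rsqrt) auto
  have S0: "S \<ge> 0" unfolding S_def using energy_nonneg by simp
  have x0: "x > 0" using X assms by linarith
  have "norm (z1 y - z1 x) \<le> (- C * S / y) - (- C * S / x)"
  proof (cases "x = y")
    case False
    show ?thesis
    proof (rule differentiable_bound_general[where f' = "\<lambda>t. - b t * (z1 t + z2 t)" and \<phi>' = "\<lambda>t. C * S / t\<^sup>2"])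
      show "x < y" using False assms by simp
      show "continuous_on {x..y} z1" using z1 assms
        by (intro continuous_at_imp_continuous_on ballI) (meson has_vector_derivative_continuous atLeastAtMost_iff order_trans)
      show "continuous_on {x..y} (\<lambda>t. - C * S / t)" using x0 by (intro continuous_intros) auto
      fix t assume t: "x < t" "t < y"
      show "(z1 has_vector_derivative - b t * (z1 t + z2 t)) (at t)"
        using z1[of t] t assms by simp
      show "((\<lambda>t. - C * S / t) has_vector_derivative C * S / t\<^sup>2) (at t)"
        unfolding has_real_derivative_iff_has_vector_derivative[symmetric]
        using t x0 by (auto intro!: derivative_eq_intros simp: power2_eq_square)
      have "norm (- b t * (z1 t + z2 t)) \<le> (C / t\<^sup>2) * S"
        unfolding norm_mult norm_minus_cancel using b[of t] S[of t] t assms C norm_triangle_ineq[of "z1 t" "z2 t"]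
        by (intro mult_mono) auto
      then show "norm (- b t * (z1 t + z2 t)) \<le> C * S / t\<^sup>2" by simp
    qed
  qed simp
  also have "\<dots> \<le> C * S / x" using C S0 x0 assms by simp
  finally show ?thesis unfolding S_def .
qed

lemma z1_limit:
  obtains L where "(z1 \<longlongrightarrow> L) at_top"
    "\<And>x. X \<le> x \<Longrightarrow> norm (z1 x - L) \<le> C * sqrt (2 * energy X * exp (4 * C / X)) / x"
  using convergent_at_top_rate[OF X z1_rate] by blast

text \<open>The cone where \<open>z1\<close> dominates is forward invariant, because \<open>z2\<close> is damped there.\<close>

lemma cone_limit_nonzero:
  assumes x: "X \<le> x" and big: "\<And>t. x \<le> t \<Longrightarrow> Re (e t) \<ge> 2 * C / t\<^sup>2"
    and cone: "norm (z1 x) > norm (z2 x)" and L: "(z1 \<longlongrightarrow> L) at_top"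
  shows "L \<noteq> 0"
proof
  assume "L = 0"
  define h where "h t = (norm (z1 t))\<^sup>2 - (norm (z2 t))\<^sup>2" for t
  have x0: "x > 0" using X x by linarith
  have hx: "h x > 0" unfolding h_def using cone by (simp add: power_strict_mono)
  have mono: "h x * exp (- 4 * C / x) \<le> h y * exp (- 4 * C / y)" if "x \<le> y" for y
  proof (rule DERIV_nonneg_imp_nondecreasing[OF that])
    fix t assume t: "x \<le> t" "t \<le> y"
    have t0: "t > 0" and Xt: "X \<le> t" using t x0 x by linarith+
    obtain D1 where D1: "((\<lambda>x. (norm (z1 x))\<^sup>2) has_real_derivative D1) (at t)"
     "\<bar>D1\<bar> \<le> 2 * (C / t\<^sup>2 * (norm (z1 t) * (norm (z1 t) + norm (z2 t))))" using deriv_z1_sq[OF Xt] .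
    obtain D2 where D2: "((\<lambda>x. (norm (z2 x))\<^sup>2) has_real_derivative D2) (at t)"
     "\<bar>D2 + 4 * Re (e t) * (norm (z2 t))\<^sup>2\<bar> \<le> 2 * (C / t\<^sup>2 * (norm (z2 t) * (norm (z1 t) + norm (z2 t))))"
      using deriv_z2_sq[OF Xt] .
    have "D1 - D2 \<ge> 4 * Re (e t) * (norm (z2 t))\<^sup>2 - 2 * (C / t\<^sup>2) * (norm (z1 t) + norm (z2 t))\<^sup>2"
    proof -
      have "2 * (g * (a * (a + c))) + 2 * (g * (c * (a + c))) = 2 * g * (a + c)\<^sup>2" for g a c :: real
        by (simp add: power2_eq_square algebra_simps)
      then show ?thesis using D1(2) D2(2) by (smt (verit))
    qed
    moreover have "2 * (C / t\<^sup>2) * (norm (z1 t) + norm (z2 t))\<^sup>2 \<le> 2 * (C / t\<^sup>2) * (2 * energy t)"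
      using two_mult_le C by (intro mult_left_mono) auto
    moreover have "2 * C / t\<^sup>2 * (norm (z2 t))\<^sup>2 \<le> Re (e t) * (norm (z2 t))\<^sup>2"
      using big[OF t(1)] by (intro mult_right_mono) auto
    \<comment> \<open>The damping contributes at least \<open>8 * C / t^2\<close> times the square
      of \<open>norm (z2 t)\<close>, the coupling costs at most \<open>4 * C / t^2\<close> times the
      energy. What remains is the multiple \<open>- 4 * C / t^2\<close> of \<open>h t\<close>, so
      \<open>exp (- 4 * C / t)\<close> is the right integrating factor.\<close>
    ultimately have D: "D1 - D2 \<ge> - (4 * C / t\<^sup>2) * h t"
      unfolding h_def energy_def by (simp add: algebra_simps)
    have "((\<lambda>t. h t * exp (- 4 * C / t)) has_real_derivative
        (D1 - D2) * exp (- 4 * C / t) + exp (- 4 * C / t) * (4 * C / t\<^sup>2) * h t) (at t)"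
      unfolding h_def using t0
      by (intro DERIV_mult_exp DERIV_diff D1(1) D2(1)) (auto intro!: derivative_eq_intros simp: power2_eq_square)
    moreover have "(D1 - D2) * exp (- 4 * C / t) + exp (- 4 * C / t) * (4 * C / t\<^sup>2) * h t \<ge> 0"
      using mult_right_mono[OF D, of "exp (- 4 * C / t)"] by (simp add: algebra_simps)
    ultimately show "\<exists>y. ((\<lambda>t. h t * exp (- 4 * C / t)) has_real_derivative y) (at t) \<and> 0 \<le> y" by blast
  qed
  define m where "m = h x * exp (- 4 * C / x)"
  have m: "m > 0" unfolding m_def using hx by simp
  have "(norm (z1 y))\<^sup>2 \<ge> m" if "x \<le> y" for y
  proof -
    have "m \<le> h y * exp (- 4 * C / y)" unfolding m_def by (rule mono[OF that])
    also have "\<dots> \<le> (norm (z1 y))\<^sup>2 * 1"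
      using C x0 that unfolding h_def by (intro mult_mono) (auto simp: divide_nonneg_nonneg)
    finally show ?thesis by simp
  qed
  then have "eventually (\<lambda>y. m \<le> (norm (z1 y))\<^sup>2) at_top" unfolding eventually_at_top_linorder by blast
  moreover have "((\<lambda>y. (norm (z1 y))\<^sup>2) \<longlongrightarrow> (norm L)\<^sup>2) at_top" by (intro tendsto_intros L)
  ultimately have "m \<le> (norm L)\<^sup>2" by (intro tendsto_lowerbound) auto
  then show False using m \<open>L = 0\<close> by simp
qed

text \<open>Contrapositive of the cone argument: a zero limit of \<open>z1\<close> keeps the
  solution out of the cone at every later time. With \<open>norm z1 \<le> norm z2\<close> the
  inequality for \<open>z2\<close> is closed up to \<open>C / t^2\<close>, and the damping
  integrates to \<open>exp (- 4 * A)\<close> for the squared norm.\<close>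

lemma limit_zero_decay:
  assumes x: "X \<le> x" and big: "\<And>t. x \<le> t \<Longrightarrow> Re (e t) \<ge> 2 * C / t\<^sup>2"
    and L: "(z1 \<longlongrightarrow> 0) at_top" and y: "x \<le> y"
    and A: "\<And>t. x \<le> t \<Longrightarrow> (A has_real_derivative Re (e t)) (at t)"
  shows "norm (z1 y) \<le> norm (z2 y)"
    "(norm (z2 y))\<^sup>2 \<le> (norm (z2 x))\<^sup>2 * exp (4 * C / x) * exp (- 4 * (A y - A x))"
proof -
  have dom: "norm (z1 t) \<le> norm (z2 t)" if "x \<le> t" for t
    using cone_limit_nonzero[of t, OF _ _ _ L] big x that by (meson not_le order_trans)
  show "norm (z1 y) \<le> norm (z2 y)" by (rule dom[OF y])
  have x0: "x > 0" using X x by linarith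
  have "(norm (z2 y))\<^sup>2 * exp (4 * A y + 4 * C / y) \<le> (norm (z2 x))\<^sup>2 * exp (4 * A x + 4 * C / x)"
  proof (rule DERIV_nonpos_imp_nonincreasing[OF y])
    fix t assume t: "x \<le> t" "t \<le> y"
    have t0: "t > 0" and Xt: "X \<le> t" using t x0 x by linarith+
    obtain D2 where D2: "((\<lambda>x. (norm (z2 x))\<^sup>2) has_real_derivative D2) (at t)"
     "\<bar>D2 + 4 * Re (e t) * (norm (z2 t))\<^sup>2\<bar> \<le> 2 * (C / t\<^sup>2 * (norm (z2 t) * (norm (z1 t) + norm (z2 t))))"
      using deriv_z2_sq[OF Xt] .
    have "2 * (C / t\<^sup>2 * (norm (z2 t) * (norm (z1 t) + norm (z2 t)))) \<le> 2 * (C / t\<^sup>2 * (norm (z2 t) * (2 * norm (z2 t))))"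
      using dom[OF t(1)] C by (intro mult_left_mono) auto
    then have D: "D2 \<le> (4 * C / t\<^sup>2 - 4 * Re (e t)) * (norm (z2 t))\<^sup>2"
    proof -
      have eq: "2 * (C / t\<^sup>2 * (norm (z2 t) * (2 * norm (z2 t)))) = 4 * C / t\<^sup>2 * (norm (z2 t))\<^sup>2"
        by (simp add: power2_eq_square)
      show ?thesis
        using D2(2) \<open>2 * (C / t\<^sup>2 * (norm (z2 t) * (norm (z1 t) + norm (z2 t)))) \<le> _\<close>
        unfolding left_diff_distrib eq by linarith
    qed
    let ?e = "exp (4 * A t + 4 * C / t)"
    have "((\<lambda>t. (norm (z2 t))\<^sup>2 * exp (4 * A t + 4 * C / t)) has_real_derivative
        D2 * ?e + ?e * (4 * Re (e t) - 4 * C / t\<^sup>2) * (norm (z2 t))\<^sup>2) (at t)"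
      using t0 A[OF t(1)]
      by (intro DERIV_mult_exp D2(1)) (auto intro!: derivative_eq_intros simp: power2_eq_square)
    moreover have "D2 * ?e + ?e * (4 * Re (e t) - 4 * C / t\<^sup>2) * (norm (z2 t))\<^sup>2 \<le> 0"
      using mult_right_mono[OF D, of ?e] by (simp add: algebra_simps)
    ultimately show "\<exists>y. ((\<lambda>t. (norm (z2 t))\<^sup>2 * exp (4 * A t + 4 * C / t)) has_real_derivative y) (at t) \<and> y \<le> 0" by blast
  qed
  then have "(norm (z2 y))\<^sup>2 * exp (4 * C / y) \<le> (norm (z2 x))\<^sup>2 * exp (4 * C / x) * exp (- 4 * (A y - A x))"
    by (simp add: exp_add exp_diff exp_minus field_simps)
  moreover have "(norm (z2 y))\<^sup>2 * 1 \<le> (norm (z2 y))\<^sup>2 * exp (4 * C / y)"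
    using C x0 y by (intro mult_left_mono) auto
  ultimately show "(norm (z2 y))\<^sup>2 \<le> (norm (z2 x))\<^sup>2 * exp (4 * C / x) * exp (- 4 * (A y - A x))" by linarith
qed

end

section \<open>Liouville--Green variables\<close>

definition freq :: "nat \<Rightarrow> nat \<Rightarrow> complex \<Rightarrow> complex \<Rightarrow> complex \<Rightarrow> complex" where
  "freq l k p q z = p * z ^ l + q * z ^ k"
text \<open>The truncated exponents here and in \<open>freq''\<close> are harmless: wherever
  truncation occurs, the integer factor in front is 0.\<close>

definition freq' :: "nat \<Rightarrow> nat \<Rightarrow> complex \<Rightarrow> complex \<Rightarrow> complex \<Rightarrow> complex" where
  "freq' l k p q z = p * (of_nat l * z ^ (l - 1)) + q * (of_nat k * z ^ (k - 1))"
definition freq'' :: "nat \<Rightarrow> nat \<Rightarrow> complex \<Rightarrow> complex \<Rightarrow> complex \<Rightarrow> complex" where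
  "freq'' l k p q z = p * (of_nat l * (of_nat (l - 1) * z ^ (l - 1 - 1))) + q * (of_nat k * (of_nat (k - 1) * z ^ (k - 1 - 1)))"
definition freq_int :: "nat \<Rightarrow> nat \<Rightarrow> complex \<Rightarrow> complex \<Rightarrow> complex \<Rightarrow> complex" where
  "freq_int l k p q z = p * z ^ (l + 1) / of_nat (l + 1) + q * z ^ (k + 1) / of_nat (k + 1)"
text \<open>With \<open>a = freq\<close> this is half of \<open>a^(-1/2)\<close> times the second
  derivative of \<open>a^(-1/2)\<close>, the usual error term of the Liouville--Green
  approximation.\<close>

definition coupling :: "nat \<Rightarrow> nat \<Rightarrow> complex \<Rightarrow> complex \<Rightarrow> complex \<Rightarrow> complex" where
  "coupling l k p q z = 3 * (freq' l k p q z)\<^sup>2 / (8 * (freq l k p q z) ^ 3) - freq'' l k p q z / (4 * (freq l k p q z)\<^sup>2)"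
definition prefactor :: "nat \<Rightarrow> nat \<Rightarrow> complex \<Rightarrow> complex \<Rightarrow> complex \<Rightarrow> complex" where
  "prefactor l k p q z = inverse (csqrt (freq l k p q z))"

text \<open>Liouville--Green variables for \<open>y'' = a\<^sup>2 y\<close> with \<open>a = freq\<close> and primitive \<open>A = freq_int\<close>: along
  \<open>a\<^sup>-\<^sup>1\<^sup>/\<^sup>2 exp A\<close> the pair \<open>(Z1, Z2)\<close> is approximately \<open>(1, 0)\<close>, along \<open>a\<^sup>-\<^sup>1\<^sup>/\<^sup>2 exp (- A)\<close> it is
  approximately \<open>(0, exp (- 2 A))\<close>. Hence a solution stays bounded on the half line as soon as the
  limit of \<open>Z1\<close> vanishes.\<close>

definition Z1 :: "nat \<Rightarrow> nat \<Rightarrow> complex \<Rightarrow> complex \<Rightarrow> complex \<Rightarrow> complex \<Rightarrow> complex \<Rightarrow> complex" where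
  "Z1 l k p q c0 c1 z = prefactor l k p q z * exp (- freq_int l k p q z) *
     (dsol l k p q c0 c1 z + (freq l k p q z + freq' l k p q z / (2 * freq l k p q z)) * sol l k p q c0 c1 z) / 2"
definition Z2 :: "nat \<Rightarrow> nat \<Rightarrow> complex \<Rightarrow> complex \<Rightarrow> complex \<Rightarrow> complex \<Rightarrow> complex \<Rightarrow> complex" where
  "Z2 l k p q c0 c1 z = prefactor l k p q z * exp (- freq_int l k p q z) *
     (- dsol l k p q c0 c1 z + (freq l k p q z - freq' l k p q z / (2 * freq l k p q z)) * sol l k p q c0 c1 z) / 2"

lemma freq_deriv: "(freq l k p q has_field_derivative freq' l k p q z) (at z)"
  unfolding freq_def[abs_def] freq'_def by (auto intro!: derivative_eq_intros)

lemma freq'_deriv: "(freq' l k p q has_field_derivative freq'' l k p q z) (at z)"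
  unfolding freq'_def[abs_def] freq''_def by (auto intro!: derivative_eq_intros)

lemma freq_int_deriv: "(freq_int l k p q has_field_derivative freq l k p q z) (at z)"
proof -
  have "((\<lambda>z. c * z ^ (n + 1) / of_nat (n + 1)) has_field_derivative c * z ^ n) (at z)" for c :: complex and n
  proof (rule DERIV_cong[OF DERIV_cdivide[OF DERIV_cmult[OF DERIV_power[OF DERIV_ident]]]])
    have "of_nat (n + 1) \<noteq> (0 :: complex)" by (simp only: of_nat_eq_0_iff)
    then show "c * (of_nat (n + 1) * (1 * z ^ (n + 1 - Suc 0))) / of_nat (n + 1) = c * z ^ n" by simp
  qed
  then show ?thesis
    unfolding freq_int_def[abs_def] freq_def by (intro DERIV_add)
qed

lemma prefactor_deriv:
  assumes "freq l k p q z \<notin> \<real>\<^sub>\<le>\<^sub>0"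
  shows "(prefactor l k p q has_field_derivative - (freq' l k p q z / (2 * freq l k p q z)) * prefactor l k p q z) (at z)"
proof -
  have nz: "csqrt (freq l k p q z) \<noteq> 0" using assms by auto
  have "(prefactor l k p q has_field_derivative - (inverse (csqrt (freq l k p q z)) * (inverse (2 * csqrt (freq l k p q z)) * freq' l k p q z) * inverse (csqrt (freq l k p q z)))) (at z)"
    unfolding prefactor_def[abs_def]
    by (rule DERIV_inverse'[OF DERIV_chain2[OF has_field_derivative_csqrt[OF assms] freq_deriv] nz])
  moreover have "(csqrt (freq l k p q z))\<^sup>2 = freq l k p q z" by simp
  then have "inverse (csqrt (freq l k p q z)) * (inverse (2 * csqrt (freq l k p q z)) * freq' l k p q z) * inverse (csqrt (freq l k p q z))
     = freq' l k p q z / (2 * freq l k p q z) * prefactor l k p q z"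
    unfolding prefactor_def using nz by (simp add: field_simps power2_eq_square)
  ultimately show ?thesis by (simp only: mult_minus_left)
qed

text \<open>Stated for arbitrary functions, so that the algebra runs over few atoms. Both error
  terms contain \<open>s z * exp (- A z) * (a z * y z)\<close> because this is the sum of the two
  transformed components.\<close>

lemma liouville_green_deriv:
  fixes a a' s A y y' :: "complex \<Rightarrow> complex"
  assumes a: "(a has_field_derivative a' z) (at z)" and a': "(a' has_field_derivative a2) (at z)"
    and s: "(s has_field_derivative - (a' z / (2 * a z)) * s z) (at z)"
    and A: "(A has_field_derivative a z) (at z)"
    and y: "(y has_field_derivative y' z) (at z)" and y': "(y' has_field_derivative (a z)\<^sup>2 * y z) (at z)"
    and nz: "a z \<noteq> 0"
  defines "b \<equiv> 3 * (a' z)\<^sup>2 / (8 * a z ^ 3) - a2 / (4 * (a z)\<^sup>2)"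
  shows "((\<lambda>z. s z * exp (- A z) * (y' z + (a z + a' z / (2 * a z)) * y z) / 2) has_field_derivative
     - b * (s z * exp (- A z) * (a z * y z))) (at z)"
   "((\<lambda>z. s z * exp (- A z) * (- y' z + (a z - a' z / (2 * a z)) * y z) / 2) has_field_derivative
     - 2 * a z * (s z * exp (- A z) * (- y' z + (a z - a' z / (2 * a z)) * y z) / 2) + b * (s z * exp (- A z) * (a z * y z))) (at z)"
proof -
  have r: "((\<lambda>z. a' z / (2 * a z)) has_field_derivative (a2 * (2 * a z) - a' z * (2 * a' z)) / (2 * a z)\<^sup>2) (at z)"
    unfolding power2_eq_square by (rule DERIV_divide[OF a' DERIV_cmult[OF a]]) (use nz in simp)
  have sE: "((\<lambda>z. s z * exp (- A z)) has_field_derivative (- (a' z / (2 * a z)) - a z) * (s z * exp (- A z))) (at z)"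
    by (rule DERIV_cong[OF DERIV_mult[OF s DERIV_fun_exp[OF DERIV_minus[OF A]]]]) (simp add: algebra_simps)
  have G: "((\<lambda>z. y' z + (a z + a' z / (2 * a z)) * y z) has_field_derivative
     (a z)\<^sup>2 * y z + ((a' z + (a2 * (2 * a z) - a' z * (2 * a' z)) / (2 * a z)\<^sup>2) * y z + y' z * (a z + a' z / (2 * a z)))) (at z)"
    by (intro DERIV_add[OF y' DERIV_mult[OF DERIV_add[OF a r] y]])
  have H: "((\<lambda>z. - y' z + (a z - a' z / (2 * a z)) * y z) has_field_derivative
     - ((a z)\<^sup>2 * y z) + ((a' z - (a2 * (2 * a z) - a' z * (2 * a' z)) / (2 * a z)\<^sup>2) * y z + y' z * (a z - a' z / (2 * a z)))) (at z)"
    by (intro DERIV_add[OF DERIV_minus[OF y'] DERIV_mult[OF DERIV_diff[OF a r] y]])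
  show "((\<lambda>z. s z * exp (- A z) * (y' z + (a z + a' z / (2 * a z)) * y z) / 2) has_field_derivative
     - b * (s z * exp (- A z) * (a z * y z))) (at z)"
    by (rule DERIV_cong[OF DERIV_cdivide[OF DERIV_mult[OF sE G]]])
      (unfold b_def, use nz in \<open>simp add: field_simps power2_eq_square power3_eq_cube\<close>)
  show "((\<lambda>z. s z * exp (- A z) * (- y' z + (a z - a' z / (2 * a z)) * y z) / 2) has_field_derivative
     - 2 * a z * (s z * exp (- A z) * (- y' z + (a z - a' z / (2 * a z)) * y z) / 2) + b * (s z * exp (- A z) * (a z * y z))) (at z)"
    by (rule DERIV_cong[OF DERIV_cdivide[OF DERIV_mult[OF sE H]]])
      (unfold b_def, use nz in \<open>simp add: field_simps power2_eq_square power3_eq_cube\<close>)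
qed


lemma Z1_plus_Z2:
  "Z1 l k p q c0 c1 z + Z2 l k p q c0 c1 z = prefactor l k p q z * exp (- freq_int l k p q z) * (freq l k p q z * sol l k p q c0 c1 z)"
  unfolding Z1_def Z2_def by (simp add: field_simps)

lemma Z_deriv:
  assumes "freq l k p q z \<notin> \<real>\<^sub>\<le>\<^sub>0"
  shows "(Z1 l k p q c0 c1 has_field_derivative - coupling l k p q z * (Z1 l k p q c0 c1 z + Z2 l k p q c0 c1 z)) (at z)"
    "(Z2 l k p q c0 c1 has_field_derivative - 2 * freq l k p q z * Z2 l k p q c0 c1 z +
        coupling l k p q z * (Z1 l k p q c0 c1 z + Z2 l k p q c0 c1 z)) (at z)"
proof -
  have nz: "freq l k p q z \<noteq> 0" using assms by auto
  note L = liouville_green_deriv[OF freq_deriv freq'_deriv prefactor_deriv[OF assms] freq_int_deriv sol_has_field_derivative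
      dsol_has_field_derivative[of l k p q c0 c1 z, folded freq_def] nz]
  show "(Z1 l k p q c0 c1 has_field_derivative - coupling l k p q z * (Z1 l k p q c0 c1 z + Z2 l k p q c0 c1 z)) (at z)"
    unfolding Z1_plus_Z2 coupling_def unfolding Z1_def[abs_def] by (rule L(1))
  show "(Z2 l k p q c0 c1 has_field_derivative - 2 * freq l k p q z * Z2 l k p q c0 c1 z +
        coupling l k p q z * (Z1 l k p q c0 c1 z + Z2 l k p q c0 c1 z)) (at z)"
    unfolding Z1_plus_Z2 coupling_def unfolding Z2_def[abs_def] by (rule L(2))
qed

section \<open>Frequencies in a sector of the right half-plane\<close>

definition freq_norm :: "nat \<Rightarrow> nat \<Rightarrow> complex \<Rightarrow> complex \<Rightarrow> real \<Rightarrow> real" where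
  "freq_norm l k p q x = norm p * x ^ l + norm q * x ^ k"

definition sectorial :: "nat \<Rightarrow> nat \<Rightarrow> complex \<Rightarrow> complex \<Rightarrow> real \<Rightarrow> real \<Rightarrow> real \<Rightarrow> bool" where
  "sectorial l k p q X d \<nu> \<longleftrightarrow> k \<le> l \<and> X > 0 \<and> d > 0 \<and> \<nu> > 0 \<and>
     (\<forall>x\<ge>X. \<nu> \<le> freq_norm l k p q x \<and> d * freq_norm l k p q x \<le> Re (freq l k p q (of_real x)))"

definition coupling_const :: "nat \<Rightarrow> real \<Rightarrow> real \<Rightarrow> real" where
  "coupling_const l d \<nu> = (3 / 8 * (real l)\<^sup>2 / d ^ 3 + (real l)\<^sup>2 / (4 * d\<^sup>2)) / \<nu>"

lemma norm_freq':
  assumes "k \<le> l" "x > 0"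
  shows "norm (freq' l k p q (of_real x)) \<le> real l * freq_norm l k p q x / x"
proof -
  have *: "real n * x ^ (n - 1) \<le> real l * x ^ n / x" if "n \<le> l" for n
  proof (cases n)
    case (Suc m)
    have "real n * x ^ m \<le> real l * x ^ m" using that assms by (intro mult_right_mono) auto
    then show ?thesis using Suc assms by (simp add: field_simps)
  qed (use assms in auto)
  have "norm (freq' l k p q (of_real x)) \<le> norm p * (real l * x ^ (l - 1)) + norm q * (real k * x ^ (k - 1))"
    unfolding freq'_def by (rule order_trans[OF norm_triangle_ineq]) (use assms in \<open>simp add: norm_mult norm_power\<close>)
  also have "\<dots> \<le> norm p * (real l * x ^ l / x) + norm q * (real l * x ^ k / x)"
    using *[of l] *[of k] assms by (intro add_mono mult_left_mono) auto
  also have "\<dots> = real l * freq_norm l k p q x / x" unfolding freq_norm_def using assms by (simp add: field_simps)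
  finally show ?thesis .
qed

lemma norm_freq'':
  assumes "k \<le> l" "x > 0"
  shows "norm (freq'' l k p q (of_real x)) \<le> (real l)\<^sup>2 * freq_norm l k p q x / x\<^sup>2"
proof -
  have *: "real n * (real (n - 1) * x ^ (n - 1 - 1)) \<le> (real l)\<^sup>2 * x ^ n / x\<^sup>2" if "n \<le> l" for n
  proof -
    consider "n = 0" | "n = 1" | m where "n = Suc (Suc m)" by (metis One_nat_def not0_implies_Suc)
    then show ?thesis
    proof cases
      case 3
      have "real n * real (n - 1) * x ^ m \<le> (real l)\<^sup>2 * x ^ m" unfolding power2_eq_square
        using that assms by (intro mult_right_mono mult_mono) auto
      also have "\<dots> = (real l)\<^sup>2 * x ^ n / x\<^sup>2" using 3 assms by (simp add: power2_eq_square)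
      finally show ?thesis using 3 by simp
    qed (use assms in auto)
  qed
  have "norm (freq'' l k p q (of_real x)) \<le> norm p * (real l * (real (l - 1) * x ^ (l - 1 - 1))) + norm q * (real k * (real (k - 1) * x ^ (k - 1 - 1)))"
    unfolding freq''_def by (rule order_trans[OF norm_triangle_ineq]) (use assms in \<open>simp add: norm_mult norm_power\<close>)
  also have "\<dots> \<le> norm p * ((real l)\<^sup>2 * x ^ l / x\<^sup>2) + norm q * ((real l)\<^sup>2 * x ^ k / x\<^sup>2)"
    using *[of l] *[of k] assms by (intro add_mono mult_left_mono) auto
  also have "\<dots> = (real l)\<^sup>2 * freq_norm l k p q x / x\<^sup>2" unfolding freq_norm_def using assms by (simp add: field_simps)
  finally show ?thesis .
qed

lemma coupling_const_nonneg: "d > 0 \<Longrightarrow> \<nu> > 0 \<Longrightarrow> coupling_const l d \<nu> \<ge> 0"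
  unfolding coupling_const_def by simp

text \<open>Each derivative of \<open>freq\<close> costs at most a factor \<open>l / x\<close>
  relative to \<open>freq_norm\<close>, whereas \<open>freq\<close> itself is at least
  \<open>d * freq_norm\<close>. Both quotients keep one power of \<open>freq_norm\<close>, which is
  at least \<open>\<nu>\<close>, and two powers of \<open>x\<close> in the denominator.\<close>

lemma norm_coupling:
  assumes g: "sectorial l k p q X d \<nu>" and x: "X \<le> x"
  shows "norm (coupling l k p q (of_real x)) \<le> coupling_const l d \<nu> / x\<^sup>2"
proof -
  define n where "n = freq_norm l k p q x"
  have kl: "k \<le> l" and x0: "x > 0" and d: "d > 0" and nu: "\<nu> > 0" "\<nu> \<le> n"
    and a: "d * n \<le> norm (freq l k p q (of_real x))"
    using g x complex_Re_le_cmod[of "freq l k p q (of_real x)"] unfolding sectorial_def n_def by (auto intro: order_trans)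
  have n0: "n > 0" using nu by linarith
  have dn: "d * n > 0" using d n0 by simp
  have "norm (coupling l k p q (of_real x)) \<le> 3 * (norm (freq' l k p q (of_real x)))\<^sup>2 / (8 * norm (freq l k p q (of_real x)) ^ 3)
       + norm (freq'' l k p q (of_real x)) / (4 * (norm (freq l k p q (of_real x)))\<^sup>2)"
    unfolding coupling_def by (rule order_trans[OF norm_triangle_ineq4]) (simp add: norm_mult norm_divide norm_power)
  also have "\<dots> \<le> 3 * (real l * n / x)\<^sup>2 / (8 * (d * n) ^ 3) + ((real l)\<^sup>2 * n / x\<^sup>2) / (4 * (d * n)\<^sup>2)"
    using norm_freq'[OF kl x0, of p q] norm_freq''[OF kl x0, of p q] a dn n0 x0 unfolding n_def[symmetric]
    by (intro add_mono frac_le mult_mono power_mono) auto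
  also have "\<dots> = (3 / 8 * (real l)\<^sup>2 / d ^ 3 + (real l)\<^sup>2 / (4 * d\<^sup>2)) / n / x\<^sup>2"
    using n0 d x0 by (simp add: field_simps power2_eq_square power3_eq_cube)
  also have "\<dots> \<le> coupling_const l d \<nu> / x\<^sup>2" unfolding coupling_const_def
    using nu d by (intro divide_right_mono divide_left_mono) auto
  finally show ?thesis .
qed

lemma sectorial_Re:
  assumes "sectorial l k p q X d \<nu>" "X \<le> x"
  shows "Re (freq l k p q (of_real x)) \<ge> d * \<nu>" "Re (freq l k p q (of_real x)) > 0"
    "freq l k p q (of_real x) \<notin> \<real>\<^sub>\<le>\<^sub>0"
proof -
  have "d * \<nu> \<le> d * freq_norm l k p q x" "d * \<nu> > 0" using assms unfolding sectorial_def by auto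
  then show *: "Re (freq l k p q (of_real x)) \<ge> d * \<nu>" "Re (freq l k p q (of_real x)) > 0"
    using assms unfolding sectorial_def by (meson order_trans less_le_trans)+
  then show "freq l k p q (of_real x) \<notin> \<real>\<^sub>\<le>\<^sub>0" by (auto simp: complex_nonpos_Reals_iff)
qed

lemma sectorial_lg_system:
  assumes g: "sectorial l k p q X d \<nu>"
  shows "lg_system (\<lambda>x. Z1 l k p q c0 c1 (of_real x)) (\<lambda>x. Z2 l k p q c0 c1 (of_real x))
     (\<lambda>x. coupling l k p q (of_real x)) (\<lambda>x. freq l k p q (of_real x)) X (coupling_const l d \<nu>)"
proof
  show "X > 0" "coupling_const l d \<nu> \<ge> 0" using g coupling_const_nonneg unfolding sectorial_def by auto
  fix x assume x: "X \<le> x"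
  note Z = Z_deriv[OF sectorial_Re(3)[OF g x], of c0 c1]
  show "((\<lambda>x. Z1 l k p q c0 c1 (of_real x)) has_vector_derivative
     - coupling l k p q (of_real x) * (Z1 l k p q c0 c1 (of_real x) + Z2 l k p q c0 c1 (of_real x))) (at x)"
    using has_vector_derivative_real_field[OF Z(1)] by simp
  show "((\<lambda>x. Z2 l k p q c0 c1 (of_real x)) has_vector_derivative
     - 2 * freq l k p q (of_real x) * Z2 l k p q c0 c1 (of_real x) +
     coupling l k p q (of_real x) * (Z1 l k p q c0 c1 (of_real x) + Z2 l k p q c0 c1 (of_real x))) (at x)"
    using has_vector_derivative_real_field[OF Z(2)] by simp
  show "0 \<le> Re (freq l k p q (of_real x))" using sectorial_Re[OF g x] by simp
  show "norm (coupling l k p q (of_real x)) \<le> coupling_const l d \<nu> / x\<^sup>2" by (rule norm_coupling[OF g x])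
qed

section \<open>Amplitude of the dominant solution\<close>

text \<open>Twice \<open>Z1\<close> is the Wronskian of the approximate recessive solution
  \<open>prefactor * exp (- freq_int)\<close> with \<open>sol\<close>. The limit is therefore half
  the Wronskian with the true recessive solution, in other words the coefficient of the growing
  Liouville--Green solution.\<close>

definition amplitude :: "nat \<Rightarrow> nat \<Rightarrow> complex \<Rightarrow> complex \<Rightarrow> complex \<Rightarrow> complex \<Rightarrow> complex" where
  "amplitude l k p q c0 c1 = Lim at_top (\<lambda>x::real. Z1 l k p q c0 c1 (of_real x))"

definition Z_energy :: "nat \<Rightarrow> nat \<Rightarrow> complex \<Rightarrow> complex \<Rightarrow> complex \<Rightarrow> complex \<Rightarrow> real \<Rightarrow> real" where
  "Z_energy l k p q c0 c1 X = (norm (Z1 l k p q c0 c1 (of_real X)))\<^sup>2 + (norm (Z2 l k p q c0 c1 (of_real X)))\<^sup>2"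

lemma amplitude_limit:
  assumes g: "sectorial l k p q X d \<nu>"
  shows "((\<lambda>x::real. Z1 l k p q c0 c1 (of_real x)) \<longlongrightarrow> amplitude l k p q c0 c1) at_top"
    "X \<le> x \<Longrightarrow> norm (Z1 l k p q c0 c1 (of_real x) - amplitude l k p q c0 c1) \<le>
       coupling_const l d \<nu> * sqrt (2 * Z_energy l k p q c0 c1 X * exp (4 * coupling_const l d \<nu> / X)) / x"
    "norm (amplitude l k p q c0 c1) \<le> sqrt (Z_energy l k p q c0 c1 X * exp (4 * coupling_const l d \<nu> / X))"
proof -
  interpret lg_system "\<lambda>x. Z1 l k p q c0 c1 (of_real x)" "\<lambda>x. Z2 l k p q c0 c1 (of_real x)"
     "\<lambda>x. coupling l k p q (of_real x)" "\<lambda>x. freq l k p q (of_real x)" X "coupling_const l d \<nu>"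
    by (rule sectorial_lg_system[OF g])
  have EE: "energy X = Z_energy l k p q c0 c1 X" unfolding energy_def Z_energy_def ..
  obtain L where L: "((\<lambda>x::real. Z1 l k p q c0 c1 (of_real x)) \<longlongrightarrow> L) at_top"
    "\<And>x. X \<le> x \<Longrightarrow> norm (Z1 l k p q c0 c1 (of_real x) - L) \<le> coupling_const l d \<nu> * sqrt (2 * Z_energy l k p q c0 c1 X * exp (4 * coupling_const l d \<nu> / X)) / x"
    using z1_limit unfolding EE by blast
  have JL: "amplitude l k p q c0 c1 = L" unfolding amplitude_def by (rule tendsto_Lim[OF _ L(1)]) simp
  show "((\<lambda>x::real. Z1 l k p q c0 c1 (of_real x)) \<longlongrightarrow> amplitude l k p q c0 c1) at_top" using L JL by simp
  show "X \<le> x \<Longrightarrow> norm (Z1 l k p q c0 c1 (of_real x) - amplitude l k p q c0 c1) \<le>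
       coupling_const l d \<nu> * sqrt (2 * Z_energy l k p q c0 c1 X * exp (4 * coupling_const l d \<nu> / X)) / x" using L JL by simp
  have "norm (Z1 l k p q c0 c1 (of_real x)) \<le> sqrt (Z_energy l k p q c0 c1 X * exp (4 * coupling_const l d \<nu> / X))" if "X \<le> x" for x
  proof (rule real_le_rsqrt)
    have "(norm (Z1 l k p q c0 c1 (of_real x)))\<^sup>2 \<le> energy x" unfolding energy_def by simp
    then show "(norm (Z1 l k p q c0 c1 (of_real x)))\<^sup>2 \<le> Z_energy l k p q c0 c1 X * exp (4 * coupling_const l d \<nu> / X)"
      using energy_bound[OF that] unfolding EE by linarith
  qed
  then have "eventually (\<lambda>x. norm (Z1 l k p q c0 c1 (of_real x)) \<le> sqrt (Z_energy l k p q c0 c1 X * exp (4 * coupling_const l d \<nu> / X))) at_top"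
    unfolding eventually_at_top_linorder by blast
  then show "norm (amplitude l k p q c0 c1) \<le> sqrt (Z_energy l k p q c0 c1 X * exp (4 * coupling_const l d \<nu> / X))"
    unfolding JL using tendsto_norm[OF L(1)] by (intro tendsto_upperbound) auto
qed

lemma Z_linear:
  "Z1 l k p q (s * c0 + t * d0) (s * c1 + t * d1) z = s * Z1 l k p q c0 c1 z + t * Z1 l k p q d0 d1 z"
  "Z2 l k p q (s * c0 + t * d0) (s * c1 + t * d1) z = s * Z2 l k p q c0 c1 z + t * Z2 l k p q d0 d1 z"
  unfolding Z1_def Z2_def sol_linear by (simp_all add: algebra_simps add_divide_distrib diff_divide_distrib)

lemma amplitude_linear:
  assumes g: "sectorial l k p q X d \<nu>"
  shows "amplitude l k p q (s * c0 + t * d0) (s * c1 + t * d1) = s * amplitude l k p q c0 c1 + t * amplitude l k p q d0 d1"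
proof -
  have "((\<lambda>x::real. Z1 l k p q (s * c0 + t * d0) (s * c1 + t * d1) (of_real x)) \<longlongrightarrow> s * amplitude l k p q c0 c1 + t * amplitude l k p q d0 d1) at_top"
    unfolding Z_linear by (intro tendsto_intros amplitude_limit(1)[OF g])
  then show ?thesis unfolding amplitude_def[of l k p q "s * c0 + t * d0"] by (intro tendsto_Lim) simp_all
qed

lemma amplitude_basis:
  assumes g: "sectorial l k p q X d \<nu>"
  shows "amplitude l k p q c0 c1 = c0 * amplitude l k p q 1 0 + c1 * amplitude l k p q 0 1"
  using amplitude_linear[OF g, of c0 1 c1 0 0 1] by simp

lemma sol_wronskian:
  "sol l k p q 1 0 z * dsol l k p q 0 1 z - dsol l k p q 1 0 z * sol l k p q 0 1 z = 1"
proof -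
  let ?connection = "\<lambda>z. sol l k p q 1 0 z * dsol l k p q 0 1 z - dsol l k p q 1 0 z * sol l k p q 0 1 z"
  have "(?connection has_field_derivative 0) (at z)" for z
    by (auto intro!: derivative_eq_intros sol_has_field_derivative dsol_has_field_derivative simp: algebra_simps)
  then have "\<exists>c. \<forall>z\<in>UNIV. ?connection z = c" by (intro has_field_derivative_zero_constant) auto
  then have "?connection z = ?connection 0" by (metis UNIV_I)
  then show ?thesis by simp
qed

text \<open>The passage from \<open>(sol, dsol)\<close> to \<open>(Z1, Z2)\<close> is linear, and
  its determinant is a nonzero multiple of \<open>freq\<close> times the square of
  \<open>prefactor * exp (- freq_int)\<close>. Hence data can be prescribed in the variables
  \<open>Z1\<close>, \<open>Z2\<close>.\<close>

lemma Z_wronskian: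
  assumes "freq l k p q z \<notin> \<real>\<^sub>\<le>\<^sub>0"
  shows "Z1 l k p q 1 0 z * Z2 l k p q 0 1 z - Z1 l k p q 0 1 z * Z2 l k p q 1 0 z \<noteq> 0"
proof -
  let ?s = "prefactor l k p q z * exp (- freq_int l k p q z)" and ?a = "freq l k p q z"
  have nz: "?a \<noteq> 0" "?s \<noteq> 0" using assms unfolding prefactor_def by auto
  have gen: "(s * (u' + (a + r) * u) / 2) * (s * (- v' + (a - r) * v) / 2) - (s * (v' + (a + r) * v) / 2) * (s * (- u' + (a - r) * u) / 2)
     = - (s * s * a / 2) * (u * v' - u' * v)" for s u u' v v' a r :: complex
    by (simp add: field_simps)
  have "Z1 l k p q 1 0 z * Z2 l k p q 0 1 z - Z1 l k p q 0 1 z * Z2 l k p q 1 0 z = - (?s * ?s * ?a / 2)"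
    unfolding Z1_def Z2_def gen sol_wronskian by simp
  then show ?thesis using nz by simp
qed

lemma sectorial_eventually_big:
  assumes g: "sectorial l k p q X d \<nu>"
  obtains Y where "X \<le> Y" "\<And>t. Y \<le> t \<Longrightarrow> Re (freq l k p q (of_real t)) \<ge> 2 * coupling_const l d \<nu> / t\<^sup>2"
proof
  define C where "C = coupling_const l d \<nu>"
  have d: "d > 0" "\<nu> > 0" "X > 0" using g unfolding sectorial_def by auto
  have C: "C \<ge> 0" unfolding C_def using coupling_const_nonneg d by auto
  define Y where "Y = max X (max 1 (2 * C / (d * \<nu>)))"
  show "X \<le> Y" unfolding Y_def by simp
  fix t assume t: "Y \<le> t"
  then have t1: "t \<ge> 1" "t \<ge> 2 * C / (d * \<nu>)" "X \<le> t" unfolding Y_def by auto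
  have "2 * C / t\<^sup>2 \<le> 2 * C / t" using C t1 by (intro divide_left_mono) (auto simp: power2_eq_square)
  also have "\<dots> \<le> d * \<nu>" using t1 d by (simp add: field_simps)
  also have "\<dots> \<le> Re (freq l k p q (of_real t))" using sectorial_Re[OF g t1(3)] by simp
  finally show "Re (freq l k p q (of_real t)) \<ge> 2 * coupling_const l d \<nu> / t\<^sup>2" unfolding C_def .
qed

text \<open>Cramer's rule gives data with \<open>Z2 = 0\<close> at \<open>Y\<close>, and then
  \<open>Z1\<close> is the determinant from \<open>Z_wronskian\<close>. Such a solution starts
  inside the cone of \<open>cone_limit_nonzero\<close>.\<close>

lemma amplitude_nontrivial:
  assumes g: "sectorial l k p q X d \<nu>"
  shows "amplitude l k p q 1 0 \<noteq> 0 \<or> amplitude l k p q 0 1 \<noteq> 0"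
proof (rule ccontr)
  assume n: "\<not> (amplitude l k p q 1 0 \<noteq> 0 \<or> amplitude l k p q 0 1 \<noteq> 0)"
  obtain Y where Y: "X \<le> Y" "\<And>t. Y \<le> t \<Longrightarrow> Re (freq l k p q (of_real t)) \<ge> 2 * coupling_const l d \<nu> / t\<^sup>2"
    using sectorial_eventually_big[OF g] by blast
  define c0 where "c0 = Z2 l k p q 0 1 (of_real Y)"
  define c1 where "c1 = - Z2 l k p q 1 0 (of_real Y)"
  have lin: "Z1 l k p q c0 c1 z = c0 * Z1 l k p q 1 0 z + c1 * Z1 l k p q 0 1 z"
    "Z2 l k p q c0 c1 z = c0 * Z2 l k p q 1 0 z + c1 * Z2 l k p q 0 1 z" for z
    using Z_linear[of l k p q c0 1 c1 0 0 1 z] by simp_all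
  have "Z2 l k p q c0 c1 (of_real Y) = 0" unfolding lin by (simp add: c0_def c1_def)
  moreover have "Z1 l k p q c0 c1 (of_real Y) \<noteq> 0"
    using Z_wronskian[OF sectorial_Re(3)[OF g Y(1)]] unfolding lin by (simp add: c0_def c1_def algebra_simps)
  ultimately have "amplitude l k p q c0 c1 \<noteq> 0"
    using lg_system.cone_limit_nonzero[OF sectorial_lg_system[OF g, of c0 c1] Y(1) Y(2) _ amplitude_limit(1)[OF g]] by simp
  then show False using n amplitude_basis[OF g, of c0 c1] by simp
qed

text \<open>Up to the square root of \<open>freq\<close>, which is bounded below, \<open>sol\<close>
  is \<open>(Z1 + Z2) * exp freq_int\<close>. A zero amplitude makes both components decay like
  \<open>exp (- 2 * A)\<close>, which outweighs \<open>exp A\<close>; the remaining interval is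
  compact.\<close>

lemma amplitude_zero_bounded:
  assumes g: "sectorial l k p q X d \<nu>" and J0: "amplitude l k p q c0 c1 = 0"
  shows "\<exists>B. \<forall>x\<ge>0::real. norm (sol l k p q c0 c1 (of_real x)) \<le> B"
proof -
  obtain Y where Y: "X \<le> Y" "\<And>t. Y \<le> t \<Longrightarrow> Re (freq l k p q (of_real t)) \<ge> 2 * coupling_const l d \<nu> / t\<^sup>2"
    using sectorial_eventually_big[OF g] by blast
  have d: "d > 0" "\<nu> > 0" "X > 0" using g unfolding sectorial_def by auto
  define A where "A t = Re (freq_int l k p q (of_real t))" for t
  define K where "K = norm (Z2 l k p q c0 c1 (of_real Y)) * exp (2 * coupling_const l d \<nu> / Y)"
  have dA: "(A has_real_derivative Re (freq l k p q (of_real t))) (at t)" for t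
    unfolding A_def[abs_def] has_real_derivative_iff_has_vector_derivative
    using bounded_linear.has_vector_derivative[OF bounded_linear_Re has_vector_derivative_real_field[OF freq_int_deriv]] by simp
  have bd: "norm (sol l k p q c0 c1 (of_real x)) \<le> 2 * K * exp (- A Y + 2 * A Y) * inverse (sqrt (d * \<nu>))" if x: "Y \<le> x" for x
  proof -
    have Xx: "X \<le> x" using x Y by simp
    have nz: "freq l k p q (of_real x) \<noteq> 0" using sectorial_Re(2)[OF g Xx] by auto
    note D = lg_system.limit_zero_decay[OF sectorial_lg_system[OF g, of c0 c1] Y(1) Y(2) amplitude_limit(1)[OF g, of c0 c1, unfolded J0] x dA]
    have "exp (- 4 * (A x - A Y)) = (exp (- 2 * (A x - A Y)))\<^sup>2" "exp (4 * coupling_const l d \<nu> / Y) = (exp (2 * coupling_const l d \<nu> / Y))\<^sup>2"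
      by (simp_all flip: exp_double add: algebra_simps)
    then have "(norm (Z2 l k p q c0 c1 (of_real x)))\<^sup>2 \<le> (K * exp (- 2 * (A x - A Y)))\<^sup>2"
      using D(2) unfolding K_def by (simp add: power_mult_distrib)
    then have z2: "norm (Z2 l k p q c0 c1 (of_real x)) \<le> K * exp (- 2 * (A x - A Y))"
      by (rule power2_le_imp_le) (simp add: K_def)
    \<comment> \<open>The resulting bound \<open>exp (- A x)\<close> is traded for its value at
      \<open>Y\<close>: only boundedness is wanted, not decay.\<close>
    have AY: "A Y \<le> A x"
      by (rule DERIV_nonneg_imp_nondecreasing[OF x]) (use dA sectorial_Re(2)[OF g] Y(1) in \<open>meson less_imp_le order_trans\<close>)
    have cs: "sqrt (d * \<nu>) \<le> norm (csqrt (freq l k p q (of_real x)))"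
    proof (rule power2_le_imp_le)
      have "(norm (csqrt (freq l k p q (of_real x))))\<^sup>2 = norm (freq l k p q (of_real x))" by (simp flip: norm_power)
      then show "(sqrt (d * \<nu>))\<^sup>2 \<le> (norm (csqrt (freq l k p q (of_real x))))\<^sup>2"
        using d sectorial_Re(1)[OF g Xx] complex_Re_le_cmod[of "freq l k p q (of_real x)"] by simp
    qed simp
    have "csqrt (freq l k p q (of_real x)) * csqrt (freq l k p q (of_real x)) = freq l k p q (of_real x)"
      by (simp flip: power2_eq_square)
    then have "sol l k p q c0 c1 (of_real x) = (Z1 l k p q c0 c1 (of_real x) + Z2 l k p q c0 c1 (of_real x)) * exp (freq_int l k p q (of_real x)) * inverse (csqrt (freq l k p q (of_real x)))"
      unfolding Z1_plus_Z2 prefactor_def using nz by (simp add: exp_minus field_simps)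
    then have "norm (sol l k p q c0 c1 (of_real x)) = norm (Z1 l k p q c0 c1 (of_real x) + Z2 l k p q c0 c1 (of_real x)) * exp (A x) * inverse (norm (csqrt (freq l k p q (of_real x))))"
      by (simp add: norm_mult norm_inverse A_def)
    also have "\<dots> \<le> (2 * (K * exp (- 2 * (A x - A Y)))) * exp (A x) * inverse (sqrt (d * \<nu>))"
    proof (intro mult_mono)
      show "norm (Z1 l k p q c0 c1 (of_real x) + Z2 l k p q c0 c1 (of_real x)) \<le> 2 * (K * exp (- 2 * (A x - A Y)))"
        using D(1) z2 norm_triangle_ineq[of "Z1 l k p q c0 c1 (of_real x)" "Z2 l k p q c0 c1 (of_real x)"] by linarith
      show "inverse (norm (csqrt (freq l k p q (of_real x)))) \<le> inverse (sqrt (d * \<nu>))"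
        using cs d by (intro le_imp_inverse_le) auto
    qed (auto simp: K_def)
    also have "\<dots> = 2 * K * exp (- A x + 2 * A Y) * inverse (sqrt (d * \<nu>))"
      by (simp add: exp_add[symmetric] algebra_simps) 
    also have "\<dots> \<le> 2 * K * exp (- A Y + 2 * A Y) * inverse (sqrt (d * \<nu>))"
      using AY d by (intro mult_right_mono mult_left_mono) (auto simp: K_def)
    finally show ?thesis .
  qed
  have "compact ((\<lambda>x. sol l k p q c0 c1 (of_real x)) ` {0..Y})"
  proof (intro compact_continuous_image continuous_at_imp_continuous_on ballI compact_Icc)
    fix x show "isCont (\<lambda>x::real. sol l k p q c0 c1 (of_real x)) x"
      by (rule has_vector_derivative_continuous[OF has_vector_derivative_real_field[OF sol_has_field_derivative]])
  qed
  then have "bounded ((\<lambda>x. sol l k p q c0 c1 (of_real x)) ` {0..Y})" by (rule compact_imp_bounded)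
  then obtain B where B: "\<forall>w \<in> (\<lambda>x. sol l k p q c0 c1 (of_real x)) ` {0..Y}. norm w \<le> B"
    unfolding bounded_iff by (elim exE)
  define M where "M = 2 * K * exp (- A Y + 2 * A Y) * inverse (sqrt (d * \<nu>))"
  have "norm (sol l k p q c0 c1 (of_real x)) \<le> max B M" if "x \<ge> 0" for x
  proof (cases "x \<le> Y")
    case True
    then have "norm (sol l k p q c0 c1 (of_real x)) \<le> B" using B that by simp
    then show ?thesis by simp
  next
    case False
    then have "norm (sol l k p q c0 c1 (of_real x)) \<le> M" unfolding M_def using bd[of x] by simp
    then show ?thesis by simp
  qed
  then show ?thesis by blast
qed

section \<open>Dependence on the parameters\<close>

text \<open>The initial values \<open>(alpha, beta)\<close> at \<open>0\<close> are those of the solution that is recessive at \<open>+\<infinity>\<close>.\<close>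

definition alpha :: "nat \<Rightarrow> nat \<Rightarrow> complex \<Rightarrow> complex \<Rightarrow> complex" where
  "alpha l k p q = 2 * amplitude l k p q 0 1"
definition beta :: "nat \<Rightarrow> nat \<Rightarrow> complex \<Rightarrow> complex \<Rightarrow> complex" where
  "beta l k p q = - 2 * amplitude l k p q 1 0"

lemma of_nat_Suc_neq_0: "of_nat (n + 1) \<noteq> (0 :: complex)"
  by (simp only: of_nat_eq_0_iff)

lemma Z1_continuous_param:
  fixes P Q :: "'a::topological_space \<Rightarrow> complex"
  assumes "compact K" "continuous_on K P" "continuous_on K Q"
    and "\<And>w. w \<in> K \<Longrightarrow> freq l k (P w) (Q w) z \<notin> \<real>\<^sub>\<le>\<^sub>0"
  shows "continuous_on K (\<lambda>w. Z1 l k (P w) (Q w) c0 c1 z)" "continuous_on K (\<lambda>w. Z2 l k (P w) (Q w) c0 c1 z)"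
proof -
  have a: "continuous_on K (\<lambda>w. freq l k (P w) (Q w) z)" unfolding freq_def by (intro continuous_intros assms)
  have nz: "freq l k (P w) (Q w) z \<noteq> 0" if "w \<in> K" for w using assms(4)[OF that] by auto
  have s: "continuous_on K (\<lambda>w. prefactor l k (P w) (Q w) z)" unfolding prefactor_def
    by (intro continuous_on_inverse continuous_on_compose2[OF continuous_on_csqrt a]) (use assms(4) nz in auto)
  have A: "continuous_on K (\<lambda>w. exp (- freq_int l k (P w) (Q w) z))" unfolding freq_int_def
    by (intro continuous_intros assms) (rule ballI, rule of_nat_Suc_neq_0)+
  have r: "continuous_on K (\<lambda>w. freq' l k (P w) (Q w) z / (2 * freq l k (P w) (Q w) z))"
    unfolding freq'_def by (intro continuous_intros a assms) (use nz in auto)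
  note y = sol_continuous[OF assms(1-3)]
  show "continuous_on K (\<lambda>w. Z1 l k (P w) (Q w) c0 c1 z)" unfolding Z1_def
    by (intro continuous_on_divide continuous_on_mult continuous_on_add s A r a y continuous_on_const) auto
  show "continuous_on K (\<lambda>w. Z2 l k (P w) (Q w) c0 c1 z)" unfolding Z2_def
    by (intro continuous_on_divide continuous_on_mult continuous_on_add continuous_on_minus continuous_on_diff s A r a y continuous_on_const) auto
qed

lemma Z1_holomorphic_param:
  assumes "open S" "P holomorphic_on S" "Q holomorphic_on S"
    and "\<And>w. w \<in> S \<Longrightarrow> freq l k (P w) (Q w) z \<notin> \<real>\<^sub>\<le>\<^sub>0"
  shows "(\<lambda>w. Z1 l k (P w) (Q w) c0 c1 z) holomorphic_on S"
proof -
  have a: "(\<lambda>w. freq l k (P w) (Q w) z) holomorphic_on S" unfolding freq_def by (intro holomorphic_intros assms)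
  have nz: "freq l k (P w) (Q w) z \<noteq> 0" if "w \<in> S" for w using assms(4)[OF that] by auto
  have s: "(\<lambda>w. prefactor l k (P w) (Q w) z) holomorphic_on S" unfolding prefactor_def
    by (intro holomorphic_on_inverse holomorphic_on_csqrt' a) (use assms(4) nz in auto)
  have A: "(\<lambda>w. exp (- freq_int l k (P w) (Q w) z)) holomorphic_on S" unfolding freq_int_def
    by (intro holomorphic_intros assms) (rule of_nat_Suc_neq_0)+
  have r: "(\<lambda>w. freq' l k (P w) (Q w) z / (2 * freq l k (P w) (Q w) z)) holomorphic_on S"
    unfolding freq'_def by (intro holomorphic_intros a assms) (use nz in auto)
  note y = sol_holomorphic[OF assms(1-3)]
  show ?thesis unfolding Z1_def
    by (intro holomorphic_on_divide holomorphic_on_mult holomorphic_on_add s A r a y holomorphic_on_const) auto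
qed

text \<open>The rate of convergence involves the solution only through its energy at
  \<open>X\<close>, a continuous function of the parameter and hence bounded on the compact
  set.\<close>

lemma uniform_limit_amplitude:
  fixes P Q :: "'a::topological_space \<Rightarrow> complex"
  assumes K: "compact K" "continuous_on K P" "continuous_on K Q"
    and g: "\<And>w. w \<in> K \<Longrightarrow> sectorial l k (P w) (Q w) X d \<nu>"
  shows "uniform_limit K (\<lambda>(x::real) w. Z1 l k (P w) (Q w) c0 c1 (of_real x)) (\<lambda>w. amplitude l k (P w) (Q w) c0 c1) at_top"
proof -
  have "continuous_on K (\<lambda>w. Z_energy l k (P w) (Q w) c0 c1 X)"
    unfolding Z_energy_def by (intro continuous_intros Z1_continuous_param K) (use sectorial_Re(3)[OF g] in auto)
  then have "bounded ((\<lambda>w. Z_energy l k (P w) (Q w) c0 c1 X) ` K)"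
    using K compact_continuous_image compact_imp_bounded by blast
  then obtain M where M: "\<forall>y\<in>(\<lambda>w. Z_energy l k (P w) (Q w) c0 c1 X) ` K. norm y \<le> M" unfolding bounded_iff by (elim exE)
  define B where "B = coupling_const l d \<nu> * sqrt (2 * M * exp (4 * coupling_const l d \<nu> / X))"
  have rate: "norm (Z1 l k (P w) (Q w) c0 c1 (of_real x) - amplitude l k (P w) (Q w) c0 c1) \<le> B / x" if "w \<in> K" "X \<le> x" for w x
  proof -
    have x0: "X > 0" "d > 0" "\<nu> > 0" using g[OF that(1)] unfolding sectorial_def by auto
    have "Z_energy l k (P w) (Q w) c0 c1 X \<le> M" using M that by force
    then have "coupling_const l d \<nu> * sqrt (2 * Z_energy l k (P w) (Q w) c0 c1 X * exp (4 * coupling_const l d \<nu> / X)) \<le> B"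
      unfolding B_def using coupling_const_nonneg x0 by (intro mult_left_mono) auto
    then show ?thesis
      using amplitude_limit(2)[OF g[OF that(1)] that(2), of c0 c1] x0 that
      by (meson divide_right_mono less_imp_le order_trans)
  qed
  have Bl: "((\<lambda>x. B / x) \<longlongrightarrow> 0) at_top" by real_asymp
  show ?thesis
  proof (rule uniform_limitI)
    fix e :: real assume "e > 0"
    then have "eventually (\<lambda>x. B / x < e) at_top" using order_tendstoD(2)[OF Bl] by blast
    moreover have "eventually (\<lambda>x. X \<le> x) at_top" by (rule eventually_ge_at_top)
    ultimately show "eventually (\<lambda>x. \<forall>w\<in>K. dist (Z1 l k (P w) (Q w) c0 c1 (of_real x)) (amplitude l k (P w) (Q w) c0 c1) < e) at_top"
      by eventually_elim (use rate in \<open>fastforce simp: dist_norm\<close>)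
  qed
qed

lemma amplitude_continuous:
  fixes P Q :: "'a::topological_space \<Rightarrow> complex"
  assumes K: "compact K" "continuous_on K P" "continuous_on K Q"
    and g: "\<And>w. w \<in> K \<Longrightarrow> sectorial l k (P w) (Q w) X d \<nu>"
  shows "continuous_on K (\<lambda>w. amplitude l k (P w) (Q w) c0 c1)"
proof (rule uniform_limit_theorem[OF _ uniform_limit_amplitude[OF K g]])
  have "eventually (\<lambda>x. X \<le> x) at_top" by (rule eventually_ge_at_top)
  then show "eventually (\<lambda>x::real. continuous_on K (\<lambda>w. Z1 l k (P w) (Q w) c0 c1 (of_real x))) at_top"
    by eventually_elim (intro Z1_continuous_param K, use sectorial_Re(3)[OF g] in auto)
qed auto

text \<open>A locally uniform limit of holomorphic functions. The triple \<open>X\<close>,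
  \<open>d\<close>, \<open>\<nu>\<close> may change with the compact set, since the amplitude itself
  does not refer to it.\<close>

lemma amplitude_holomorphic:
  assumes S: "open S" "P holomorphic_on S" "Q holomorphic_on S"
    and g: "\<And>K. compact K \<Longrightarrow> K \<subseteq> S \<Longrightarrow> \<exists>X d \<nu>. \<forall>w\<in>K. sectorial l k (P w) (Q w) X d \<nu>"
  shows "(\<lambda>w. amplitude l k (P w) (Q w) c0 c1) holomorphic_on S"
proof (rule analytic_imp_holomorphic, unfold analytic_on_def, intro ballI)
  fix w assume "w \<in> S"
  then obtain r where r: "r > 0" "cball w r \<subseteq> S" using S open_contains_cball by blast
  obtain X d \<nu> where gX: "\<And>v. v \<in> cball w r \<Longrightarrow> sectorial l k (P v) (Q v) X d \<nu>"
    using g[OF compact_cball r(2)] by blast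
  have c: "continuous_on (cball w r) P" "continuous_on (cball w r) Q"
    using S r holomorphic_on_imp_continuous_on continuous_on_subset by blast+
  have bS: "ball w r \<subseteq> S" using r ball_subset_cball by blast
  have ev: "eventually (\<lambda>x::real. continuous_on (cball w r) (\<lambda>w. Z1 l k (P w) (Q w) c0 c1 (of_real x)) \<and>
     (\<lambda>w. Z1 l k (P w) (Q w) c0 c1 (of_real x)) holomorphic_on ball w r) at_top"
  proof -
    have "eventually (\<lambda>x. X \<le> x) at_top" by (rule eventually_ge_at_top)
    then show ?thesis
    proof eventually_elim
      case (elim x)
      have n: "freq l k (P v) (Q v) (of_real x) \<notin> \<real>\<^sub>\<le>\<^sub>0" if "v \<in> cball w r" for v by (rule sectorial_Re(3)[OF gX[OF that] elim])
      show ?case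
        by (intro conjI Z1_continuous_param(1)[OF compact_cball c n] Z1_holomorphic_param[OF open_ball] 
            holomorphic_on_subset[OF S(2) bS] holomorphic_on_subset[OF S(3) bS] n) auto
    qed
  qed
  have "(\<lambda>w. amplitude l k (P w) (Q w) c0 c1) holomorphic_on ball w r"
    by (rule holomorphic_uniform_limit[OF ev uniform_limit_amplitude[OF compact_cball c gX]]) auto
  then show "\<exists>e>0. (\<lambda>w. amplitude l k (P w) (Q w) c0 c1) holomorphic_on ball w e" using r by blast
qed

section \<open>Sufficient conditions for sectoriality\<close>

lemma Re_freq_ge: "x \<ge> 0 \<Longrightarrow> Re (freq l k p q (of_real x)) \<ge> Re p * x ^ l + Re q * x ^ k"
  unfolding freq_def by (simp flip: of_real_power)

text \<open>Beyond \<open>4 * M / \<delta>\<close> the \<open>q\<close> term is at most a quarter of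
  \<open>\<delta> * x ^ l\<close>. Then the real part is at least
  \<open>3 / 4 * \<delta> * x ^ l\<close> and \<open>freq_norm\<close> at most
  \<open>(M + \<delta>) * x ^ l\<close>; the second constant is their ratio. The direction of
  \<open>q\<close> is arbitrary.\<close>

lemma sectorial_lt:
  assumes kl: "k < l" and d: "0 < \<delta>" "\<delta> \<le> Re p" and M: "norm p \<le> M" "norm q \<le> M"
  shows "sectorial l k p q (max 1 (4 * M / \<delta>)) (3 / 4 * \<delta> / (M + \<delta>)) \<delta>"
  unfolding sectorial_def
proof (intro conjI allI impI)
  have M0: "M \<ge> 0" using M norm_ge_zero order_trans by blast
  show "k \<le> l" "0 < max 1 (4 * M / \<delta>)" "0 < 3 / 4 * \<delta> / (M + \<delta>)" "0 < \<delta>" using kl d M0 by auto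
  fix x :: real assume x: "max 1 (4 * M / \<delta>) \<le> x"
  have x1: "x \<ge> 1" and xM: "4 * M \<le> \<delta> * x" using x d by (auto simp: field_simps)
  have "4 * (norm q * x ^ k) \<le> (4 * M) * x ^ k" using M x1 by (simp add: mult_right_mono)
  also have "\<dots> \<le> (\<delta> * x) * x ^ k" using xM x1 by (intro mult_right_mono) auto
  also have "\<dots> = \<delta> * x ^ Suc k" by simp
  also have "\<dots> \<le> \<delta> * x ^ l" using d x1 kl by (intro mult_left_mono power_increasing) auto
  finally have q: "norm q * x ^ k \<le> \<delta> / 4 * x ^ l" by simp
  have xl: "x ^ l \<ge> 1" using x1 by simp
  have dp: "\<delta> \<le> norm p" using d complex_Re_le_cmod[of p] by linarith
  have "\<delta> * 1 \<le> norm p * x ^ l" using dp xl d by (intro mult_mono) auto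
  moreover have "norm q * x ^ k \<ge> 0" using x1 by simp
  ultimately show "\<delta> \<le> freq_norm l k p q x" unfolding freq_norm_def by simp
  have "norm p * x ^ l \<le> M * x ^ l" using M xl by (intro mult_right_mono) auto
  moreover have "\<delta> / 4 * x ^ l \<le> \<delta> * x ^ l" using d xl by (intro mult_right_mono) auto
  ultimately have n: "freq_norm l k p q x \<le> (M + \<delta>) * x ^ l" unfolding freq_norm_def distrib_right using q by linarith
  have "Re q * x ^ k \<ge> - (norm q * x ^ k)"
  proof -
    have "- norm q \<le> Re q" using abs_Re_le_cmod[of q] by linarith
    then show ?thesis using mult_right_mono[of "- norm q" "Re q" "x ^ k"] x1 by simp
  qed
  moreover have "\<delta> * x ^ l \<le> Re p * x ^ l" using d xl by (intro mult_right_mono) auto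
  ultimately have R: "Re (freq l k p q (of_real x)) \<ge> 3 / 4 * \<delta> * x ^ l"
    using Re_freq_ge[OF order_trans[OF zero_le_one x1], of p l q k] q by linarith
  have "3 / 4 * \<delta> / (M + \<delta>) * freq_norm l k p q x \<le> 3 / 4 * \<delta> / (M + \<delta>) * ((M + \<delta>) * x ^ l)"
    using n d M0 by (intro mult_left_mono) auto
  also have "\<dots> = 3 / 4 * \<delta> * x ^ l"
  proof -
    have "a / b * (b * y) = a * y" if "b > 0" for a b y :: real using that by simp
    then show ?thesis using d M0 by (meson add_nonneg_pos)
  qed
  finally show "3 / 4 * \<delta> / (M + \<delta>) * freq_norm l k p q x \<le> Re (freq l k p q (of_real x))" using R by linarith
qed

text \<open>With both coefficients in one sector no cancellation can occur, so the estimate already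
  holds from \<open>X = 1\<close>. The size of \<open>p\<close> does not enter the constants, which
  therefore survive the limit \<open>p = 0\<close>.\<close>

lemma sectorial_sector:
  assumes "k \<le> l" "0 < d" "d * norm p \<le> Re p" "d * norm q \<le> Re q" "0 < \<nu>" "\<nu> \<le> norm q"
  shows "sectorial l k p q 1 d \<nu>"
  unfolding sectorial_def
proof (intro conjI allI impI)
  fix x :: real assume x: "1 \<le> x"
  have xk: "x ^ k \<ge> 1" "x ^ l \<ge> 1" using x by auto
  have "\<nu> * 1 \<le> norm q * x ^ k" using assms xk by (intro mult_mono) auto
  then show "\<nu> \<le> freq_norm l k p q x" unfolding freq_norm_def using xk
    by (smt (verit) mult_nonneg_nonneg norm_ge_zero)
  have "d * freq_norm l k p q x = (d * norm p) * x ^ l + (d * norm q) * x ^ k" unfolding freq_norm_def by (simp add: algebra_simps)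
  also have "\<dots> \<le> Re p * x ^ l + Re q * x ^ k" using assms xk by (intro add_mono mult_right_mono) auto
  also have "\<dots> \<le> Re (freq l k p q (of_real x))" by (rule Re_freq_ge) (use x in simp)
  finally show "d * freq_norm l k p q x \<le> Re (freq l k p q (of_real x))" .
qed (use assms in auto)

text \<open>For large \<open>q\<close> of any direction, \<open>X\<close> is moved beyond the
  turning points, to where the \<open>q\<close> term is at most the fraction \<open>r\<close> of
  \<open>x ^ l\<close>. In exchange \<open>d\<close> does not depend on \<open>q\<close>.\<close>

lemma sectorial_ratio:
  assumes "k \<le> l" "1 \<le> X" "0 \<le> r" "r < 1" "norm q \<le> r * X ^ (l - k)"
  shows "sectorial l k 1 q X ((1 - r) / (1 + r)) 1"
  unfolding sectorial_def
proof (intro conjI allI impI)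
  fix x :: real assume x: "X \<le> x"
  have x1: "x \<ge> 1" using x assms by simp
  have xl: "x ^ l \<ge> 1" using x1 by simp
  have "norm q * x ^ k \<le> r * X ^ (l - k) * x ^ k" using assms x1 by (intro mult_right_mono) auto
  also have "\<dots> \<le> r * x ^ (l - k) * x ^ k" using assms x by (intro mult_right_mono mult_left_mono power_mono) auto
  also have "\<dots> = r * x ^ l" using assms by (simp flip: power_add)
  finally have q: "norm q * x ^ k \<le> r * x ^ l" .
  show "1 \<le> freq_norm l k 1 q x" unfolding freq_norm_def
    using add_mono[OF xl mult_nonneg_nonneg[OF norm_ge_zero[of q] zero_le_power[of x k]]] x1 by simp
  have "- norm q * x ^ k \<le> Re q * x ^ k" using abs_Re_le_cmod[of q] x1 by (intro mult_right_mono) (linarith, simp)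
  then have R: "(1 - r) * x ^ l \<le> Re (freq l k 1 q (of_real x))"
    using Re_freq_ge[OF order_trans[OF zero_le_one x1], of 1 l q k] q unfolding left_diff_distrib by simp
  have "freq_norm l k 1 q x \<le> (1 + r) * x ^ l" unfolding freq_norm_def using q by (simp add: algebra_simps)
  then have "(1 - r) / (1 + r) * freq_norm l k 1 q x \<le> (1 - r) / (1 + r) * ((1 + r) * x ^ l)" using assms by (intro mult_left_mono) auto
  also have "\<dots> = (1 - r) * x ^ l" using assms by simp
  finally show "(1 - r) / (1 + r) * freq_norm l k 1 q x \<le> Re (freq l k 1 q (of_real x))" using R by linarith
qed (use assms in auto)

lemma compact_Re_lower_bound:
  fixes P :: "complex \<Rightarrow> complex"
  assumes "compact K" "continuous_on K P" "\<And>w. w \<in> K \<Longrightarrow> Re (P w) > 0"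
  obtains \<delta> where "\<delta> > 0" "\<And>w. w \<in> K \<Longrightarrow> \<delta> \<le> Re (P w)"
proof (cases "K = {}")
  case False
  obtain w where "w \<in> K" "\<forall>v\<in>K. Re (P w) \<le> Re (P v)"
    using continuous_attains_inf[OF assms(1) False, of "\<lambda>w. Re (P w)"] assms(2) by (auto intro: continuous_on_Re)
  then show ?thesis using that[of "Re (P w)"] assms(3) by auto
qed (use that[of 1] in auto)

lemma amplitude_holomorphic_lt:
  assumes S: "open S" "P holomorphic_on S" "Q holomorphic_on S" and kl: "k < l"
    and Re: "\<And>w. w \<in> S \<Longrightarrow> Re (P w) > 0"
  shows "(\<lambda>w. amplitude l k (P w) (Q w) c0 c1) holomorphic_on S"
proof (rule amplitude_holomorphic[OF S])
  fix K assume K: "compact K" "K \<subseteq> S"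
  have c: "continuous_on K P" "continuous_on K Q"
    using S K holomorphic_on_imp_continuous_on continuous_on_subset by blast+
  obtain \<delta> where "\<delta> > 0" "\<And>w. w \<in> K \<Longrightarrow> \<delta> \<le> Re (P w)" using compact_Re_lower_bound[OF K(1) c(1)] Re K by blast
  moreover obtain M where "\<And>w. w \<in> K \<Longrightarrow> norm (P w) \<le> M" "\<And>w. w \<in> K \<Longrightarrow> norm (Q w) \<le> M"
    using bounded_pair[OF K(1) c] by blast
  ultimately show "\<exists>X d \<nu>. \<forall>w\<in>K. sectorial l k (P w) (Q w) X d \<nu>" using sectorial_lt[OF kl] by blast
qed

lemma amplitude_holomorphic_zero:
  assumes S: "open S" "Q holomorphic_on S" and kl: "k \<le> l"
    and Re: "\<And>w. w \<in> S \<Longrightarrow> Re (Q w) > 0"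
  shows "(\<lambda>w. amplitude l k 0 (Q w) c0 c1) holomorphic_on S"
proof (rule amplitude_holomorphic[OF S(1) holomorphic_on_const S(2)])
  fix K assume K: "compact K" "K \<subseteq> S"
  have c: "continuous_on K Q"
    using S K holomorphic_on_imp_continuous_on continuous_on_subset by blast+
  obtain \<delta> where d: "\<delta> > 0" "\<And>w. w \<in> K \<Longrightarrow> \<delta> \<le> Re (Q w)" using compact_Re_lower_bound[OF K(1) c] Re K by blast
  obtain M where M: "\<And>w. w \<in> K \<Longrightarrow> norm (Q w) \<le> M"
    using bounded_pair[OF K(1) c c] by blast
  have "sectorial l k 0 (Q w) 1 (\<delta> / (\<delta> + M)) \<delta>" if w: "w \<in> K" for w
  proof (rule sectorial_sector[OF kl])
    have M0: "M \<ge> 0" using M[OF w] norm_ge_zero order_trans by blast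
    show "0 < \<delta> / (\<delta> + M)" using d M0 by simp
    show "\<delta> \<le> norm (Q w)" using d(2)[OF w] complex_Re_le_cmod order_trans by blast
    have "\<delta> / (\<delta> + M) * norm (Q w) \<le> \<delta> / (\<delta> + M) * (\<delta> + M)" using M[OF w] d M0 by (intro mult_left_mono) auto
    also have "\<dots> = \<delta>" using d M0 by simp
    finally show "\<delta> / (\<delta> + M) * norm (Q w) \<le> Re (Q w)" using d(2)[OF w] by simp
  qed (use d in auto)
  then show "\<exists>X d \<nu>. \<forall>w\<in>K. sectorial l k 0 (Q w) X d \<nu>" by blast
qed

section \<open>Dilations and rotations of the variable\<close>

lemma csqrt_scale:
  assumes "c > 0" shows "csqrt (of_real c * z) = of_real (sqrt c) * csqrt z"
proof (rule csqrt_unique)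
  show "(of_real (sqrt c) * csqrt z)\<^sup>2 = of_real c * z"
    using assms by (simp add: power_mult_distrib flip: of_real_power)
  show "0 < Re (of_real (sqrt c) * csqrt z) \<or> Re (of_real (sqrt c) * csqrt z) = 0 \<and> 0 \<le> Im (of_real (sqrt c) * csqrt z)"
    using csqrt_principal[of z] assms by auto
qed

text \<open>Under \<open>x \<mapsto> c * x\<close> the frequency and the derivative of the solution
  both gain a factor \<open>c\<close>, the primitive \<open>freq_int\<close> is invariant, and
  \<open>prefactor\<close> gains \<open>c^(-1/2)\<close>; what is left is
  \<open>sqrt c\<close>.\<close>

lemma Z1_scale:
  fixes c :: real
  assumes c: "c > 0"
  shows "Z1 l k (of_real c ^ (l + 1) * p) (of_real c ^ (k + 1) * q) c0 (of_real c * c1) z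
     = of_real (sqrt c) * Z1 l k p q c0 c1 (of_real c * z)"
proof -
  let ?c = "of_real c :: complex"
  have c0: "?c \<noteq> 0" using c by simp
  have a: "freq l k (?c ^ (l + 1) * p) (?c ^ (k + 1) * q) z = ?c * freq l k p q (?c * z)"
    unfolding freq_def by (simp add: power_mult_distrib algebra_simps)
  have *: "?c ^ (n + 1) * (of_nat n * z ^ (n - 1)) = ?c\<^sup>2 * (of_nat n * (?c * z) ^ (n - 1))" for n
    by (cases n) (simp_all add: power_mult_distrib power2_eq_square)
  have da: "freq' l k (?c ^ (l + 1) * p) (?c ^ (k + 1) * q) z = ?c\<^sup>2 * freq' l k p q (?c * z)"
  proof -
    have "?c ^ (n + 1) * r * (of_nat n * z ^ (n - 1)) = ?c\<^sup>2 * (r * (of_nat n * (?c * z) ^ (n - 1)))" for n r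
      using arg_cong[OF *[of n], of "(*) r"] by (simp only: mult_ac)
    then show ?thesis unfolding freq'_def by (simp only: distrib_left)
  qed
  have A: "freq_int l k (?c ^ (l + 1) * p) (?c ^ (k + 1) * q) z = freq_int l k p q (?c * z)"
    unfolding freq_int_def by (simp add: power_mult_distrib algebra_simps)
  have s: "prefactor l k (?c ^ (l + 1) * p) (?c ^ (k + 1) * q) z = inverse (of_real (sqrt c)) * prefactor l k p q (?c * z)"
    unfolding prefactor_def a csqrt_scale[OF c] by simp
  have e: "?c ^ (2*l + 2) * p\<^sup>2 = (?c ^ (l + 1) * p)\<^sup>2" "?c ^ (l + k + 2) * (p * q) = (?c ^ (l + 1) * p) * (?c ^ (k + 1) * q)"
     "?c ^ (2*k + 2) * q\<^sup>2 = (?c ^ (k + 1) * q)\<^sup>2"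
    by (simp_all add: power_mult_distrib power_add mult_2 power2_eq_square)
  have r: "of_real (sqrt c) * of_real (sqrt c) = ?c" using c by (simp flip: of_real_mult)
  have sc: "of_real (sqrt c) \<noteq> (0 :: complex)" using c by simp
  have gen: "inverse r * s * E * (c * y' + (c * a + c\<^sup>2 * a' / (2 * (c * a))) * y) / 2 = r * (s * E * (y' + (a + a' / (2 * a)) * y) / 2)"
    if "r * r = c" "c \<noteq> 0" "r \<noteq> 0" for r s E y' a a' y c :: complex
  proof -
    have "c * y' + (c * a + c\<^sup>2 * a' / (2 * (c * a))) * y = c * (y' + (a + a' / (2 * a)) * y)"
      using that by (simp add: algebra_simps power2_eq_square)
    moreover have "inverse r * s * E * (r * r * Y) / 2 = r * (s * E * Y / 2)" for Y
      using that(3) by simp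
    ultimately show ?thesis using that(1) by simp
  qed
  show ?thesis
    unfolding Z1_def s A da a sol_scale[OF e] by (rule gen[OF r c0 sc])
qed

lemma alpha_beta_holomorphic_lt:
  assumes "open S" "P holomorphic_on S" "Q holomorphic_on S" "k < l" "\<And>w. w \<in> S \<Longrightarrow> Re (P w) > 0"
  shows "(\<lambda>w. alpha l k (P w) (Q w)) holomorphic_on S" "(\<lambda>w. beta l k (P w) (Q w)) holomorphic_on S"
  unfolding alpha_def beta_def by (intro holomorphic_intros amplitude_holomorphic_lt assms; assumption)+

lemma alpha_beta_holomorphic_zero:
  assumes "open S" "Q holomorphic_on S" "k \<le> l" "\<And>w. w \<in> S \<Longrightarrow> Re (Q w) > 0"
  shows "(\<lambda>w. alpha l k 0 (Q w)) holomorphic_on S" "(\<lambda>w. beta l k 0 (Q w)) holomorphic_on S"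
  unfolding alpha_def beta_def by (intro holomorphic_intros amplitude_holomorphic_zero assms; assumption)+

lemma alpha_beta_scale:
  fixes c :: real
  assumes g: "sectorial l k p q X d \<nu>" and c: "c > 0"
  shows "of_real (sqrt c) * alpha l k (of_real c ^ (l + 1) * p) (of_real c ^ (k + 1) * q) = alpha l k p q"
    "beta l k (of_real c ^ (l + 1) * p) (of_real c ^ (k + 1) * q) = of_real (sqrt c) * beta l k p q"
proof -
  let ?p = "of_real c ^ (l + 1) * p" and ?q = "of_real c ^ (k + 1) * q"
  have r: "of_real (sqrt c) * of_real (sqrt c) = (of_real c :: complex)" using c by (simp flip: of_real_mult)
  have c0: "of_real (sqrt c) \<noteq> (0 :: complex)" using c by simp
  have lim: "((\<lambda>x::real. Z1 l k ?p ?q c0 c1 (of_real x)) \<longlongrightarrow> of_real (sqrt c) * amplitude l k p q c0 (c1 / of_real c)) at_top" for c0 c1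
  proof -
    have "filterlim (\<lambda>x. c * x) at_top at_top" using c by real_asymp
    then have "((\<lambda>x. of_real (sqrt c) * Z1 l k p q c0 (c1 / of_real c) (of_real (c * x))) \<longlongrightarrow> of_real (sqrt c) * amplitude l k p q c0 (c1 / of_real c)) at_top"
      by (intro tendsto_intros filterlim_compose[OF amplitude_limit(1)[OF g]])
    then show ?thesis using Z1_scale[OF c, of l k p q c0 "c1 / of_real c"] c by simp
  qed
  have Jl: "amplitude l k ?p ?q c0 c1 = of_real (sqrt c) * amplitude l k p q c0 (c1 / of_real c)" for c0 c1
    unfolding amplitude_def[of l k ?p] by (rule tendsto_Lim[OF _ lim]) simp
  have "amplitude l k p q 0 (1 / of_real c) = 1 / of_real c * amplitude l k p q 0 1"
    using amplitude_basis[OF g, of 0 "1 / of_real c"] by simp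
  then have "of_real (sqrt c) * amplitude l k ?p ?q 0 1 = amplitude l k p q 0 1"
    unfolding Jl mult.assoc[symmetric] r using c by simp
  then show "of_real (sqrt c) * alpha l k ?p ?q = alpha l k p q" unfolding alpha_def by simp
  show "beta l k ?p ?q = of_real (sqrt c) * beta l k p q" unfolding beta_def Jl by simp
qed

lemma strip:
  fixes c :: real
  assumes "c > 0"
  shows "open {w. \<bar>Im w\<bar> < c}" "connected {w. \<bar>Im w\<bar> < c}"
proof -
  have e: "{w. \<bar>Im w\<bar> < c} = {w. Im w < c} \<inter> {w. Im w > - c}" by auto
  show "open {w. \<bar>Im w\<bar> < c}" unfolding e by (intro open_Int open_halfspace_Im_lt open_halfspace_Im_gt)
  show "connected {w. \<bar>Im w\<bar> < c}" unfolding e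
    by (intro convex_connected convex_Int convex_halfspace_Im_lt convex_halfspace_Im_gt)
qed

lemma strip_identity:
  fixes c :: real
  assumes c: "c > 0" and h: "f holomorphic_on {w. \<bar>Im w\<bar> < c}" and r: "\<And>x::real. f (of_real x) = 0" and w: "\<bar>Im w\<bar> < c"
  shows "f w = 0"
proof (rule analytic_continuation[OF h strip[OF c], of "of_real ` UNIV" 0])
  show "(0::complex) islimpt of_real ` UNIV"
    unfolding islimpt_approachable
  proof (intro allI impI)
    fix e :: real assume "e > 0"
    then have "of_real (e / 2) \<noteq> (0 :: complex) \<and> dist (of_real (e / 2) :: complex) 0 < e"
      by (simp add: norm_divide)
    then show "\<exists>x'\<in>of_real ` UNIV. x' \<noteq> (0::complex) \<and> dist x' 0 < e"
      by blast
  qed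
qed (use c r w in auto)

lemma Re_exp_pos: "\<bar>Im w\<bar> < pi / 2 \<Longrightarrow> Re (exp w) > 0"
  unfolding Re_exp by (intro mult_pos_pos exp_gt_zero cos_gt_zero_pi) linarith+

lemma sqrt_exp: "sqrt (exp x) = exp (x / 2)"
  by (rule real_sqrt_unique) (simp_all flip: exp_double)

text \<open>The scaling law of \<open>alpha\<close> and \<open>beta\<close> under real dilations of \<open>x\<close> extends to small rotations by the
  identity theorem.\<close>

lemma alpha_beta_rotate:
  assumes kl: "k < l" and w: "real (l + 1) * \<bar>Im w\<bar> < pi / 2"
  shows "exp (w / 2) * alpha l k (exp (of_nat (l + 1) * w)) (exp (of_nat (k + 1) * w) * q) = alpha l k 1 q"
    "beta l k (exp (of_nat (l + 1) * w)) (exp (of_nat (k + 1) * w) * q) = exp (w / 2) * beta l k 1 q"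
proof -
  have hexp: "(\<lambda>w. exp (w / 2)) holomorphic_on S" for S by (intro holomorphic_intros) auto
  define c where "c = pi / 2 / real (l + 1)"
  have c: "c > 0" unfolding c_def by simp
  have Sc: "real (l + 1) * \<bar>Im w\<bar> < pi / 2 \<longleftrightarrow> \<bar>Im w\<bar> < c" for w
    unfolding c_def by (subst pos_less_divide_eq) (simp_all add: mult.commute)
  have Re: "Re (exp (of_nat (l + 1) * w)) > 0" if "w \<in> {w. \<bar>Im w\<bar> < c}" for w
    using that Sc[of w] by (intro Re_exp_pos) (simp add: abs_mult del: of_nat_add)
  have h: "(\<lambda>w. exp (of_nat (l + 1) * w)) holomorphic_on S" "(\<lambda>w. exp (of_nat (k + 1) * w) * q) holomorphic_on S" for S
    by (intro holomorphic_intros)+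
  note hol = alpha_beta_holomorphic_lt[OF strip(1)[OF c] h kl Re]
  have g: "sectorial l k 1 q (max 1 (4 * (norm q + 1) / 1)) (3 / 4 * 1 / ((norm q + 1) + 1)) 1"
    by (intro sectorial_lt kl) auto
  have e: "exp (of_nat (n + 1) * of_real x) = (of_real (exp x) ^ (n + 1) :: complex)" for n and x :: real
    by (simp only: exp_of_real[symmetric] exp_of_nat_mult)
  have s: "exp (of_real x / 2) = (of_real (sqrt (exp x)) :: complex)" for x :: real
    unfolding sqrt_exp by (simp flip: exp_of_real)
  define F where "F = (\<lambda>w. exp (w / 2) * alpha l k (exp (of_nat (l + 1) * w)) (exp (of_nat (k + 1) * w) * q) - alpha l k 1 q)"
  have "F w = 0"
  proof (rule strip_identity[where f = F and w = w, OF c])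
    show "F holomorphic_on {w. \<bar>Im w\<bar> < c}" unfolding F_def
      by (intro holomorphic_on_diff holomorphic_on_mult hexp hol holomorphic_on_const; assumption?)
    show "F (of_real x) = 0" for x :: real
      unfolding F_def e s using alpha_beta_scale(1)[OF g, of "exp x"] by simp
  qed (use w Sc in auto)
  then show "exp (w / 2) * alpha l k (exp (of_nat (l + 1) * w)) (exp (of_nat (k + 1) * w) * q) = alpha l k 1 q" unfolding F_def by simp
  define G where "G = (\<lambda>w. beta l k (exp (of_nat (l + 1) * w)) (exp (of_nat (k + 1) * w) * q) - exp (w / 2) * beta l k 1 q)"
  have "G w = 0"
  proof (rule strip_identity[where f = G and w = w, OF c])
    show "G holomorphic_on {w. \<bar>Im w\<bar> < c}" unfolding G_def
      by (intro holomorphic_on_diff holomorphic_on_mult hexp hol holomorphic_on_const; assumption?)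
    show "G (of_real x) = 0" for x :: real
      unfolding G_def e s using alpha_beta_scale(2)[OF g, of "exp x"] by simp
  qed (use w Sc in auto)
  then show "beta l k (exp (of_nat (l + 1) * w)) (exp (of_nat (k + 1) * w) * q) = exp (w / 2) * beta l k 1 q" unfolding G_def by simp
qed

text \<open>With \<open>p = 0\<close> only the second coefficient has to stay in the right
  half-plane, so the admissible angle widens from \<open>pi / (2 * (l + 1))\<close> to
  \<open>pi / (2 * (k + 1))\<close>. The wider range is needed to rotate back after the
  limit.\<close>

lemma alpha_beta_rotate_zero:
  assumes kl: "k \<le> l" and w: "real (k + 1) * \<bar>Im w\<bar> < pi / 2"
  shows "exp (w / 2) * alpha l k 0 (exp (of_nat (k + 1) * w)) = alpha l k 0 1"
    "beta l k 0 (exp (of_nat (k + 1) * w)) = exp (w / 2) * beta l k 0 1"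
proof -
  have hexp: "(\<lambda>w. exp (w / 2)) holomorphic_on S" for S by (intro holomorphic_intros) auto
  define c where "c = pi / 2 / real (k + 1)"
  have c: "c > 0" unfolding c_def by simp
  have Sc: "real (k + 1) * \<bar>Im w\<bar> < pi / 2 \<longleftrightarrow> \<bar>Im w\<bar> < c" for w
    unfolding c_def by (subst pos_less_divide_eq) (simp_all add: mult.commute)
  have Re: "Re (exp (of_nat (k + 1) * w)) > 0" if "w \<in> {w. \<bar>Im w\<bar> < c}" for w
    using that Sc[of w] by (intro Re_exp_pos) (simp add: abs_mult del: of_nat_add)
  have h: "(\<lambda>w. exp (of_nat (k + 1) * w)) holomorphic_on S" for S
    by (intro holomorphic_intros)
  note hol = alpha_beta_holomorphic_zero[OF strip(1)[OF c] h kl Re]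
  have g: "sectorial l k 0 1 1 1 1"
    by (intro sectorial_sector kl) auto
  have e: "exp (of_nat (n + 1) * of_real x) = (of_real (exp x) ^ (n + 1) :: complex)" for n and x :: real
    by (simp only: exp_of_real[symmetric] exp_of_nat_mult)
  have s: "exp (of_real x / 2) = (of_real (sqrt (exp x)) :: complex)" for x :: real
    unfolding sqrt_exp by (simp flip: exp_of_real)
  define F where "F = (\<lambda>w. exp (w / 2) * alpha l k 0 (exp (of_nat (k + 1) * w)) - alpha l k 0 1)"
  have "F w = 0"
  proof (rule strip_identity[where f = F and w = w, OF c])
    show "F holomorphic_on {w. \<bar>Im w\<bar> < c}" unfolding F_def
      by (intro holomorphic_on_diff holomorphic_on_mult hexp hol holomorphic_on_const; assumption?)
    show "F (of_real x) = 0" for x :: real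
      unfolding F_def e s using alpha_beta_scale(1)[OF g, of "exp x"] by simp
  qed (use w Sc in auto)
  then show "exp (w / 2) * alpha l k 0 (exp (of_nat (k + 1) * w)) = alpha l k 0 1" unfolding F_def by simp
  define G where "G = (\<lambda>w. beta l k 0 (exp (of_nat (k + 1) * w)) - exp (w / 2) * beta l k 0 1)"
  have "G w = 0"
  proof (rule strip_identity[where f = G and w = w, OF c])
    show "G holomorphic_on {w. \<bar>Im w\<bar> < c}" unfolding G_def
      by (intro holomorphic_on_diff holomorphic_on_mult hexp hol holomorphic_on_const; assumption?)
    show "G (of_real x) = 0" for x :: real
      unfolding G_def e s using alpha_beta_scale(2)[OF g, of "exp x"] by simp
  qed (use w Sc in auto)
  then show "beta l k 0 (exp (of_nat (k + 1) * w)) = exp (w / 2) * beta l k 0 1" unfolding G_def by simp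
qed

text \<open>An imaginary \<open>q\<close> contributes nothing to the real part of the frequency. A
  small rotation moves it into the right half-plane while the first coefficient only turns to the
  argument \<open>\<tau> * pi / 4\<close>; a simultaneous contraction gives \<open>q\<close> modulus
  1 and sends the first coefficient to 0. This family is sectorial uniformly up to the limit, which
  is the equation with \<open>p = 0\<close> and is rotated back to \<open>q = 1\<close>. In the
  product of the two phases the auxiliary angle cancels and \<theta> remains.\<close>

lemma alpha_beta_imaginary_limit:
  fixes \<tau> :: real
  assumes kl: "k < l" and tau: "\<tau> = 1 \<or> \<tau> = - 1"
  defines "\<theta> \<equiv> pi / (4 * (real k + 1))"
  shows "((\<lambda>r::real. exp (of_real r / 2) * alpha l k 1 (- (of_real \<tau> * \<i> * exp (of_nat (k + 1) * of_real r)))) \<longlongrightarrow>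
           exp (\<i> * of_real (\<tau> * \<theta>)) * alpha l k 0 1) at_top"
    "((\<lambda>r::real. exp (- of_real r / 2) * beta l k 1 (- (of_real \<tau> * \<i> * exp (of_nat (k + 1) * of_real r)))) \<longlongrightarrow>
           exp (- \<i> * of_real (\<tau> * \<theta>)) * beta l k 0 1) at_top"
proof -
  define \<phi> where "\<phi> = pi / (4 * (real l + 1))"
  define w where "w r = - of_real r + \<i> * of_real (\<tau> * \<phi>)" for r :: real
  \<comment> \<open>The second coefficient ends up with argument
    \<open>\<tau> * ((k + 1) * \<phi> - pi / 2)\<close>, and
    \<open>(k + 1) * 2 * \<theta> = pi / 2\<close>; hence \<open>w'\<close> generates the rotation
    that takes 1 to \<open>Q\<close>.\<close>
  define w' where "w' = \<i> * of_real (\<tau> * (\<phi> - 2 * \<theta>))"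
  define Q where "Q = exp (of_nat (k + 1) * w')"
  define P where "P \<epsilon> = of_real \<epsilon> * exp (\<i> * of_real (\<tau> * (pi / 4)))" for \<epsilon> :: real
  have at: "\<bar>\<tau>\<bar> = 1" using tau by auto
  have ph: "0 < \<phi>" "(real l + 1) * \<phi> = pi / 4" unfolding \<phi>_def by (auto simp: field_simps)
  have th: "0 < \<theta>" "(real k + 1) * \<theta> = pi / 4" unfolding \<theta>_def by (auto simp: field_simps)
  have kphi: "0 < (real k + 1) * \<phi>" "(real k + 1) * \<phi> \<le> pi / 4"
    using ph kl by (auto simp flip: ph(2) intro!: mult_right_mono)
  have kd: "(real k + 1) * (\<phi> - 2 * \<theta>) = (real k + 1) * \<phi> - pi / 2"
    using th(2) by (simp add: right_diff_distrib)
  have iw': "real (k + 1) * \<bar>Im w'\<bar> < pi / 2"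
  proof -
    have "real (k + 1) * \<bar>Im w'\<bar> = \<bar>(real k + 1) * (\<phi> - 2 * \<theta>)\<bar>" unfolding w'_def using at by (simp add: abs_mult)
    then show ?thesis unfolding kd using kphi by (simp add: abs_if) 
  qed
  have iw: "real (l + 1) * \<bar>Im (w r)\<bar> < pi / 2" for r
  proof -
    have "real (l + 1) * \<bar>Im (w r)\<bar> = (real l + 1) * \<phi>" unfolding w_def using at ph by (simp add: abs_mult)
    then show ?thesis unfolding ph using pi_gt_zero by linarith
  qed
  have Qw: "exp (of_nat (k + 1) * w r) * (- (of_real \<tau> * \<i> * exp (of_nat (k + 1) * of_real r))) = Q" for r
  proof -
    have i: "- (of_real \<tau> * \<i>) = exp (- \<i> * of_real (\<tau> * (pi / 2)))"
      using tau by (auto simp: exp_eq_polar cis_conv_exp[symmetric] complex_eq_iff Re_exp Im_exp)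
    have "of_nat (k + 1) * w r + of_nat (k + 1) * of_real r + - \<i> * of_real (\<tau> * (pi / 2)) = of_nat (k + 1) * w'"
    proof -
      have "of_nat (k + 1) * w r + of_nat (k + 1) * of_real r + - \<i> * of_real (\<tau> * (pi / 2)) = \<i> * of_real (\<tau> * ((real k + 1) * \<phi> - pi / 2))"
        unfolding w_def by (simp add: algebra_simps)
      then show ?thesis unfolding kd[symmetric] w'_def by (simp add: algebra_simps)
    qed
    then have "Q = exp (of_nat (k + 1) * w r) * exp (of_nat (k + 1) * of_real r) * (- (of_real \<tau> * \<i>))"
      unfolding Q_def i by (simp flip: exp_add)
    then show ?thesis by (simp add: mult_ac)
  qed
  have Pw: "exp (of_nat (l + 1) * w r) = P (exp (- (real l + 1) * r))" for r
  proof -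
    have "of_nat (l + 1) * w r = of_real (- (real l + 1) * r) + \<i> * of_real (\<tau> * ((real l + 1) * \<phi>))"
      unfolding w_def by (simp add: algebra_simps)
    then show ?thesis unfolding P_def ph by (simp only: exp_add exp_of_real)
  qed
  have ReQ: "Re Q > 0" unfolding Q_def by (rule Re_exp_pos) (use iw' in \<open>simp add: abs_mult del: of_nat_add\<close>)
  have "Re (of_nat (k + 1) * w') = 0" unfolding w'_def by (simp del: of_nat_add)
  then have nQ: "norm Q = 1" unfolding Q_def norm_exp_eq_Re by simp
  define d where "d = min (sqrt 2 / 2) (Re Q)"
  \<comment> \<open>The bound \<open>sqrt 2 / 2 = cos (pi / 4)\<close> for
    \<open>P \<epsilon>\<close> holds for all \<open>\<epsilon>\<close> in the interval, the
    endpoint \<open>P 0 = 0\<close> included; this permits passing to the limit by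
    continuity.\<close>
  have gd: "sectorial l k (P \<epsilon>) Q 1 d 1" if "\<epsilon> \<in> {0..1}" for \<epsilon>
  proof (rule sectorial_sector)
    have "norm (P \<epsilon>) = \<epsilon>" "Re (P \<epsilon>) = \<epsilon> * (sqrt 2 / 2)" unfolding P_def using that tau
      by (auto simp: norm_mult Re_exp cos_45)
    moreover have "\<epsilon> * d \<le> \<epsilon> * (sqrt 2 / 2)" using that unfolding d_def by (intro mult_left_mono) auto
    ultimately show "d * norm (P \<epsilon>) \<le> Re (P \<epsilon>)" by (simp only: mult.commute)
    show "d * norm Q \<le> Re Q" unfolding nQ d_def by simp
  qed (use kl ReQ nQ in \<open>auto simp: d_def\<close>)
  have cJ: "continuous_on {0..1} (\<lambda>\<epsilon>. amplitude l k (P \<epsilon>) Q c0 c1)" for c0 c1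
    by (rule amplitude_continuous[OF compact_Icc _ _ gd]) (auto simp: P_def intro!: continuous_intros)
  have lim: "((\<lambda>r. amplitude l k (P (exp (- (real l + 1) * r))) Q c0 c1) \<longlongrightarrow> amplitude l k (P 0) Q c0 c1) at_top" for c0 c1
  proof (rule continuous_on_tendsto_compose[OF cJ])
    show "((\<lambda>r. exp (- (real l + 1) * r)) \<longlongrightarrow> 0) at_top" by real_asymp
    have "eventually (\<lambda>r::real. r \<ge> 0) at_top" by (rule eventually_ge_at_top)
    then show "eventually (\<lambda>r. exp (- (real l + 1) * r) \<in> {0..1}) at_top"
      by eventually_elim (auto intro!: mult_nonpos_nonneg)
  qed simp
  have P0: "P 0 = 0" unfolding P_def by simp
  note R0 = alpha_beta_rotate_zero[OF less_imp_le[OF kl] iw', folded Q_def]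
  have R: "exp (w r / 2) * alpha l k (P (exp (- (real l + 1) * r))) Q = alpha l k 1 (- (of_real \<tau> * \<i> * exp (of_nat (k + 1) * of_real r)))"
    "beta l k (P (exp (- (real l + 1) * r))) Q = exp (w r / 2) * beta l k 1 (- (of_real \<tau> * \<i> * exp (of_nat (k + 1) * of_real r)))" for r
    using alpha_beta_rotate[OF kl iw, of r "- (of_real \<tau> * \<i> * exp (of_nat (k + 1) * of_real r))"] unfolding Qw Pw by simp_all
  have ehalf: "exp (w r / 2) = exp (- of_real r / 2) * exp (\<i> * of_real (\<tau> * \<phi>) / 2)" for r
    unfolding w_def exp_add[symmetric] by (rule arg_cong[of _ _ exp]) (simp add: field_simps)
  have ang: "exp (\<i> * of_real (\<tau> * \<phi>) / 2) = exp (\<i> * of_real (\<tau> * \<theta>)) * exp (w' / 2)"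
    unfolding w'_def exp_add[symmetric] by (rule arg_cong[of _ _ exp]) (simp add: field_simps)
  have ra: "exp (of_real r / 2) * alpha l k 1 (- (of_real \<tau> * \<i> * exp (of_nat (k + 1) * of_real r)))
     = exp (\<i> * of_real (\<tau> * \<phi>) / 2) * alpha l k (P (exp (- (real l + 1) * r))) Q" for r
    unfolding R(1)[of r, symmetric] ehalf by (simp add: exp_minus)
  have rb: "exp (- of_real r / 2) * beta l k 1 (- (of_real \<tau> * \<i> * exp (of_nat (k + 1) * of_real r)))
     = exp (- (\<i> * of_real (\<tau> * \<phi>) / 2)) * beta l k (P (exp (- (real l + 1) * r))) Q" for r
    unfolding R(2)[of r] ehalf by (simp add: exp_minus)
  have la: "((\<lambda>r. alpha l k (P (exp (- (real l + 1) * r))) Q) \<longlongrightarrow> alpha l k 0 Q) at_top"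
     "((\<lambda>r. beta l k (P (exp (- (real l + 1) * r))) Q) \<longlongrightarrow> beta l k 0 Q) at_top"
    unfolding alpha_def beta_def using lim[unfolded P0] by (auto intro!: tendsto_intros)
  have "exp (\<i> * of_real (\<tau> * \<phi>) / 2) * alpha l k 0 Q = exp (\<i> * of_real (\<tau> * \<theta>)) * alpha l k 0 1"
    unfolding ang mult.assoc R0 ..
  then show "((\<lambda>r::real. exp (of_real r / 2) * alpha l k 1 (- (of_real \<tau> * \<i> * exp (of_nat (k + 1) * of_real r)))) \<longlongrightarrow>
           exp (\<i> * of_real (\<tau> * \<theta>)) * alpha l k 0 1) at_top"
    unfolding ra using tendsto_mult[OF tendsto_const la(1)] by metis
  have "exp (- (\<i> * of_real (\<tau> * \<phi>) / 2)) * beta l k 0 Q = exp (- \<i> * of_real (\<tau> * \<theta>)) * beta l k 0 1"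
    unfolding exp_minus[of "\<i> * of_real (\<tau> * \<phi>) / 2"] ang R0 by (simp add: exp_minus field_simps)
  then show "((\<lambda>r::real. exp (- of_real r / 2) * beta l k 1 (- (of_real \<tau> * \<i> * exp (of_nat (k + 1) * of_real r)))) \<longlongrightarrow>
           exp (- \<i> * of_real (\<tau> * \<theta>)) * beta l k 0 1) at_top"
    unfolding rb using tendsto_mult[OF tendsto_const la(2)] by metis
qed

section \<open>Zeros of the connection coefficient\<close>

text \<open>The derivative of \<open>y * dy\<close> is \<open>dy^2 + Q * y^2\<close>, so
  \<open>y^2\<close> is nondecreasing and \<open>y\<close>, positive just after 0, cannot come back
  to 0. In the application \<open>Q\<close> is the square of a real frequency, whatever the sign of
  the latter.\<close>

lemma nonneg_ode:
  fixes y dy Q :: "real \<Rightarrow> real"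
  assumes y: "\<And>x. (y has_real_derivative dy x) (at x)" and dy: "\<And>x. (dy has_real_derivative Q x * y x) (at x)"
    and Q: "\<And>x. Q x \<ge> 0" and i: "y 0 \<ge> 0" "dy 0 \<ge> 0" "y 0 > 0 \<or> dy 0 > 0" and x: "x \<ge> 0"
  shows "y x \<ge> y 0 + dy 0 * x" "dy x \<ge> dy 0"
proof -
  have f: "y t * dy t \<ge> 0" if "t \<ge> 0" for t
  proof -
    have "y 0 * dy 0 \<le> y t * dy t"
    proof (rule DERIV_nonneg_imp_nondecreasing[OF that])
      fix s
      have "((\<lambda>t. y t * dy t) has_real_derivative dy s * dy s + Q s * y s * y s) (at s)"
        by (rule DERIV_mult[OF y dy])
      moreover have "dy s * dy s + Q s * y s * y s \<ge> 0" using Q[of s] by (simp add: mult.assoc)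
      ultimately show "\<exists>d. ((\<lambda>t. y t * dy t) has_real_derivative d) (at s) \<and> 0 \<le> d" by blast
    qed
    then show ?thesis using i by (smt (verit) mult_nonneg_nonneg)
  qed
  have sq: "(y s)\<^sup>2 \<le> (y t)\<^sup>2" if "0 \<le> s" "s \<le> t" for s t
  proof (rule DERIV_nonneg_imp_nondecreasing[OF that(2)])
    fix u assume "s \<le> u" "u \<le> t"
    then have "y u * dy u \<ge> 0" using f that by simp
    moreover have "((\<lambda>t. (y t)\<^sup>2) has_real_derivative 2 * (y u * dy u)) (at u)"
      unfolding power2_eq_square by (rule DERIV_cong[OF DERIV_mult[OF y y]]) simp
    ultimately show "\<exists>d. ((\<lambda>t. (y t)\<^sup>2) has_real_derivative d) (at u) \<and> 0 \<le> d" by (intro exI[of _ "2 * (y u * dy u)"]) simp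
  qed
  obtain e where e: "e > 0" "\<And>t. 0 < t \<Longrightarrow> t < e \<Longrightarrow> y t > 0"
  proof (cases "y 0 > 0")
    case True
    have "isCont y 0" using y DERIV_isCont by blast
    then obtain e where e: "e > 0" "\<And>t. \<bar>t\<bar> < e \<Longrightarrow> \<bar>y t - y 0\<bar> < y 0"
      using True unfolding continuous_at_eps_delta by (auto simp: dist_real_def)
    have "y t > 0" if "0 < t" "t < e" for t using e(2)[of t] that by (simp add: abs_if split: if_splits)
    then show ?thesis using that[OF e(1)] by blast
  next
    case False
    then have "y 0 = 0" "dy 0 > 0" using i by auto
    then show ?thesis using DERIV_pos_inc_right[OF y[of 0]] that by auto
  qed
  have pos: "y t \<ge> 0" if t: "t \<ge> 0" for t
  proof (rule ccontr)
    assume "\<not> y t \<ge> 0"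
    then have yt: "y t < 0" by simp
    then have t0: "t > 0" using t i by (cases "t = 0") auto
    define s where "s = min t e / 2"
    have s: "0 < s" "s < e" "s \<le> t" unfolding s_def using t0 e by auto
    have ys: "y s > 0" using e s by simp
    have "\<exists>u\<ge>s. u \<le> t \<and> y u = 0"
      by (rule IVT2') (use s ys yt y in \<open>auto intro!: continuous_at_imp_continuous_on DERIV_isCont\<close>)
    then obtain u where "s \<le> u" "u \<le> t" "y u = 0" by blast
    then show False using sq[of s u] s ys by simp
  qed
  have d: "dy t \<ge> dy 0" if "t \<ge> 0" for t
  proof (rule DERIV_nonneg_imp_nondecreasing[OF that])
    fix s assume "0 \<le> s" "s \<le> t"
    then show "\<exists>d. (dy has_real_derivative d) (at s) \<and> 0 \<le> d" using dy[of s] Q[of s] pos[of s] by auto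
  qed
  show "dy x \<ge> dy 0" by (rule d[OF x])
  have "y 0 - dy 0 * 0 \<le> y x - dy 0 * x"
  proof (rule DERIV_nonneg_imp_nondecreasing[OF x])
    fix s assume s: "0 \<le> s" "s \<le> x"
    have "((\<lambda>x. y x - dy 0 * x) has_real_derivative dy s - dy 0) (at s)"
      by (rule DERIV_cong[OF DERIV_diff[OF y DERIV_cmult[OF DERIV_ident]]]) simp
    then show "\<exists>d. ((\<lambda>x. y x - dy 0 * x) has_real_derivative d) (at s) \<and> 0 \<le> d" using d[OF s(1)] by force
  qed
  then show "y x \<ge> y 0 + dy 0 * x" by simp
qed

lemma has_real_derivative_of_real:
  fixes f :: "complex \<Rightarrow> complex"
  assumes "\<And>x. f (of_real x) = of_real (g x)" "(f has_field_derivative of_real d) (at (of_real x))"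
  shows "(g has_real_derivative d) (at x)"
proof -
  have "((\<lambda>x. of_real (g x) :: complex) has_vector_derivative of_real d) (at x)"
    using has_vector_derivative_real_field[OF assms(2)] assms(1) by simp
  from bounded_linear.has_vector_derivative[OF bounded_linear_Re this] show ?thesis
    by (simp add: has_real_derivative_iff_has_vector_derivative)
qed

definition rfreq :: "nat \<Rightarrow> nat \<Rightarrow> real \<Rightarrow> real \<Rightarrow> real \<Rightarrow> real" where
  "rfreq l k p q x = p * x ^ l + q * x ^ k"
definition rfreq' :: "nat \<Rightarrow> nat \<Rightarrow> real \<Rightarrow> real \<Rightarrow> real \<Rightarrow> real" where
  "rfreq' l k p q x = p * (real l * x ^ (l - 1)) + q * (real k * x ^ (k - 1))"
definition rfreq_int :: "nat \<Rightarrow> nat \<Rightarrow> real \<Rightarrow> real \<Rightarrow> real \<Rightarrow> real" where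
  "rfreq_int l k p q x = p * x ^ (l + 1) / real (l + 1) + q * x ^ (k + 1) / real (k + 1)"

lemma freq_of_real:
  "freq l k (of_real p) (of_real q) (of_real x) = of_real (rfreq l k p q x)"
  "freq' l k (of_real p) (of_real q) (of_real x) = of_real (rfreq' l k p q x)"
  "freq_int l k (of_real p) (of_real q) (of_real x) = of_real (rfreq_int l k p q x)"
  unfolding freq_def rfreq_def freq'_def rfreq'_def freq_int_def rfreq_int_def by simp_all

lemma real_solution:
  obtains y dy :: "real \<Rightarrow> real" where
    "\<And>x. sol l k (of_real p) (of_real q) (of_real c0) (of_real c1) (of_real x) = of_real (y x)"
    "\<And>x. dsol l k (of_real p) (of_real q) (of_real c0) (of_real c1) (of_real x) = of_real (dy x)"
    "\<And>x. (y has_real_derivative dy x) (at x)" "\<And>x. (dy has_real_derivative (rfreq l k p q x)\<^sup>2 * y x) (at x)"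
    "y 0 = c0" "dy 0 = c1"
proof -
  let ?s = "sol l k (of_real p) (of_real q) (of_real c0) (of_real c1)"
  let ?d = "dsol l k (of_real p) (of_real q) (of_real c0) (of_real c1)"
  define y where "y x = Re (?s (of_real x))" for x
  define dy where "dy x = Re (?d (of_real x))" for x
  have s: "?s (of_real x) = of_real (y x)" "?d (of_real x) = of_real (dy x)" for x
    unfolding y_def dy_def using sol_Reals[of "of_real p" "of_real q" "of_real c0" "of_real c1" "of_real x" l k]
    by (simp_all add: complex_eq_iff complex_is_Real_iff)
  show ?thesis
  proof
    show "?s (of_real x) = of_real (y x)" "?d (of_real x) = of_real (dy x)" for x by (rule s)+
    show "y 0 = c0" "dy 0 = c1" unfolding y_def dy_def by simp_all
    show "(y has_real_derivative dy x) (at x)" for x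
      by (rule has_real_derivative_of_real[where f = ?s and g = y, OF s(1)]) (use sol_has_field_derivative s(2) in metis)
    show "(dy has_real_derivative (rfreq l k p q x)\<^sup>2 * y x) (at x)" for x
      by (rule has_real_derivative_of_real[where f = ?d and g = dy, OF s(2)])
        (use dsol_has_field_derivative[of l k "of_real p" "of_real q" "of_real c0" "of_real c1" "of_real x"] s(1)[of x]
          freq_of_real(1)[of l k p q x, unfolded freq_def] in simp)
  qed
qed

text \<open>Up to \<open>X\<close> convexity of the positive solution gives the linear lower bound.
  Beyond \<open>X\<close>, where the frequency is nondecreasing, \<open>Z1 + Z2\<close> lies between
  0 and \<open>2 * Z1\<close>; so the derivative of \<open>Z1\<close> is at least
  \<open>- 2 * C / x^2\<close> times \<open>Z1\<close>, and \<open>Z1\<close> loses at most the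
  factor \<open>exp (- 2 * C / X)\<close>.\<close>

lemma amplitude_real_lower_bound:
  assumes g: "sectorial l k (of_real p) (of_real q) X d \<nu>"
    and mono: "\<And>x. X \<le> x \<Longrightarrow> rfreq' l k p q x \<ge> 0"
    and i: "c0 \<ge> 0" "c1 \<ge> 0" "c0 > 0 \<or> c1 > 0"
  obtains j where "amplitude l k (of_real p) (of_real q) (of_real c0) (of_real c1) = of_real j"
    "j \<ge> exp (- (2 * coupling_const l d \<nu> / X)) * (sqrt (rfreq l k p q X) * exp (- rfreq_int l k p q X) * (c0 + c1 * X) / 2)"
proof -
  obtain y dy where y: 
    "\<And>x. sol l k (of_real p) (of_real q) (of_real c0) (of_real c1) (of_real x) = of_real (y x)"
    "\<And>x. dsol l k (of_real p) (of_real q) (of_real c0) (of_real c1) (of_real x) = of_real (dy x)"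
    "\<And>x. (y has_real_derivative dy x) (at x)" "\<And>x. (dy has_real_derivative (rfreq l k p q x)\<^sup>2 * y x) (at x)"
    "y 0 = c0" "dy 0 = c1" using real_solution[of l k p q c0 c1] by blast
  have X0: "X > 0" and C0: "coupling_const l d \<nu> \<ge> 0" using g coupling_const_nonneg unfolding sectorial_def by auto
  have pos: "y x \<ge> c0 + c1 * x" "dy x \<ge> c1" if "x \<ge> 0" for x
    using nonneg_ode[OF y(3,4) _ _ _ _ that] i y(5,6) by auto
  have a0: "rfreq l k p q x > 0" if "X \<le> x" for x using sectorial_Re(2)[OF g that] unfolding freq_of_real by simp
  define C where "C = coupling_const l d \<nu>"
  define z where "z x = Re (Z1 l k (of_real p) (of_real q) (of_real c0) (of_real c1) (of_real x))" for x
  define e where "e x = inverse (sqrt (rfreq l k p q x)) * exp (- rfreq_int l k p q x) * (rfreq l k p q x * y x)" for x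
  have sr: "prefactor l k (of_real p) (of_real q) (of_real x) = of_real (inverse (sqrt (rfreq l k p q x)))" if "X \<le> x" for x
    unfolding prefactor_def freq_of_real using a0[OF that] by simp
  have Z': "Z1 l k (of_real p) (of_real q) (of_real c0) (of_real c1) (of_real x) =
     of_real (inverse (sqrt (rfreq l k p q x)) * exp (- rfreq_int l k p q x) *
     (dy x + (rfreq l k p q x + rfreq' l k p q x / (2 * rfreq l k p q x)) * y x) / 2)" if "X \<le> x" for x
    unfolding Z1_def sr[OF that] y(1,2) freq_of_real by (simp flip: exp_of_real)
  have Z: "Z1 l k (of_real p) (of_real q) (of_real c0) (of_real c1) (of_real x) = of_real (z x)" if "X \<le> x" for x
    unfolding z_def Z'[OF that] by (simp only: Re_complex_of_real)
  have ZZ: "Z1 l k (of_real p) (of_real q) (of_real c0) (of_real c1) (of_real x) +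
        Z2 l k (of_real p) (of_real q) (of_real c0) (of_real c1) (of_real x) = of_real (e x)" if "X \<le> x" for x
    unfolding Z1_plus_Z2 e_def sr[OF that] y(1,2) freq_of_real by (simp flip: exp_of_real)
  have ez: "0 \<le> e x" "e x \<le> 2 * z x" if "X \<le> x" for x
  proof -
    have "c0 + c1 * x \<ge> 0" "x \<ge> 0" using i X0 that by auto
    then have *: "y x \<ge> 0" "dy x \<ge> 0" "inverse (sqrt (rfreq l k p q x)) * exp (- rfreq_int l k p q x) \<ge> 0"
      using pos[of x] i a0[OF that] by (linarith, linarith, simp)
    then show "0 \<le> e x" unfolding e_def using a0[OF that] by simp
    have "rfreq l k p q x * y x \<le> dy x + (rfreq l k p q x + rfreq' l k p q x / (2 * rfreq l k p q x)) * y x"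
      unfolding distrib_right using * mono[OF that] a0[OF that] by simp
    then have "e x \<le> inverse (sqrt (rfreq l k p q x)) * exp (- rfreq_int l k p q x) * (dy x + (rfreq l k p q x + rfreq' l k p q x / (2 * rfreq l k p q x)) * y x)"
      unfolding e_def using *(3) by (rule mult_left_mono)
    then show "e x \<le> 2 * z x" unfolding z_def Z'[OF that] Re_complex_of_real by simp
  qed
  have grow: "z X * exp (- (2 * C) / X) \<le> z x * exp (- (2 * C) / x)" if x: "X \<le> x" for x
  proof (rule DERIV_nonneg_imp_nondecreasing[OF x])
    fix t assume t: "X \<le> t" "t \<le> x"
    have t0: "t > 0" using X0 t by simp
    define b where "b = coupling l k (of_real p) (of_real q) (of_real t)"
    have b: "norm b \<le> C / t\<^sup>2" unfolding b_def C_def by (rule norm_coupling[OF g t(1)])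
    have "((\<lambda>x::real. Z1 l k (of_real p) (of_real q) (of_real c0) (of_real c1) (of_real x)) has_vector_derivative - b * of_real (e t)) (at t)"
      using has_vector_derivative_real_field[OF Z_deriv(1)[OF sectorial_Re(3)[OF g t(1)], of "of_real c0" "of_real c1"]] unfolding ZZ[OF t(1)] b_def by simp
    from bounded_linear.has_vector_derivative[OF bounded_linear_Re this]
    have rd: "(z has_real_derivative - Re b * e t) (at t)"
      unfolding z_def[abs_def] by (simp add: has_real_derivative_iff_has_vector_derivative)
    have "Re b * e t \<le> C / t\<^sup>2 * (2 * z t)"
      using b abs_Re_le_cmod[of b] ez[OF t(1)] by (intro mult_mono) (auto simp: C_def C0)
    then have nn: "(- Re b * e t) * exp (- (2 * C) / t) + exp (- (2 * C) / t) * (2 * C / t\<^sup>2) * z t \<ge> 0"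
      using mult_right_mono[of "Re b * e t" "C / t\<^sup>2 * (2 * z t)" "exp (- (2 * C) / t)"] by (simp add: algebra_simps)
    have "((\<lambda>t. - (2 * C) / t) has_real_derivative 2 * C / t\<^sup>2) (at t)"
      using t0 by (auto intro!: derivative_eq_intros simp: power2_eq_square)
    from DERIV_mult_exp[OF rd this] nn
    show "\<exists>y. ((\<lambda>t. z t * exp (- (2 * C) / t)) has_real_derivative y) (at t) \<and> 0 \<le> y" by blast
  qed
  define JJ where "JJ = amplitude l k (of_real p) (of_real q) (of_real c0) (of_real c1)"
  note L = amplitude_limit(1)[OF g, of "of_real c0" "of_real c1", folded JJ_def]
  have zl: "(z \<longlongrightarrow> Re JJ) at_top" unfolding z_def[abs_def] by (intro tendsto_intros L)
  have "((\<lambda>x::real. Im (Z1 l k (of_real p) (of_real q) (of_real c0) (of_real c1) (of_real x))) \<longlongrightarrow> Im JJ) at_top"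
    by (intro tendsto_intros L)
  moreover have "eventually (\<lambda>x::real. Im (Z1 l k (of_real p) (of_real q) (of_real c0) (of_real c1) (of_real x)) = 0) at_top"
    using eventually_ge_at_top[of X] by eventually_elim (simp add: Z)
  ultimately have "((\<lambda>x::real. 0) \<longlongrightarrow> Im JJ) at_top" by (rule Lim_transform_eventually)
  then have "Im JJ = 0" by (simp add: tendsto_const_iff)
  then have amplitude: "JJ = of_real (Re JJ)" by (simp add: complex_eq_iff)
  have "eventually (\<lambda>x. z X * exp (- (2 * C) / X) \<le> z x) at_top"
    using eventually_ge_at_top[of X]
  proof eventually_elim
    case (elim x)
    have "z x * exp (- (2 * C) / x) \<le> z x * 1"
      using ez[OF elim] elim X0 C0 by (intro mult_left_mono) (auto simp: C_def)
    then show ?case using grow[OF elim] by simp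
  qed
  then have ReJ: "z X * exp (- (2 * C) / X) \<le> Re JJ" by (intro tendsto_lowerbound[OF zl]) auto
  have "sqrt (rfreq l k p q X) * sqrt (rfreq l k p q X) = rfreq l k p q X" using a0[of X] by simp
  then have eX: "e X = sqrt (rfreq l k p q X) * exp (- rfreq_int l k p q X) * y X"
    unfolding e_def using a0[of X] by (simp add: field_simps)
  have "sqrt (rfreq l k p q X) * exp (- rfreq_int l k p q X) * (c0 + c1 * X) \<le> e X"
    unfolding eX using pos[of X] X0 a0[of X] by (intro mult_left_mono) auto
  then have le: "exp (- (2 * C / X)) * (sqrt (rfreq l k p q X) * exp (- rfreq_int l k p q X) * (c0 + c1 * X) / 2) \<le> exp (- (2 * C / X)) * z X"
    using ez(2)[of X] by (intro mult_left_mono) auto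
  have "exp (- (2 * C / X)) * z X \<le> Re JJ" using ReJ by (simp add: mult.commute)
  from order_trans[OF le this] show ?thesis using that amplitude unfolding C_def JJ_def by blast
qed

lemma sectorial_one:
  assumes "s \<ge> 0" "k \<le> l" shows "sectorial l k 1 (of_real s) 1 1 1"
  unfolding sectorial_def
proof (intro conjI allI impI)
  fix x :: real assume x: "1 \<le> x"
  have "freq l k 1 (of_real s) (of_real x) = of_real (freq_norm l k 1 (of_real s) x)"
    unfolding freq_def freq_norm_def using assms by simp
  then show "1 * freq_norm l k 1 (of_real s) x \<le> Re (freq l k 1 (of_real s) (of_real x))" by simp
  have "x ^ l \<ge> 1" "s * x ^ k \<ge> 0" using x assms by auto
  then show "1 \<le> freq_norm l k 1 (of_real s) x" unfolding freq_norm_def using assms by simp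
qed (use assms in auto)

text \<open>The factor \<open>exp (- 1 - s)\<close> is the bound \<open>1 + s\<close> for the
  primitive of the frequency at \<open>X = 1\<close>. It is crude, but linear in \<open>s\<close>,
  and thus of lower order than the growth it will be multiplied with.\<close>

lemma alpha_beta_pos_lower:
  assumes s: "s \<ge> 0" and kl: "k \<le> l"
  obtains a b where "alpha l k 1 (of_real s) = of_real a" "beta l k 1 (of_real s) = of_real (- b)"
    "a \<ge> exp (- (2 * coupling_const l 1 1)) * exp (- 1 - s)" "b \<ge> exp (- (2 * coupling_const l 1 1)) * exp (- 1 - s)"
proof -
  have g: "sectorial l k (of_real 1) (of_real s) 1 1 1" using sectorial_one[OF s kl] by simp
  have m: "rfreq' l k 1 s x \<ge> 0" if "x \<ge> 1" for x unfolding rfreq'_def using that s by simp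
  have "1 / real (l + 1) \<le> 1" "s / real (k + 1) \<le> s" using s by (auto simp: field_simps)
  moreover have "rfreq_int l k 1 s 1 = 1 / real (l + 1) + s / real (k + 1)" unfolding rfreq_int_def by simp
  ultimately have A: "rfreq_int l k 1 s 1 \<le> 1 + s" by linarith
  have "1 * exp (- 1 - s) \<le> sqrt (rfreq l k 1 s 1) * exp (- rfreq_int l k 1 s 1)"
    using A s by (intro mult_mono) (auto simp: rfreq_def)
  then have B: "exp (- (2 * coupling_const l 1 1)) * exp (- 1 - s) \<le> exp (- (2 * coupling_const l 1 1 / 1)) * (sqrt (rfreq l k 1 s 1) * exp (- rfreq_int l k 1 s 1))"
    by (intro mult_mono) auto
  obtain j0 where j0: "amplitude l k 1 (of_real s) 1 0 = of_real j0"
    "j0 \<ge> exp (- (2 * coupling_const l 1 1 / 1)) * (sqrt (rfreq l k 1 s 1) * exp (- rfreq_int l k 1 s 1) * (1 + 0 * 1) / 2)"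
    using amplitude_real_lower_bound[OF g m, of 1 0] by auto
  obtain j1 where j1: "amplitude l k 1 (of_real s) 0 1 = of_real j1"
    "j1 \<ge> exp (- (2 * coupling_const l 1 1 / 1)) * (sqrt (rfreq l k 1 s 1) * exp (- rfreq_int l k 1 s 1) * (0 + 1 * 1) / 2)"
    using amplitude_real_lower_bound[OF g m, of 0 1] by auto
  show ?thesis
  proof
    show "alpha l k 1 (of_real s) = of_real (2 * j1)" "beta l k 1 (of_real s) = of_real (- (2 * j0))"
      unfolding alpha_def beta_def j0 j1 by simp_all
    define T where "T = exp (- (2 * coupling_const l 1 1 / 1)) * (sqrt (rfreq l k 1 s 1) * exp (- rfreq_int l k 1 s 1))"
    have "T \<le> 2 * j0" "T \<le> 2 * j1" using j0(2) j1(2) unfolding T_def by simp_all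
    then show "exp (- (2 * coupling_const l 1 1)) * exp (- 1 - s) \<le> 2 * j1" "exp (- (2 * coupling_const l 1 1)) * exp (- 1 - s) \<le> 2 * j0"
      using B unfolding T_def[symmetric] by simp_all
  qed
qed

lemma alpha_beta_zero_nonzero:
  assumes kl: "k \<le> l"
  shows "alpha l k 0 1 \<noteq> 0" "beta l k 0 1 \<noteq> 0"
proof -
  have g: "sectorial l k (of_real 0) (of_real 1) 1 1 1" using sectorial_sector[OF kl, of 1 0 1 1] by simp
  have m: "rfreq' l k 0 1 x \<ge> 0" if "x \<ge> 1" for x unfolding rfreq'_def using that by simp
  have a1: "rfreq l k 0 1 1 = 1" unfolding rfreq_def by simp
  obtain j0 where j0: "amplitude l k 0 1 1 0 = of_real j0" "j0 \<ge> exp (- (2 * coupling_const l 1 1 / 1)) * (sqrt (rfreq l k 0 1 1) * exp (- rfreq_int l k 0 1 1) * (1 + 0 * 1) / 2)"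
    using amplitude_real_lower_bound[OF g m, of 1 0] by auto
  obtain j1 where j1: "amplitude l k 0 1 0 1 = of_real j1" "j1 \<ge> exp (- (2 * coupling_const l 1 1 / 1)) * (sqrt (rfreq l k 0 1 1) * exp (- rfreq_int l k 0 1 1) * (0 + 1 * 1) / 2)"
    using amplitude_real_lower_bound[OF g m, of 0 1] by auto
  have "exp (- (2 * coupling_const l 1 1 / 1)) * (sqrt (rfreq l k 0 1 1) * exp (- rfreq_int l k 0 1 1) / 2) > 0" unfolding a1 by simp
  then have "j0 > 0" "j1 > 0" using j0(2) j1(2) by simp_all
  then show "alpha l k 0 1 \<noteq> 0" "beta l k 0 1 \<noteq> 0" unfolding alpha_def beta_def j0 j1 by simp_all
qed

text \<open>The reflection \<open>x \<mapsto> - x\<close> turns \<open>\<zeta>\<close> into \<open>parity_sign l k * \<zeta>\<close>, so up to sign \<open>connection l k\<close> is the Wronskian of the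
  solutions that are recessive at \<open>+\<infinity>\<close> and at \<open>-\<infinity>\<close>.\<close>

definition parity_sign :: "nat \<Rightarrow> nat \<Rightarrow> complex" where "parity_sign l k = (- 1) ^ (l + k)"

definition connection :: "nat \<Rightarrow> nat \<Rightarrow> complex \<Rightarrow> complex" where
  "connection l k \<zeta> = alpha l k 1 (- \<zeta>) * beta l k 1 (- (parity_sign l k * \<zeta>)) + beta l k 1 (- \<zeta>) * alpha l k 1 (- (parity_sign l k * \<zeta>))"

lemma parity_sign_cases: "parity_sign l k = 1 \<or> parity_sign l k = - 1"
  unfolding parity_sign_def by (metis minus_one_power_iff)

lemma connection_holomorphic: assumes "k < l" shows "connection l k holomorphic_on UNIV"
  unfolding connection_def[abs_def]
  by (intro holomorphic_intros alpha_beta_holomorphic_lt assms) auto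

lemma sectorial_one_complex: assumes "k < l" shows "\<exists>X d \<nu>. sectorial l k 1 q X d \<nu>"
  using sectorial_lt[OF assms, of 1 1 "norm q + 1" q] by force

text \<open>By reflection, \<open>alpha\<close> and \<open>- beta\<close> at the parameter
  \<open>parity_sign l k * \<zeta>\<close> are the initial values of the solution recessive at the
  other end. Half of \<open>connection\<close> is, up to sign, its dominant coefficient at this
  end.\<close>

lemma amplitude_eq_connection:
  assumes "k < l"
  shows "amplitude l k 1 (- \<zeta>) (alpha l k 1 (- (parity_sign l k * \<zeta>))) (- beta l k 1 (- (parity_sign l k * \<zeta>))) = - connection l k \<zeta> / 2"
proof -
  obtain X d \<nu> where g: "sectorial l k 1 (- \<zeta>) X d \<nu>" using sectorial_one_complex[OF assms] by blast
  show ?thesis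
    unfolding connection_def amplitude_basis[OF g, of "alpha l k 1 (- (parity_sign l k * \<zeta>))"]
    unfolding alpha_def[of l k 1 "- \<zeta>"] beta_def[of l k 1 "- \<zeta>"] by (simp add: algebra_simps)
qed

text \<open>Take \<open>\<zeta> = r * X ^ (l - k)\<close>. The condition \<open>r < 1\<close> puts
  \<open>X\<close> to the right of the turning point, and \<open>r > (k + 1) / (l + 1)\<close> makes
  the integral of the frequency over \<open>[0, X]\<close> negative, so that
  \<open>exp (- freq_int)\<close> is \<open>exp (\<kappa> * X ^ (l + 1))\<close>. The factor at the
  reflected parameter is equally large or, for negative \<open>parity_sign\<close>, at least of size
  \<open>exp (- 1 - s)\<close> with \<open>s \<le> X ^ l\<close>, which cannot compensate.\<close>

lemma connection_unbounded:
  assumes kl: "k < l"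
  shows "\<exists>\<zeta>. norm (connection l k \<zeta>) > B"
proof -
  define r where "r = ((real k + 1) / (real l + 1) + 1) / 2"
  have r: "(real k + 1) / (real l + 1) < r" "r < 1" "0 < r"
  proof -
    have u: "(real k + 1) / (real l + 1) < 1" "(real k + 1) / (real l + 1) > 0" using kl by simp_all
    have "u < (u + 1) / 2 \<and> (u + 1) / 2 < 1 \<and> 0 < (u + 1) / 2" if "u < 1" "u > 0" for u :: real using that by simp
    from this[OF u] show "(real k + 1) / (real l + 1) < r" "r < 1" "0 < r" unfolding r_def by blast+
  qed
  define \<kappa> where "\<kappa> = r / (real k + 1) - 1 / (real l + 1)"
  have kap: "\<kappa> > 0" 
  proof -
    have "1 / (real l + 1) = (real k + 1) / (real l + 1) / (real k + 1)" by simp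
    also have "\<dots> < r / (real k + 1)" using r(1) by (intro divide_strict_right_mono) auto
    finally show ?thesis unfolding \<kappa>_def by simp
  qed
  define C where "C = coupling_const l ((1 - r) / (1 + r)) 1"
  have C: "C \<ge> 0" unfolding C_def using r by (intro coupling_const_nonneg) auto
  define c1 where "c1 = exp (- (2 * C)) * sqrt (1 - r)"
  have c1: "c1 > 0" unfolding c1_def using r by simp
  define c2 where "c2 = min c1 (exp (- (2 * coupling_const l 1 1)))"
  have c2: "c2 > 0" unfolding c2_def using c1 by simp
  have main: "norm (connection l k (of_real (r * X ^ (l - k)))) \<ge> c1 * c2 * exp ((\<kappa> * X - 1) * X ^ l - 1)" if X: "X \<ge> 1" for X
  proof -
    define s where "s = r * X ^ (l - k)"
    have s0: "s \<ge> 0" unfolding s_def using r(2,3) X by simp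
    have "s \<le> 1 * X ^ l" unfolding s_def using r(2,3) X by (intro mult_mono power_increasing) auto
    then have sX: "s \<le> X ^ l" by simp
    have g: "sectorial l k (of_real 1) (of_real (- s)) X ((1 - r) / (1 + r)) 1"
    proof -
      have "norm (of_real (- s) :: complex) = s" using s0 unfolding norm_of_real by simp
      then have "norm (of_real (- s) :: complex) \<le> r * X ^ (l - k)" by (simp add: s_def)
      from sectorial_ratio[OF less_imp_le[OF kl] X less_imp_le[OF r(3)] r(2) this] show ?thesis by simp
    qed
    have sx: "s * x ^ k \<le> r * x ^ l" if "X \<le> x" for x
    proof -
      have "s * x ^ k \<le> r * x ^ (l - k) * x ^ k" unfolding s_def using r(2,3) X that
        by (intro mult_right_mono mult_left_mono power_mono) auto
      also have "\<dots> = r * x ^ l" using kl by (simp flip: power_add)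
      finally show ?thesis .
    qed
    have m: "rfreq' l k 1 (- s) x \<ge> 0" if x: "X \<le> x" for x
    proof -
      have x0: "x > 0" using x X by simp
      have *: "x * (real n * x ^ (n - 1)) = real n * x ^ n" for n by (cases n) auto
      have "x * rfreq' l k 1 (- s) x = x * (real l * x ^ (l - 1)) - s * (x * (real k * x ^ (k - 1)))"
        unfolding rfreq'_def by (simp add: algebra_simps)
      also have "\<dots> = real l * x ^ l - real k * (s * x ^ k)" unfolding * by simp
      also have "\<dots> \<ge> 0"
      proof -
        have "r * x ^ l \<le> 1 * x ^ l" using r(2,3) x0 by (intro mult_right_mono) auto
        then have "s * x ^ k \<le> x ^ l" using sx[OF x] by simp
        then have "real k * (s * x ^ k) \<le> real l * x ^ l" using kl s0 x0 by (intro mult_mono) auto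
        then show ?thesis by simp
      qed
      finally show ?thesis using x0 by (simp add: zero_le_mult_iff)
    qed
    have aX: "rfreq l k 1 (- s) X \<ge> 1 - r"
    proof -
      have "(1 - r) * 1 \<le> (1 - r) * X ^ l" using r(2,3) X by (intro mult_left_mono) auto
      then show ?thesis unfolding rfreq_def using sx[of X] by (simp add: algebra_simps)
    qed
    have AX: "- rfreq_int l k 1 (- s) X = \<kappa> * X ^ (l + 1)"
    proof -
      have "X ^ (l - k) * X ^ (k + 1) = X ^ (l + 1)" using kl by (simp only: power_add[symmetric]) simp
      then have "s * X ^ (k + 1) = r * X ^ (l + 1)" unfolding s_def by (simp only: mult.assoc)
      then have "- rfreq_int l k 1 (- s) X = r * X ^ (l + 1) / real (k + 1) - X ^ (l + 1) / real (l + 1)"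
        unfolding rfreq_int_def by simp
      then show ?thesis unfolding \<kappa>_def by (simp add: algebra_simps)
    qed
    have bound: "\<exists>j. amplitude l k 1 (of_real (- s)) (of_real d0) (of_real d1) = of_real j \<and>
       j \<ge> c1 * exp (\<kappa> * X ^ (l + 1)) * (d0 + d1) / 2" if d: "d0 \<ge> 0" "d1 \<ge> 0" "d0 > 0 \<or> d1 > 0" for d0 d1
    proof -
      obtain j where j: "amplitude l k 1 (of_real (- s)) (of_real d0) (of_real d1) = of_real j"
        "j \<ge> exp (- (2 * C / X)) * (sqrt (rfreq l k 1 (- s) X) * exp (- rfreq_int l k 1 (- s) X) * (d0 + d1 * X) / 2)"
        using amplitude_real_lower_bound[OF g m d] unfolding C_def by auto
      have "exp (- (2 * C)) * (sqrt (1 - r) * exp (\<kappa> * X ^ (l + 1)) * (d0 + d1) / 2) \<le>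
         exp (- (2 * C / X)) * (sqrt (rfreq l k 1 (- s) X) * exp (- rfreq_int l k 1 (- s) X) * (d0 + d1 * X) / 2)"
        unfolding AX
      proof (intro mult_mono divide_right_mono)
        show "exp (- (2 * C)) \<le> exp (- (2 * C / X))" using C X by (simp add: field_simps mult_left_mono)
        show "d0 + d1 \<le> d0 + d1 * X" using d X by (simp add: mult_left_mono[of 1 X d1, simplified])
      qed (use aX r(2,3) d X in auto)
      then show ?thesis using j unfolding c1_def by (intro exI[of _ j]) (simp add: algebra_simps)
    qed
    have e1: "exp (\<kappa> * X ^ (l + 1)) \<ge> 1" using kap X by simp
    \<comment> \<open>Not only sizes but signs matter: \<open>alpha\<close> positive and
      \<open>beta\<close> negative make \<open>(alpha, - beta)\<close> nonnegative data, to which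
      \<open>bound\<close> applies without cancellation.\<close>
    have ab: "\<exists>a b. alpha l k 1 (- (parity_sign l k * of_real s)) = of_real a \<and> beta l k 1 (- (parity_sign l k * of_real s)) = of_real (- b) \<and>
       a \<ge> c2 * exp (- 1 - s) \<and> b \<ge> c2 * exp (- 1 - s)"
      using parity_sign_cases[of l k]
    proof
      assume "parity_sign l k = 1"
      then have e: "- (parity_sign l k * of_real s) = of_real (- s)" by simp
      obtain j0 where j0: "amplitude l k 1 (of_real (- s)) 1 0 = of_real j0" "j0 \<ge> c1 * exp (\<kappa> * X ^ (l + 1)) / 2"
        using bound[of 1 0, OF zero_le_one order_refl disjI1[OF zero_less_one]] unfolding of_real_0 of_real_1 add_0_right mult_1_right by blast
      obtain j1 where j1: "amplitude l k 1 (of_real (- s)) 0 1 = of_real j1" "j1 \<ge> c1 * exp (\<kappa> * X ^ (l + 1)) / 2"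
        using bound[of 0 1, OF order_refl zero_le_one disjI2[OF zero_less_one]] unfolding of_real_0 of_real_1 add_0_left mult_1_right by blast
      have "c2 * exp (- 1 - s) \<le> c1 * exp (\<kappa> * X ^ (l + 1))"
      proof (intro mult_mono)
        show "exp (- 1 - s) \<le> exp (\<kappa> * X ^ (l + 1))" using e1 s0 by (intro order_trans[OF _ e1]) simp
      qed (use c1 in \<open>auto simp: c2_def\<close>)
      then show ?thesis unfolding e alpha_def beta_def j0 j1
        by (intro exI[of _ "2 * j1"] exI[of _ "2 * j0"]) (use j0(2) j1(2) in simp)
    next
      assume "parity_sign l k = - 1"
      then have e: "- (parity_sign l k * of_real s) = of_real s" by simp
      have c: "c2 * exp (- 1 - s) \<le> exp (- (2 * coupling_const l 1 1)) * exp (- 1 - s)" unfolding c2_def by (intro mult_right_mono) auto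
      obtain a b where "alpha l k 1 (of_real s) = of_real a" "beta l k 1 (of_real s) = of_real (- b)"
        "a \<ge> exp (- (2 * coupling_const l 1 1)) * exp (- 1 - s)" "b \<ge> exp (- (2 * coupling_const l 1 1)) * exp (- 1 - s)"
        using alpha_beta_pos_lower[OF s0 less_imp_le[OF kl]] by blast
      then show ?thesis unfolding e using order_trans[OF c] by blast
    qed
    then obtain a b where ab: "alpha l k 1 (- (parity_sign l k * of_real s)) = of_real a" "beta l k 1 (- (parity_sign l k * of_real s)) = of_real (- b)"
       "a \<ge> c2 * exp (- 1 - s)" "b \<ge> c2 * exp (- 1 - s)" by blast
    have p: "c2 * exp (- 1 - s) > 0" using c2 by simp
    then have ab0: "a > 0" "b > 0" using ab by linarith+
    have "amplitude l k 1 (- of_real s) (of_real a) (of_real b) = - connection l k (of_real s) / 2"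
      using amplitude_eq_connection[OF kl, of "of_real s"] unfolding ab by simp
    then have connection: "norm (connection l k (of_real s)) = 2 * norm (amplitude l k 1 (of_real (- s)) (of_real a) (of_real b))"
      by (simp add: norm_divide)
    obtain j where j: "amplitude l k 1 (of_real (- s)) (of_real a) (of_real b) = of_real j" "j \<ge> c1 * exp (\<kappa> * X ^ (l + 1)) * (a + b) / 2"
      using bound[of a b] ab0 by auto
    have "c1 * exp (\<kappa> * X ^ (l + 1)) * (c2 * exp (- 1 - s)) \<le> c1 * exp (\<kappa> * X ^ (l + 1)) * (a + b)"
      using ab ab0 c1 by (intro mult_left_mono) auto
    also have "\<dots> \<le> norm (connection l k (of_real s))" unfolding connection j using j(2) by simp
    finally have 1: "c1 * exp (\<kappa> * X ^ (l + 1)) * (c2 * exp (- 1 - s)) \<le> norm (connection l k (of_real s))" .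
    have "c1 * c2 * exp ((\<kappa> * X - 1) * X ^ l - 1) \<le> c1 * c2 * exp (\<kappa> * X ^ (l + 1) + (- 1 - s))"
      using sX c1 c2 by (intro mult_left_mono) (auto simp: algebra_simps)
    also have "\<dots> = c1 * exp (\<kappa> * X ^ (l + 1)) * (c2 * exp (- 1 - s))" by (simp only: exp_add mult_ac)
    finally show ?thesis using 1 unfolding s_def by linarith
  qed
  have "filterlim (\<lambda>X. c1 * c2 * exp (\<kappa> * X - 2)) at_top at_top" using kap c1 c2 by real_asymp
  then have "eventually (\<lambda>X. c1 * c2 * exp (\<kappa> * X - 2) > B) at_top" by (simp add: filterlim_at_top_dense)
  moreover have "eventually (\<lambda>X. X \<ge> max 1 (1 / \<kappa>)) at_top" by (rule eventually_ge_at_top)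
  ultimately have "eventually (\<lambda>X. c1 * c2 * exp (\<kappa> * X - 2) > B \<and> X \<ge> max 1 (1 / \<kappa>)) at_top" by (rule eventually_conj)
  then obtain X where X: "c1 * c2 * exp (\<kappa> * X - 2) > B" "X \<ge> 1" "X \<ge> 1 / \<kappa>"
    using eventually_happens[of _ "at_top :: real filter"] by auto
  have "\<kappa> * X \<ge> 1" using X(3) kap by (simp add: field_simps)
  then have "(\<kappa> * X - 1) * 1 \<le> (\<kappa> * X - 1) * X ^ l" using X by (intro mult_left_mono) auto
  then have "c1 * c2 * exp (\<kappa> * X - 2) \<le> c1 * c2 * exp ((\<kappa> * X - 1) * X ^ l - 1)" using c1 c2 by (intro mult_left_mono) auto
  then show ?thesis using main[OF X(2)] X(1) by (meson less_le_trans order_trans)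
qed

section \<open>Growth of the connection coefficient\<close>

text \<open>The weight \<open>\<kappa>\<^sup>2\<close> on \<open>norm (y x)\<close> balances the two
  mixed terms: their sum is at most \<open>10 * \<kappa>\<^sup>2 * norm (y x) * norm (dy x)\<close>,
  hence at most \<open>5 * \<kappa> * G x\<close>. The exponent is thus proportional to
  \<open>\<kappa>\<close>, not to its square, which fixes the order of growth.\<close>

lemma sol_growth:
  fixes \<kappa> R :: real
  assumes kap: "\<kappa> \<ge> 1" and R: "R \<ge> 0" and a: "\<And>x. 0 \<le> x \<Longrightarrow> x \<le> R \<Longrightarrow> norm (freq l k p q (of_real x)) \<le> 2 * \<kappa>"
    and c: "norm c0 \<le> 1" "norm c1 \<le> 1"
  shows "norm (sol l k p q c0 c1 (of_real R)) \<le> 2 * \<kappa> * exp (5 / 2 * \<kappa> * R)"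
    "norm (dsol l k p q c0 c1 (of_real R)) \<le> 2 * \<kappa> * exp (5 / 2 * \<kappa> * R)"
proof -
  define y where "y x = sol l k p q c0 c1 (of_real x)" for x :: real
  define dy where "dy x = dsol l k p q c0 c1 (of_real x)" for x :: real
  define G where "G x = (norm (dy x))\<^sup>2 + \<kappa>\<^sup>2 * (norm (y x))\<^sup>2" for x
  have "G R * exp (- (5 * \<kappa>) * R) \<le> G 0 * exp (- (5 * \<kappa>) * 0)"
  proof (rule DERIV_nonpos_imp_nonincreasing[OF R])
    fix x assume x: "0 \<le> x" "x \<le> R"
    have d1: "((\<lambda>x. (norm (y x))\<^sup>2) has_real_derivative 2 * (y x \<bullet> dy x)) (at x)"
      unfolding y_def[abs_def] dy_def
      by (rule has_real_derivative_norm_power2[OF has_vector_derivative_real_field[OF sol_has_field_derivative]])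
    have d2: "((\<lambda>x. (norm (dy x))\<^sup>2) has_real_derivative 2 * (dy x \<bullet> ((freq l k p q (of_real x))\<^sup>2 * y x))) (at x)"
      unfolding y_def dy_def[abs_def] freq_def
      by (rule has_real_derivative_norm_power2[OF has_vector_derivative_real_field[OF dsol_has_field_derivative]])
    have dG: "(G has_real_derivative 2 * (dy x \<bullet> ((freq l k p q (of_real x))\<^sup>2 * y x)) + \<kappa>\<^sup>2 * (2 * (y x \<bullet> dy x))) (at x)"
      unfolding G_def[abs_def] by (intro DERIV_add d2 DERIV_cmult d1)
    have "dy x \<bullet> ((freq l k p q (of_real x))\<^sup>2 * y x) \<le> norm (dy x) * ((2 * \<kappa>)\<^sup>2 * norm (y x))"
    proof -
      have "dy x \<bullet> ((freq l k p q (of_real x))\<^sup>2 * y x) \<le> norm (dy x) * ((norm (freq l k p q (of_real x)))\<^sup>2 * norm (y x))"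
        using norm_cauchy_schwarz[of "dy x" "(freq l k p q (of_real x))\<^sup>2 * y x"] by (simp add: norm_mult norm_power)
      also have "\<dots> \<le> norm (dy x) * ((2 * \<kappa>)\<^sup>2 * norm (y x))"
        using a[OF x] by (intro mult_left_mono mult_right_mono power_mono) auto
      finally show ?thesis .
    qed
    moreover have "\<kappa>\<^sup>2 * (y x \<bullet> dy x) \<le> \<kappa>\<^sup>2 * (norm (y x) * norm (dy x))"
      by (intro mult_left_mono norm_cauchy_schwarz) auto
    ultimately have "2 * (dy x \<bullet> ((freq l k p q (of_real x))\<^sup>2 * y x)) + \<kappa>\<^sup>2 * (2 * (y x \<bullet> dy x)) \<le> 5 * \<kappa> * (2 * (norm (dy x) * (\<kappa> * norm (y x))))"
      by (simp add: power2_eq_square algebra_simps)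
    also have "\<dots> \<le> 5 * \<kappa> * G x" unfolding G_def
    proof (intro mult_left_mono)
      show "2 * (norm (dy x) * (\<kappa> * norm (y x))) \<le> (norm (dy x))\<^sup>2 + \<kappa>\<^sup>2 * (norm (y x))\<^sup>2"
        using sum_squares_bound[of "norm (dy x)" "\<kappa> * norm (y x)"] by (simp add: power_mult_distrib mult.assoc)
    qed (use kap in auto)
    finally have le: "2 * (dy x \<bullet> ((freq l k p q (of_real x))\<^sup>2 * y x)) + \<kappa>\<^sup>2 * (2 * (y x \<bullet> dy x)) \<le> 5 * \<kappa> * G x" .
    have "((\<lambda>x. - (5 * \<kappa>) * x) has_real_derivative - (5 * \<kappa>)) (at x)" by (auto intro!: derivative_eq_intros)
    note D = DERIV_mult_exp[OF dG this]
    show "\<exists>d. ((\<lambda>x. G x * exp (- (5 * \<kappa>) * x)) has_real_derivative d) (at x) \<and> d \<le> 0"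
      using D mult_right_mono[OF le, of "exp (- (5 * \<kappa>) * x)"] by (intro exI conjI) (assumption, simp add: algebra_simps)
  qed
  then have GR: "G R \<le> G 0 * exp (5 * \<kappa> * R)" by (simp add: exp_minus field_simps)
  have "G 0 \<le> 1 + \<kappa>\<^sup>2 * 1" unfolding G_def y_def dy_def using c
    by (intro add_mono mult_left_mono) (auto simp: power_le_one)
  also have "\<dots> \<le> (2 * \<kappa>)\<^sup>2" using kap mult_mono[of 1 \<kappa> 1 \<kappa>] by (simp add: power2_eq_square)
  finally have "G R \<le> (2 * \<kappa>)\<^sup>2 * exp (5 * \<kappa> * R)" using GR by (meson exp_ge_zero mult_right_mono order_trans)
  also have "exp (5 * \<kappa> * R) = (exp (5 / 2 * \<kappa> * R))\<^sup>2" by (simp flip: exp_double)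
  finally have G: "G R \<le> (2 * \<kappa> * exp (5 / 2 * \<kappa> * R))\<^sup>2" by (simp only: power_mult_distrib)
  have nn: "0 \<le> 2 * \<kappa> * exp (5 / 2 * \<kappa> * R)" using kap by simp
  have "(norm (dy R))\<^sup>2 \<le> G R" unfolding G_def by simp
  then show "norm (dsol l k p q c0 c1 (of_real R)) \<le> 2 * \<kappa> * exp (5 / 2 * \<kappa> * R)"
    using G nn unfolding dy_def by (meson order_trans power2_le_imp_le)
  have "1 * (norm (y R))\<^sup>2 \<le> \<kappa>\<^sup>2 * (norm (y R))\<^sup>2" using kap by (intro mult_right_mono) (auto simp: one_le_power)
  then have "(norm (y R))\<^sup>2 \<le> G R" unfolding G_def using zero_le_power2[of "norm (dy R)"] by linarith
  then show "norm (sol l k p q c0 c1 (of_real R)) \<le> 2 * \<kappa> * exp (5 / 2 * \<kappa> * R)"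
    using G nn unfolding y_def by (meson order_trans power2_le_imp_le)
qed

text \<open>On \<open>[0, R]\<close> the frequency is at most \<open>2 * R ^ l\<close>, so the
  solution grows at most like the exponential of a multiple of \<open>R ^ (l + 1)\<close>. Beyond
  \<open>R\<close> the ratio \<open>1 / 4\<close> gives the sector constant \<open>3 / 5\<close>
  independently of \<open>q\<close>, and the Liouville--Green system adds only a constant
  factor.\<close>

lemma amplitude_growth:
  assumes kl: "k < l"
  obtains K where "K \<ge> 0" "\<And>q R c0 c1. 1 \<le> R \<Longrightarrow> norm q \<le> 1 / 4 * R ^ (l - k) \<Longrightarrow> norm c0 \<le> 1 \<Longrightarrow> norm c1 \<le> 1 \<Longrightarrow>
     norm (amplitude l k 1 q c0 c1) \<le> exp (K * R ^ (l + 1))"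
proof -
  define C where "C = coupling_const l (3 / 5) 1"
  have C: "C \<ge> 0" unfolding C_def by (rule coupling_const_nonneg) auto
  define M where "M = 2 * (3 + real l)"
  \<comment> \<open>The 7 rounds up \<open>2 + 1 + 1 + 5 / 2\<close>: the primitive in the
    exponential, two polynomial factors bounded by \<open>exp T\<close>, and
    \<open>sol_growth\<close>. The constants move into the exponent because
    \<open>T \<ge> 1\<close>.\<close>
  define K where "K = 7 + (2 * M + 2 * C)"
  have M: "M \<ge> 1" unfolding M_def by simp
  have K: "K \<ge> 0" unfolding K_def using M C by simp
  have "norm (amplitude l k 1 q c0 c1) \<le> exp (K * R ^ (l + 1))"
    if R: "1 \<le> R" and q: "norm q \<le> 1 / 4 * R ^ (l - k)" and c: "norm c0 \<le> 1" "norm c1 \<le> 1" for q R c0 c1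
  proof -
    define T where "T = R ^ (l + 1)"
    define z where "z = (of_real R :: complex)"
    have T1: "T \<ge> 1" unfolding T_def using R by (intro one_le_power)
    have RT: "R ^ l \<le> T" "R ^ l \<ge> 1" unfolding T_def using R by (auto intro: power_increasing)
    have g: "sectorial l k 1 q R (3 / 5) 1"
    proof -
      have "(1 - 1 / 4) / (1 + 1 / 4) = (3 / 5 :: real)" by simp
      then show ?thesis using sectorial_ratio[OF less_imp_le[OF kl] R _ _ q] by simp
    qed
    have qk: "norm q * x ^ j \<le> R ^ (l - k + j)" if "0 \<le> x" "x \<le> R" for x j
    proof -
      have "norm q * x ^ j \<le> (1 / 4 * R ^ (l - k)) * R ^ j" using q that by (intro mult_mono power_mono) auto
      also have "\<dots> \<le> (1 * R ^ (l - k)) * R ^ j" using R by (intro mult_right_mono) auto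
      finally show ?thesis by (simp add: power_add)
    qed
    have a2: "norm (freq l k 1 q (of_real x)) \<le> 2 * R ^ l" if x: "0 \<le> x" "x \<le> R" for x
    proof -
      have "norm (freq l k 1 q (of_real x)) \<le> x ^ l + norm q * x ^ k"
        unfolding freq_def using norm_triangle_ineq[of "1 * of_real x ^ l" "q * of_real x ^ k"] x by (simp add: norm_mult norm_power)
      also have "\<dots> \<le> R ^ l + R ^ (l - k + k)" using x by (intro add_mono power_mono qk) auto
      finally show ?thesis using kl by simp
    qed
    have kR: "R ^ l * R = T" unfolding T_def by simp
    define S where "S = 2 * R ^ l * exp (5 / 2 * T)"
    have y: "norm (sol l k 1 q c0 c1 z) \<le> S" "norm (dsol l k 1 q c0 c1 z) \<le> S"
      using sol_growth[of "R ^ l" R l k 1 q c0 c1, OF RT(2) order_trans[OF zero_le_one R] a2 c]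
      unfolding S_def z_def by (simp_all add: mult.assoc kR)
    have S0: "S \<ge> 0" unfolding S_def using RT by simp
    have aR: "norm (freq l k 1 q z) \<le> 2 * T" using a2[of R] R RT unfolding z_def by simp
    define n where "n = freq_norm l k 1 q R"
    have n: "1 \<le> n" "3 / 5 * n \<le> norm (freq l k 1 q z)"
      using g R complex_Re_le_cmod[of "freq l k 1 q z"] unfolding sectorial_def n_def z_def by (auto intro: order_trans)
    have af35: "norm (freq l k 1 q z) \<ge> 3 / 5" using n by linarith
    have r: "norm (freq' l k 1 q z / (2 * freq l k 1 q z)) \<le> real l"
    proof -
      have "norm (freq' l k 1 q z) \<le> real l * n / R" unfolding n_def z_def using norm_freq'[of k l R 1 q] kl R by simp
      also have "\<dots> \<le> real l * n / 1" using R n by (intro divide_left_mono) auto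
      finally have d: "norm (freq' l k 1 q z) \<le> real l * n" by simp
      have "norm (freq' l k 1 q z / (2 * freq l k 1 q z)) = norm (freq' l k 1 q z) / (2 * norm (freq l k 1 q z))"
        by (simp add: norm_divide norm_mult)
      also have "\<dots> \<le> real l * n / n" using d n by (intro frac_le) auto
      finally show ?thesis using n by simp
    qed
    have s: "norm (prefactor l k 1 q z) \<le> 2"
    proof -
      have "(norm (csqrt (freq l k 1 q z)))\<^sup>2 = norm (freq l k 1 q z)" by (simp flip: norm_power)
      then have "(1 / 2)\<^sup>2 \<le> (norm (csqrt (freq l k 1 q z)))\<^sup>2" using af35 by (simp add: power2_eq_square)
      then have "1 / 2 \<le> norm (csqrt (freq l k 1 q z))" by (rule power2_le_imp_le) simp
      from le_imp_inverse_le[OF this] show ?thesis unfolding prefactor_def norm_inverse by simp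
    qed
    have E: "norm (exp (- freq_int l k 1 q z)) \<le> exp (2 * T)"
    proof -
      have "norm (z ^ (l + 1)) = T" unfolding z_def T_def norm_power using R by simp
      then have "norm (1 * z ^ (l + 1) / of_nat (l + 1)) \<le> T / 1"
        unfolding norm_divide norm_of_nat mult_1_left using T1 by (intro frac_le) auto
      moreover have "norm (q * z ^ (k + 1) / of_nat (k + 1)) \<le> T / 1"
      proof -
        have "norm q * R ^ (k + 1) \<le> R ^ (l - k + (k + 1))" using R by (intro qk) auto
        then have "norm (q * z ^ (k + 1)) \<le> T" unfolding T_def z_def using R kl by (simp add: norm_mult norm_power)
        then show ?thesis unfolding norm_divide norm_of_nat using T1 by (intro frac_le) auto
      qed
      ultimately have "norm (freq_int l k 1 q z) \<le> 2 * T" unfolding freq_int_def by (intro order_trans[OF norm_triangle_ineq]) simp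
      then have "Re (- freq_int l k 1 q z) \<le> 2 * T" using complex_Re_le_cmod[of "- freq_int l k 1 q z"] by simp
      then show ?thesis unfolding norm_exp_eq_Re by simp
    qed
    define B where "B = exp (2 * T) * (S + (2 * T + real l) * S)"
    have Z: "norm (Z1 l k 1 q c0 c1 z) \<le> B" "norm (Z2 l k 1 q c0 c1 z) \<le> B"
    proof -
      have gen: "norm (s * e * (v + w * u) / 2) \<le> B" if "norm s \<le> 2" "norm e \<le> exp (2 * T)" "norm v \<le> S" "norm w \<le> 2 * T + real l" "norm u \<le> S" for s e v w u :: complex
      proof -
        have "norm (v + w * u) \<le> S + (2 * T + real l) * S"
          using that S0 T1 by (intro order_trans[OF norm_triangle_ineq] add_mono) (auto simp: norm_mult intro!: mult_mono)
        then have "norm s * norm e * norm (v + w * u) \<le> 2 * exp (2 * T) * (S + (2 * T + real l) * S)"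
          using that by (intro mult_mono) auto
        then show ?thesis unfolding B_def by (simp add: norm_mult norm_divide)
      qed
      show "norm (Z1 l k 1 q c0 c1 z) \<le> B" unfolding Z1_def
        by (rule gen[OF s E y(2) _ y(1)]) (use norm_triangle_ineq[of "freq l k 1 q z" "freq' l k 1 q z / (2 * freq l k 1 q z)"] aR r in linarith)
      show "norm (Z2 l k 1 q c0 c1 z) \<le> B" unfolding Z2_def
        by (rule gen[OF s E _ _ y(1)]) (use y norm_triangle_ineq4[of "freq l k 1 q z" "freq' l k 1 q z / (2 * freq l k 1 q z)"] aR r in \<open>simp, linarith\<close>)
    qed
    have BM: "B \<le> M * exp (7 * T)"
    proof -
      have Te: "T \<le> exp T" using exp_ge_add_one_self[of T] by linarith
      have "1 + (2 * T + real l) \<le> (3 + real l) * T" using T1 mult_left_mono[OF T1, of "real l"] by (simp add: algebra_simps)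
      also have "\<dots> \<le> (3 + real l) * exp T" using Te by (intro mult_left_mono) auto
      finally have 1: "1 + (2 * T + real l) \<le> (3 + real l) * exp T" .
      have 2: "S \<le> 2 * exp T * exp (5 / 2 * T)" unfolding S_def using RT Te by (intro mult_right_mono mult_left_mono) auto
      have "B = exp (2 * T) * ((1 + (2 * T + real l)) * S)" unfolding B_def by (simp add: algebra_simps)
      also have "\<dots> \<le> exp (2 * T) * (((3 + real l) * exp T) * (2 * exp T * exp (5 / 2 * T)))"
        using 1 2 S0 by (intro mult_left_mono mult_mono) auto
      also have "\<dots> = M * (exp (2 * T) * exp T * exp T * exp (5 / 2 * T))" unfolding M_def by simp
      also have "exp (2 * T) * exp T * exp T * exp (5 / 2 * T) = exp (2 * T + T + T + 5 / 2 * T)" by (simp only: exp_add)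
      also have "M * \<dots> \<le> M * exp (7 * T)" using T1 M by (intro mult_left_mono) auto
      finally show ?thesis .
    qed
    have B0: "B \<ge> 0" using Z(1) norm_ge_zero order_trans by blast
    have Z_energy: "Z_energy l k 1 q c0 c1 R \<le> 2 * (M * exp (7 * T))\<^sup>2"
    proof -
      have "Z_energy l k 1 q c0 c1 R \<le> B\<^sup>2 + B\<^sup>2" unfolding Z_energy_def z_def[symmetric] using Z by (intro add_mono power_mono) auto
      also have "\<dots> \<le> 2 * (M * exp (7 * T))\<^sup>2" using power_mono[OF BM B0, of 2] by simp
      finally show ?thesis .
    qed
    have "norm (amplitude l k 1 q c0 c1) \<le> sqrt (Z_energy l k 1 q c0 c1 R * exp (4 * C / R))" unfolding C_def by (rule amplitude_limit(3)[OF g])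
    also have "\<dots> \<le> sqrt ((2 * (M * exp (7 * T)) * exp (2 * C))\<^sup>2)"
    proof (rule real_sqrt_le_mono)
      have "4 * C / R \<le> 2 * (2 * C)" using C R mult_left_mono[of 1 R C] by (simp add: divide_le_eq)
      then have "exp (4 * C / R) \<le> (exp (2 * C))\<^sup>2" unfolding exp_double[symmetric] by simp
      then have "Z_energy l k 1 q c0 c1 R * exp (4 * C / R) \<le> (2 * (M * exp (7 * T)))\<^sup>2 * (exp (2 * C))\<^sup>2"
        using Z_energy M by (intro mult_mono) (auto simp: power_mult_distrib Z_energy_def intro: order_trans)
      then show "Z_energy l k 1 q c0 c1 R * exp (4 * C / R) \<le> (2 * (M * exp (7 * T)) * exp (2 * C))\<^sup>2" by (simp only: power_mult_distrib)
    qed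
    also have "\<dots> = (2 * M) * exp (7 * T) * exp (2 * C)" using M by simp
    also have "\<dots> \<le> exp (2 * M) * exp (7 * T) * exp (2 * C)"
    proof (intro mult_right_mono)
      show "2 * M \<le> exp (2 * M)" using exp_ge_add_one_self[of "2 * M"] by linarith
    qed auto
    also have "\<dots> = exp (7 * T + (2 * M + 2 * C) * 1)" by (simp add: exp_add)
    also have "\<dots> \<le> exp (7 * T + (2 * M + 2 * C) * T)" using T1 M C by (subst exp_le_cancel_iff) (intro add_left_mono mult_left_mono, auto)
    also have "\<dots> = exp (K * R ^ (l + 1))" unfolding K_def T_def by (simp add: algebra_simps)
    finally show ?thesis .
  qed
  then show ?thesis using that K by blast
qed

text \<open>For \<open>R\<close> of the size of \<open>norm \<zeta>\<close> to the power
  \<open>1 / (l - k)\<close> this says that the order is at most \<open>(l + 1) / (l - k)\<close>.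
  The radius is left free: one application takes a crude value, the other the sharp one.\<close>

lemma connection_growth:
  assumes kl: "k < l"
  obtains K where "K \<ge> 0" "\<And>\<zeta> R. 1 \<le> R \<Longrightarrow> 4 * norm \<zeta> \<le> R ^ (l - k) \<Longrightarrow> norm (connection l k \<zeta>) \<le> exp (K * R ^ (l + 1))"
proof -
  obtain K where K: "K \<ge> 0" "\<And>q R c0 c1. 1 \<le> R \<Longrightarrow> norm q \<le> 1 / 4 * R ^ (l - k) \<Longrightarrow> norm c0 \<le> 1 \<Longrightarrow> norm c1 \<le> 1 \<Longrightarrow>
     norm (amplitude l k 1 q c0 c1) \<le> exp (K * R ^ (l + 1))" using amplitude_growth[OF kl] by blast
  show ?thesis
  proof
    \<comment> \<open>The 2 comes from products of two amplitudes, the 3 from absorbing the factor 8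
      into \<open>exp 3\<close>.\<close>
    show "2 * K + 3 \<ge> 0" using K by simp
    fix \<zeta> :: complex and R :: real assume R: "1 \<le> R" "4 * norm \<zeta> \<le> R ^ (l - k)"
    define X where "X = exp (K * R ^ (l + 1))"
    have q: "norm (- \<zeta>) \<le> 1 / 4 * R ^ (l - k)" "norm (- (parity_sign l k * \<zeta>)) \<le> 1 / 4 * R ^ (l - k)"
      using R parity_sign_cases[of l k] by auto
    have ab: "norm (alpha l k 1 (- \<zeta>)) \<le> 2 * X" "norm (beta l k 1 (- \<zeta>)) \<le> 2 * X"
      "norm (alpha l k 1 (- (parity_sign l k * \<zeta>))) \<le> 2 * X" "norm (beta l k 1 (- (parity_sign l k * \<zeta>))) \<le> 2 * X"
      using K(2)[OF R(1) q(1), of 0 1] K(2)[OF R(1) q(1), of 1 0] K(2)[OF R(1) q(2), of 0 1] K(2)[OF R(1) q(2), of 1 0]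
      unfolding alpha_def beta_def X_def by (simp_all add: norm_mult)
    have "norm (connection l k \<zeta>) \<le> (2 * X) * (2 * X) + (2 * X) * (2 * X)"
    proof -
      have p: "norm (x * y) \<le> (2 * X) * (2 * X)" if "norm x \<le> 2 * X" "norm y \<le> 2 * X" for x y :: complex
        unfolding norm_mult using that by (intro mult_mono) (auto simp: X_def)
      show ?thesis unfolding connection_def by (rule order_trans[OF norm_triangle_ineq add_mono[OF p p]]) (rule ab)+
    qed
    also have "\<dots> = 8 * (X * X)" by simp
    also have "\<dots> \<le> exp 3 * (X * X)"
    proof (intro mult_right_mono)
      have "(2::real) ^ 3 \<le> exp 1 ^ 3" using exp_ge_add_one_self[of 1] by (intro power_mono) auto
      then show "(8::real) \<le> exp 3" by (simp flip: exp_of_nat_mult)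
    qed (auto simp: X_def)
    also have "\<dots> = exp (2 * K * R ^ (l + 1) + 3 * 1)" unfolding X_def by (simp flip: exp_add add: algebra_simps)
    also have "\<dots> \<le> exp (2 * K * R ^ (l + 1) + 3 * R ^ (l + 1))" 
      using R(1) by (subst exp_le_cancel_iff) (intro add_left_mono mult_left_mono one_le_power, auto)
    finally show "norm (connection l k \<zeta>) \<le> exp ((2 * K + 3) * R ^ (l + 1))" by (simp add: algebra_simps)
  qed
qed


section \<open>Entire functions of finite order without zeros\<close>

text \<open>If \<open>Re u < B\<close> with \<open>B > 0\<close>, then
  \<open>u / (2 * B - u)\<close> maps the unit disc into itself, because \<open>u\<close> is closer
  to 0 than to \<open>2 * B\<close>. The Schwarz lemma bounds it by \<open>1 / 2\<close> on the half
  disc, and solving for \<open>u\<close> gives the estimate.\<close>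

lemma borel_caratheodory:
  fixes f :: "complex \<Rightarrow> complex"
  assumes h: "f holomorphic_on UNIV" and r: "r > 0" and M: "\<And>z. norm z < 2 * r \<Longrightarrow> Re (f z) < M" and z: "norm z \<le> r"
  shows "norm (f z - f 0) \<le> 2 * (M - Re (f 0))"
proof -
  define B where "B = M - Re (f 0)"
  have B: "B > 0" unfolding B_def using M[of 0] r by simp
  define u where "u w = f (of_real (2 * r) * w) - f 0" for w
  have uh: "u holomorphic_on ball 0 1" unfolding u_def[abs_def]
    using holomorphic_on_compose_gen[OF _ h, of "\<lambda>w. of_real (2 * r) * w" "ball 0 1"]
    by (auto simp: o_def intro!: holomorphic_intros)
  have Reu: "Re (u w) < B" if "norm w < 1" for w
    unfolding u_def B_def using M[of "of_real (2 * r) * w"] that r by (simp add: norm_mult)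
  have den: "2 * of_real B - u w \<noteq> 0" if "norm w < 1" for w
  proof
    assume "2 * of_real B - u w = 0"
    then have "Re (u w) = 2 * B" by (simp add: complex_eq_iff)
    then show False using Reu[OF that] B by simp
  qed
  have sq: "(norm (u w))\<^sup>2 < (norm (2 * of_real B - u w))\<^sup>2" if "norm w < 1" for w
  proof -
    have "(norm (2 * of_real B - u w))\<^sup>2 - (norm (u w))\<^sup>2 = 4 * B * (B - Re (u w))"
      unfolding cmod_power2 by (simp add: power2_eq_square algebra_simps)
    then show ?thesis using B Reu[OF that] by (smt (verit) mult_pos_pos)
  qed
  have lt: "norm (u w) < norm (2 * of_real B - u w)" if "norm w < 1" for w
    using sq[OF that] power2_less_imp_less norm_ge_zero by blast
  define g where "g w = u w / (2 * of_real B - u w)" for w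
  have "g holomorphic_on ball 0 1" unfolding g_def[abs_def]
    by (intro holomorphic_on_divide holomorphic_on_diff uh holomorphic_on_const) (use den in auto)
  moreover have "g 0 = 0" unfolding g_def u_def by simp
  moreover have "norm (g w) < 1" if "norm w < 1" for w
    unfolding g_def norm_divide using lt[OF that] den[OF that] by (simp add: divide_less_eq)
  ultimately have S: "norm (g w) \<le> norm w" if "norm w < 1" for w using Schwarz_Lemma(1)[of g w] that by blast
  define w where "w = z / of_real (2 * r)"
  have w: "norm w \<le> 1 / 2" unfolding w_def using z r by (simp add: norm_divide field_simps)
  have uw: "u w = f z - f 0" unfolding u_def w_def using r by simp
  have "norm (g w) \<le> 1 / 2" using S[of w] w by simp
  then have "norm (u w) \<le> 1 / 2 * norm (2 * of_real B - u w)"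
    unfolding g_def norm_divide using den[of w] w by (simp add: divide_le_eq)
  also have "\<dots> \<le> 1 / 2 * (2 * B + norm (u w))"
    using norm_triangle_ineq4[of "2 * of_real B" "u w"] B by (simp add: norm_mult)
  finally show ?thesis unfolding uw B_def by simp
qed

text \<open>Induction on the degree: the differences \<open>Q (t + h) - Q t\<close> have lower degree and their exponentials
  tend to \<open>1\<close>.\<close>

lemma exp_poly_limit_const:
  fixes Q :: "complex poly"
  assumes "((\<lambda>t::real. exp (poly Q (of_real t))) \<longlongrightarrow> c) at_top" "c \<noteq> 0"
  shows "exp (poly Q (of_real t)) = exp (poly Q 0)"
  using assms
proof (induction "degree Q" arbitrary: Q c t rule: less_induct)
  case (less Q)
  show ?case
  proof (cases "degree Q = 0")
    case True
    then obtain a where "Q = [:a:]" using degree_eq_zeroE by blast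
    then show ?thesis by simp
  next
    case False
    define D where "D = pcompose Q [:of_real t, 1:] - Q"
    have D: "poly D x = poly Q (of_real t + x) - poly Q x" for x unfolding D_def by (simp add: poly_pcompose)
    have "degree D < degree Q"
    proof -
      have dq: "degree (pcompose Q [:of_real t, 1:]) = degree Q" by (simp add: degree_pcompose)
      have "lead_coeff (pcompose Q [:of_real t, 1:]) = lead_coeff Q" by (subst lead_coeff_comp) auto
      then have "coeff D (degree Q) = 0" unfolding D_def using dq by simp
      moreover have "degree D \<le> degree Q" unfolding D_def by (rule degree_diff_le) (simp_all add: dq)
      ultimately show ?thesis using False by (metis coeff_0 degree_0 le_neq_implies_less leading_coeff_0_iff)
    qed
    moreover have lim: "((\<lambda>x::real. exp (poly D (of_real x))) \<longlongrightarrow> c / c) at_top"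
    proof -
      have "filterlim (\<lambda>x::real. t + x) at_top at_top" by real_asymp
      then have "((\<lambda>x::real. exp (poly Q (of_real (t + x)))) \<longlongrightarrow> c) at_top" by (rule filterlim_compose[OF less(2)])
      from tendsto_divide[OF this less(2,3)] show ?thesis unfolding D exp_diff by simp
    qed
    ultimately have "exp (poly D (of_real x)) = exp (poly D 0)" for x :: real
      using less(1)[of D "c / c" x] less(3) by simp
    then have "((\<lambda>x::real. exp (poly D 0)) \<longlongrightarrow> c / c) at_top" using lim by simp
    then have "exp (poly D 0) = 1" using less(3) by (simp add: tendsto_const_iff)
    then show ?thesis unfolding D by (simp add: exp_diff)
  qed
qed

text \<open>The phases of the two summands combine to
  \<open>2 * cos (\<theta> - \<tau> * \<theta>)\<close> with \<tau> the parity sign. For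
  \<open>\<tau> = 1\<close> the cosine is 1, for \<open>\<tau> = - 1\<close> it is
  \<open>cos (pi / (2 * (k + 1)))\<close>, which is positive as soon as \<open>k \<ge> 1\<close> and
  zero for \<open>k = 0\<close>.\<close>

lemma connection_imaginary_limit:
  assumes kl: "k < l" and c: "k \<ge> 1 \<or> parity_sign l k = 1"
  obtains c where "c \<noteq> 0" "((\<lambda>r::real. connection l k (\<i> * exp (of_nat (k + 1) * of_real r))) \<longlongrightarrow> c) at_top"
proof -
  define \<theta> where "\<theta> = pi / (4 * (real k + 1))"
  obtain \<tau> :: real where tau: "\<tau> = 1 \<or> \<tau> = - 1" "parity_sign l k = of_real \<tau>" using parity_sign_cases[of l k] by (metis of_real_1 of_real_minus)
  define z where "z r = \<i> * exp (of_nat (k + 1) * of_real r)" for r :: real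
  have connection: "connection l k (z r) = (exp (of_real r / 2) * alpha l k 1 (- z r)) * (exp (- of_real r / 2) * beta l k 1 (- (of_real \<tau> * z r)))
       + (exp (- of_real r / 2) * beta l k 1 (- z r)) * (exp (of_real r / 2) * alpha l k 1 (- (of_real \<tau> * z r)))" for r :: real
  proof -
    have "exp (of_real r / 2) * exp (- of_real r / 2) = (1 :: complex)" by (simp flip: exp_add)
    then have e: "(exp (of_real r / 2) * a) * (exp (- of_real r / 2) * b) = a * b" "(exp (- of_real r / 2) * b) * (exp (of_real r / 2) * a) = b * a" for a b :: complex
      by (metis (no_types, opaque_lifting) mult.assoc mult.commute mult_1)+
    show ?thesis unfolding connection_def tau(2) e ..
  qed
  let ?A = "alpha l k 0 1" and ?B = "beta l k 0 1"
  have L: "((\<lambda>r. exp (of_real r / 2) * alpha l k 1 (- z r)) \<longlongrightarrow> exp (\<i> * of_real \<theta>) * ?A) at_top"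
    "((\<lambda>r. exp (- of_real r / 2) * beta l k 1 (- z r)) \<longlongrightarrow> exp (- \<i> * of_real \<theta>) * ?B) at_top"
    "((\<lambda>r. exp (of_real r / 2) * alpha l k 1 (- (of_real \<tau> * z r))) \<longlongrightarrow> exp (\<i> * of_real (\<tau> * \<theta>)) * ?A) at_top"
    "((\<lambda>r. exp (- of_real r / 2) * beta l k 1 (- (of_real \<tau> * z r))) \<longlongrightarrow> exp (- \<i> * of_real (\<tau> * \<theta>)) * ?B) at_top"
    using alpha_beta_imaginary_limit[OF kl, of 1, folded \<theta>_def] alpha_beta_imaginary_limit[OF kl tau(1), folded \<theta>_def]
    unfolding z_def by (simp_all add: mult.assoc)
  let ?c = "(exp (\<i> * of_real \<theta>) * ?A) * (exp (- \<i> * of_real (\<tau> * \<theta>)) * ?B) + (exp (- \<i> * of_real \<theta>) * ?B) * (exp (\<i> * of_real (\<tau> * \<theta>)) * ?A)"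
  have lim: "((\<lambda>r. connection l k (z r)) \<longlongrightarrow> ?c) at_top"
    unfolding connection by (rule tendsto_add[OF tendsto_mult[OF L(1) L(4)] tendsto_mult[OF L(2) L(3)]])
  have "?c \<noteq> 0"
  proof -
    have ceq: "?c = ?A * ?B * of_real (2 * cos (\<theta> - \<tau> * \<theta>))"
    proof -
      have "?c = ?A * ?B * (exp (\<i> * of_real \<theta>) * exp (- \<i> * of_real (\<tau> * \<theta>)) + exp (- \<i> * of_real \<theta>) * exp (\<i> * of_real (\<tau> * \<theta>)))"
        by (simp only: distrib_left mult_ac)
      also have "exp (\<i> * of_real \<theta>) * exp (- \<i> * of_real (\<tau> * \<theta>)) = exp (\<i> * of_real (\<theta> - \<tau> * \<theta>))"
        unfolding exp_add[symmetric] by (rule arg_cong[of _ _ exp]) (simp add: algebra_simps)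
      also have "exp (- \<i> * of_real \<theta>) * exp (\<i> * of_real (\<tau> * \<theta>)) = exp (- (\<i> * of_real (\<theta> - \<tau> * \<theta>)))"
        unfolding exp_add[symmetric] by (rule arg_cong[of _ _ exp]) (simp add: algebra_simps)
      also have "exp (\<i> * of_real x) + exp (- (\<i> * of_real x)) = of_real (2 * cos x)" for x :: real
        by (simp add: complex_eq_iff Re_exp Im_exp)
      finally show ?thesis .
    qed
    have "cos (\<theta> - \<tau> * \<theta>) > 0"
    proof (cases "\<tau> = 1")
      case False
      then have "\<tau> = - 1" "k \<ge> 1" using tau c by auto
      have h: "2 * (p / (4 * x)) = p / (2 * x)" for p x :: real by (cases "x = 0") (simp_all add: field_simps)
      have "\<theta> - \<tau> * \<theta> = 2 * \<theta>" using \<open>\<tau> = - 1\<close> by simp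
      also have "\<dots> = pi / (2 * (real k + 1))" unfolding \<theta>_def by (rule h)
      finally have e: "\<theta> - \<tau> * \<theta> = pi / (2 * (real k + 1))" .
      have "pi / (2 * (real k + 1)) < pi / 2" using \<open>k \<ge> 1\<close> pi_gt_zero by (intro divide_strict_left_mono) auto
      moreover have "0 < pi / (2 * (real k + 1))" using pi_gt_zero by simp
      ultimately show ?thesis unfolding e by (intro cos_gt_zero) auto
    qed simp
    then show ?thesis unfolding ceq using alpha_beta_zero_nonzero[OF less_imp_le[OF kl]] by simp
  qed
  then show ?thesis using that lim unfolding z_def by blast
qed

lemma connection_const_False:
  assumes kl: "k < l" and c: "\<And>z. connection l k z = connection l k 0"
  shows False
  using connection_unbounded[OF kl, of "norm (connection l k 0)"] c by (metis less_irrefl)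

lemma ln_le_of_le_exp: "0 < x \<Longrightarrow> x \<le> exp y \<Longrightarrow> ln x \<le> (y :: real)"
  by (metis exp_le_cancel_iff exp_ln)

lemma connection_logarithm:
  assumes kl: "k < l" and nz: "\<And>z. connection l k z \<noteq> 0"
  obtains P where "P holomorphic_on UNIV" "\<And>z. exp (P z) = connection l k z" "\<And>z. Re (P z) = ln (norm (connection l k z))"
proof -
  obtain P where P: "P holomorphic_on UNIV" "\<And>z. exp (P z) = connection l k z"
    using holomorphic_logarithm_exists[of UNIV "connection l k" 0] connection_holomorphic[OF kl] nz by auto
  moreover have "Re (P z) = ln (norm (connection l k z))" for z
    using arg_cong[OF P(2)[of z], of norm] by (metis exp_ln ln_exp norm_exp_eq_Re)
  ultimately show ?thesis using that by blast
qed

text \<open>The crude choice \<open>R = 1 + 4 * norm z\<close> suffices: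
  \<open>exp_poly_limit_const\<close> handles a logarithm of any degree, so it only has to be a
  polynomial. Constancy on the imaginary axis then spreads by the identity theorem.\<close>

lemma connection_zero_generic:
  assumes kl: "k < l" and c: "k \<ge> 1 \<or> parity_sign l k = 1"
  shows "\<exists>z. connection l k z = 0"
proof (rule ccontr)
  assume "\<not> ?thesis"
  then have nz: "\<And>z. connection l k z \<noteq> 0" by blast
  obtain P where P: "P holomorphic_on UNIV" "\<And>z. exp (P z) = connection l k z" "\<And>z. Re (P z) = ln (norm (connection l k z))"
    using connection_logarithm[OF kl nz] by blast
  obtain K where K: "K \<ge> 0" "\<And>\<zeta> R. 1 \<le> R \<Longrightarrow> 4 * norm \<zeta> \<le> R ^ (l - k) \<Longrightarrow> norm (connection l k \<zeta>) \<le> exp (K * R ^ (l + 1))"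
    using connection_growth[OF kl] by blast
  have ReP: "Re (P z) \<le> K * (1 + 4 * norm z) ^ (l + 1)" for z
  proof -
    have "(1 + 4 * norm z) ^ 1 \<le> (1 + 4 * norm z) ^ (l - k)" using kl by (intro power_increasing) auto
    then have "norm (connection l k z) \<le> exp (K * (1 + 4 * norm z) ^ (l + 1))" by (intro K(2)) auto
    then show ?thesis unfolding P(3) using nz[of z] by (intro ln_le_of_le_exp) auto
  qed
  define B where "B = 2 * (K * 9 ^ (l + 1) + 1 + \<bar>Re (P 0)\<bar>) + norm (P 0)"
  have "norm (P z) \<le> B * norm z ^ (l + 1)" if z: "1 \<le> norm z" for z
  proof -
    have "norm (P z - P 0) \<le> 2 * ((K * (1 + 8 * norm z) ^ (l + 1) + 1) - Re (P 0))"
    proof (rule borel_caratheodory[OF P(1)])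
      show "norm z > 0" using z by linarith
      fix v :: complex assume "norm v < 2 * norm z"
      then have "K * (1 + 4 * norm v) ^ (l + 1) \<le> K * (1 + 8 * norm z) ^ (l + 1)"
        using K(1) by (intro mult_left_mono power_mono) auto
      then show "Re (P v) < K * (1 + 8 * norm z) ^ (l + 1) + 1" using ReP[of v] by linarith
    qed simp
    moreover have "K * (1 + 8 * norm z) ^ (l + 1) \<le> K * (9 * norm z) ^ (l + 1)"
      using K(1) z by (intro mult_left_mono power_mono) auto
    ultimately have "norm (P z) \<le> 2 * (K * 9 ^ (l + 1) * norm z ^ (l + 1) + (1 + \<bar>Re (P 0)\<bar>) * 1) + norm (P 0) * 1"
      using norm_triangle_ineq2[of "P z" "P 0"] unfolding power_mult_distrib by simp
    also have "\<dots> \<le> 2 * (K * 9 ^ (l + 1) * norm z ^ (l + 1) + (1 + \<bar>Re (P 0)\<bar>) * norm z ^ (l + 1)) + norm (P 0) * norm z ^ (l + 1)"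
      using z by (intro add_mono mult_left_mono order_refl one_le_power) auto
    also have "\<dots> = B * norm z ^ (l + 1)" unfolding B_def by (simp add: algebra_simps)
    finally show ?thesis .
  qed
  note Pp = Liouville_polynomial[OF P(1) this]
  \<comment> \<open>The logarithm along the imaginary axis, as a polynomial in the real variable;
    the powers of \<open>\<i>\<close> are moved into the coefficients.\<close>
  define Q where "Q = (\<Sum>j\<le>l + 1. monom ((deriv ^^ j) P 0 / fact j * \<i> ^ j) j)"
  have Q: "poly Q t = P (\<i> * t)" for t :: complex
  proof -
    have "P (\<i> * t) = (\<Sum>j\<le>l + 1. (deriv ^^ j) P 0 / fact j * (\<i> * t) ^ j)" by (rule Pp)
    then show ?thesis unfolding Q_def poly_sum poly_monom by (simp only: power_mult_distrib mult.assoc)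
  qed
  obtain c where c: "c \<noteq> 0" "((\<lambda>r::real. connection l k (\<i> * exp (of_nat (k + 1) * of_real r))) \<longlongrightarrow> c) at_top"
    using connection_imaginary_limit[OF kl c] by blast
  have "((\<lambda>t::real. exp (poly Q (of_real t))) \<longlongrightarrow> c) at_top"
  proof (rule Lim_transform_eventually)
    \<comment> \<open>The substitution \<open>r = ln t / (k + 1)\<close> turns
      \<open>exp ((k + 1) * r)\<close> into \<open>t\<close>.\<close>
    have "filterlim (\<lambda>t. ln t / (real k + 1)) at_top at_top" by real_asymp
    from filterlim_compose[OF c(2) this]
    show "((\<lambda>t. connection l k (\<i> * exp (of_nat (k + 1) * of_real (ln t / (real k + 1))))) \<longlongrightarrow> c) at_top" .
    show "eventually (\<lambda>t. connection l k (\<i> * exp (of_nat (k + 1) * of_real (ln t / (real k + 1)))) = exp (poly Q (of_real t))) at_top"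
      using eventually_gt_at_top[of 0]
    proof eventually_elim
      case (elim t)
      have "(of_nat (k + 1) :: complex) = of_real (real k + 1)" by simp
      then have "(of_nat (k + 1) * of_real (ln t / (real k + 1)) :: complex) = of_real ((real k + 1) * (ln t / (real k + 1)))"
        by (simp only: of_real_mult)
      also have "(real k + 1) * (ln t / (real k + 1)) = ln t" by simp
      finally show ?case unfolding Q P(2) using elim by (simp add: exp_of_real)
    qed
  qed
  from exp_poly_limit_const[OF this c(1)] have it: "connection l k (\<i> * of_real t) = connection l k 0" for t :: real
    unfolding Q P(2) by simp
  have "connection l k z = connection l k 0" for z
  proof -
    define w where "w = - \<i> * z"
    define F where "F w = connection l k (\<i> * w) - connection l k 0" for w
    have "F w = 0"
    proof (rule strip_identity[where f = F and c = "\<bar>Im w\<bar> + 1"])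
      show "F holomorphic_on {v. \<bar>Im v\<bar> < \<bar>Im w\<bar> + 1}" unfolding F_def[abs_def]
        using holomorphic_on_compose_gen[OF _ connection_holomorphic[OF kl], of "\<lambda>w. \<i> * w" "{v. \<bar>Im v\<bar> < \<bar>Im w\<bar> + 1}"]
        by (auto simp: o_def intro!: holomorphic_intros)
      show "F (of_real x) = 0" for x :: real unfolding F_def using it by simp
    qed auto
    then show ?thesis unfolding F_def w_def by (simp flip: mult.assoc)
  qed
  then show False using connection_const_False[OF kl] by blast
qed

text \<open>The limit along the imaginary axis is 0 here, so the exact order is used instead: it is
  \<open>(l + 1) / l \<le> 3 / 2\<close>, which makes the logarithm affine, and evenness removes the
  linear term.\<close>

lemma connection_zero_special:
  assumes l: "l \<ge> 2" and s: "parity_sign l 0 = - 1"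
  shows "\<exists>z. connection l 0 z = 0"
proof (rule ccontr)
  have kl: "0 < l" using l by simp
  assume "\<not> ?thesis"
  then have nz: "\<And>z. connection l 0 z \<noteq> 0" by blast
  obtain P where P: "P holomorphic_on UNIV" "\<And>z. exp (P z) = connection l 0 z" "\<And>z. Re (P z) = ln (norm (connection l 0 z))"
    using connection_logarithm[OF kl nz] by blast
  obtain K where K: "K \<ge> 0" "\<And>\<zeta> R. 1 \<le> R \<Longrightarrow> 4 * norm \<zeta> \<le> R ^ (l - 0) \<Longrightarrow> norm (connection l 0 \<zeta>) \<le> exp (K * R ^ (l + 1))"
    using connection_growth[OF kl] by blast
  have ReP: "Re (P z) \<le> K * ((1 + 4 * norm z) * sqrt (1 + 4 * norm z))" for z
  proof -
    \<comment> \<open>The smallest radius that \<open>connection_growth\<close> admits up to the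
      additive 1. Here \<open>l \<ge> 2\<close> enters, through
      \<open>R \<le> sqrt (1 + 4 * norm z)\<close>.\<close>
    define R where "R = root l (1 + 4 * norm z)"
    have R1: "R \<ge> 1" unfolding R_def using kl by simp
    have Rl: "R ^ l = 1 + 4 * norm z" unfolding R_def using kl by (simp add: add_nonneg_nonneg)
    have "R\<^sup>2 \<le> R ^ l" using R1 l by (intro power_increasing) auto
    then have "R \<le> sqrt (1 + 4 * norm z)" unfolding Rl by (rule real_le_rsqrt)
    then have "R ^ l * R \<le> (1 + 4 * norm z) * sqrt (1 + 4 * norm z)" unfolding Rl by (intro mult_left_mono) auto
    then have "R ^ (l + 1) \<le> (1 + 4 * norm z) * sqrt (1 + 4 * norm z)" by (simp add: mult.commute)
    then have "K * R ^ (l + 1) \<le> K * ((1 + 4 * norm z) * sqrt (1 + 4 * norm z))" using K(1) by (intro mult_left_mono)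
    moreover have "norm (connection l 0 z) \<le> exp (K * R ^ (l + 1))" by (intro K(2) R1) (simp add: Rl)
    ultimately have "norm (connection l 0 z) \<le> exp (K * ((1 + 4 * norm z) * sqrt (1 + 4 * norm z)))"
      by (meson exp_le_cancel_iff order_trans)
    then show ?thesis unfolding P(3) using nz[of z] by (intro ln_le_of_le_exp) auto
  qed
  define b where "b r = 2 * (K * ((1 + 8 * r) * sqrt (1 + 8 * r)) + 1 - Re (P 0)) + norm (P 0)" for r :: real
  have Pb: "norm (P z) \<le> b r" if r: "r > 0" and z: "norm z \<le> r" for z r
  proof -
    have "norm (P z - P 0) \<le> 2 * ((K * ((1 + 8 * r) * sqrt (1 + 8 * r)) + 1) - Re (P 0))"
    proof (rule borel_caratheodory[OF P(1) r _ z])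
      fix v :: complex assume "norm v < 2 * r"
      then have "K * ((1 + 4 * norm v) * sqrt (1 + 4 * norm v)) \<le> K * ((1 + 8 * r) * sqrt (1 + 8 * r))"
        using K(1) r by (intro mult_left_mono mult_mono real_sqrt_le_mono) auto
      then show "Re (P v) < K * ((1 + 8 * r) * sqrt (1 + 8 * r)) + 1" using ReP[of v] by linarith
    qed
    then show ?thesis unfolding b_def using norm_triangle_ineq2[of "P z" "P 0"] by simp
  qed
  \<comment> \<open>The bound \<open>b r\<close> is of order \<open>r^(3/2)\<close>, so the Cauchy
    estimate for the second derivative tends to 0.\<close>
  have d2: "norm ((deriv ^^ 2) P 0) \<le> fact 2 * b r / r ^ 2" if "r > 0" for r
    by (rule Cauchy_inequality) (use P(1) that Pb[OF that] in \<open>auto intro: holomorphic_on_subset holomorphic_on_imp_continuous_on\<close>)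
  have "((\<lambda>r. fact 2 * b r / r ^ 2) \<longlongrightarrow> 0) at_top" unfolding b_def by real_asymp
  moreover have "eventually (\<lambda>r. norm ((deriv ^^ 2) P 0) \<le> fact 2 * b r / r ^ 2) at_top"
    using eventually_gt_at_top[of 0] by eventually_elim (rule d2)
  ultimately have "norm ((deriv ^^ 2) P 0) \<le> 0" by (intro tendsto_lowerbound) auto
  then have d20: "(deriv ^^ 2) P 0 = 0" by simp
  \<comment> \<open>The number \<open>27 = 9 * 3\<close> bounds
    \<open>(1 + 8 * r) * sqrt (1 + 8 * r)\<close> by \<open>27 * r^2\<close> for
    \<open>r \<ge> 1\<close>. This coarse estimate only limits the degree to 2; the quadratic
    coefficient is already known to vanish.\<close>
  define B where "B = 2 * (K * 27 + 1 + \<bar>Re (P 0)\<bar>) + norm (P 0)"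
  have "norm (P z) \<le> B * norm z ^ 2" if z: "1 \<le> norm z" for z
  proof -
    have "(1 + 8 * norm z) * sqrt (1 + 8 * norm z) \<le> (9 * norm z) * (3 * norm z)"
    proof (intro mult_mono)
      have "1 + 8 * norm z \<le> 9 * norm z" using z by simp
      also have "\<dots> \<le> (3 * norm z)\<^sup>2" using z mult_left_mono[OF z, of "norm z"] by (simp add: power2_eq_square)
      finally show "sqrt (1 + 8 * norm z) \<le> 3 * norm z" by (intro real_le_lsqrt) auto
    qed (use z in auto)
    then have "K * ((1 + 8 * norm z) * sqrt (1 + 8 * norm z)) \<le> K * (27 * norm z ^ 2)"
      using K(1) by (intro mult_left_mono) (auto simp: power2_eq_square)
    then have "b (norm z) \<le> 2 * (K * 27 * norm z ^ 2 + (1 + \<bar>Re (P 0)\<bar>) * 1) + norm (P 0) * 1" unfolding b_def by simp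
    also have "\<dots> \<le> 2 * (K * 27 * norm z ^ 2 + (1 + \<bar>Re (P 0)\<bar>) * norm z ^ 2) + norm (P 0) * norm z ^ 2"
      using z by (intro add_mono mult_left_mono order_refl one_le_power) auto
    also have "\<dots> = B * norm z ^ 2" unfolding B_def by (simp add: algebra_simps)
    finally show ?thesis using Pb[of "norm z" z] z by linarith
  qed
  note Pp = Liouville_polynomial[OF P(1) this]
  define c where "c = deriv P 0"
  have Pc: "P z = P 0 + c * z" for z
  proof -
    have "P z = (\<Sum>j\<le>2. (deriv ^^ j) P 0 / fact j * z ^ j)" by (rule Pp)
    then show ?thesis using d20 by (simp add: numeral_2_eq_2 c_def)
  qed
  \<comment> \<open>With parity sign \<open>- 1\<close> the map
    \<open>\<zeta> \<mapsto> - \<zeta>\<close> exchanges the two summands of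
    \<open>connection\<close>.\<close>
  have even: "connection l 0 (- z) = connection l 0 z" for z unfolding connection_def s by simp
  have e1: "exp (2 * c * z) = 1" for z
  proof -
    have "exp (P 0 + c * z) = exp (P 0 - c * z)" using even[of z] unfolding P(2)[symmetric] Pc[of z] Pc[of "- z"] by simp
    then have "exp (c * z) = inverse (exp (c * z))" by (simp add: exp_add exp_diff exp_minus field_simps)
    then have "exp (c * z) * exp (c * z) = 1" by (metis exp_not_eq_zero right_inverse)
    then show ?thesis by (simp flip: exp_add add: mult.assoc)
  qed
  have "c = 0"
  proof (rule ccontr)
    assume "c \<noteq> 0"
    then have "exp 1 = (1 :: complex)" using e1[of "1 / (2 * c)"] by simp
    then have "norm (exp (1 :: complex)) = 1" by simp
    then show False by (simp add: norm_exp_eq_Re)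
  qed
  then have "connection l 0 z = connection l 0 0" for z unfolding P(2)[symmetric] using Pc[of z] by simp
  then show False using connection_const_False[OF kl] by blast
qed

lemma connection_zero:
  assumes "k < l" "(k, l) \<noteq> (0, 1)"
  shows "\<exists>z. connection l k z = 0"
proof (cases "k \<ge> 1 \<or> parity_sign l k = 1")
  case False
  then have k0: "k = 0" by auto
  then have "parity_sign l 0 = - 1" "l \<ge> 2" using False parity_sign_cases[of l 0] assms by auto
  then show ?thesis using connection_zero_special k0 by simp
qed (rule connection_zero_generic[OF assms(1)])

text \<open>The data \<open>(alpha, beta)\<close> have zero amplitude at \<open>+\<infinity>\<close>
  by construction. At a zero of \<open>connection\<close> the reflected data
  \<open>(alpha, - beta)\<close> have zero amplitude too, so the same solution is bounded in both
  directions.\<close>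

theorem bounded_solution_exists:
  assumes kl: "k < l" and ne: "(k, l) \<noteq> (0, 1)"
  obtains \<zeta> c0 c1 B where "(c0, c1) \<noteq> (0, 0)" "\<And>x::real. norm (sol l k 1 (- \<zeta>) c0 c1 (of_real x)) \<le> B"
proof -
  obtain \<zeta> where z: "connection l k \<zeta> = 0" using connection_zero[OF assms] by blast
  let ?a = "alpha l k 1 (- \<zeta>)" and ?b = "beta l k 1 (- \<zeta>)"
  obtain X d \<nu> where g1: "sectorial l k 1 (- \<zeta>) X d \<nu>" using sectorial_one_complex[OF kl] by blast
  obtain X' d' \<nu>' where g2: "sectorial l k 1 (- (parity_sign l k * \<zeta>)) X' d' \<nu>'" using sectorial_one_complex[OF kl] by blast
  have "amplitude l k 1 (- \<zeta>) ?a ?b = 0"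
    unfolding amplitude_basis[OF g1, of ?a ?b] unfolding alpha_def beta_def by simp
  then obtain B1 where B1: "\<And>x. x \<ge> 0 \<Longrightarrow> norm (sol l k 1 (- \<zeta>) ?a ?b (of_real x)) \<le> B1"
    using amplitude_zero_bounded[OF g1] by blast
  have "amplitude l k 1 (- (parity_sign l k * \<zeta>)) ?a (- ?b) = - connection l k \<zeta> / 2"
    unfolding amplitude_basis[OF g2, of ?a] unfolding connection_def alpha_def[of l k 1 "- (parity_sign l k * \<zeta>)"] beta_def[of l k 1 "- (parity_sign l k * \<zeta>)"]
    by (simp add: algebra_simps)
  then have "amplitude l k 1 (- (parity_sign l k * \<zeta>)) ?a (- ?b) = 0" using z by simp
  then obtain B2 where B2: "\<And>x. x \<ge> 0 \<Longrightarrow> norm (sol l k 1 (- (parity_sign l k * \<zeta>)) ?a (- ?b) (of_real x)) \<le> B2"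
    using amplitude_zero_bounded[OF g2] by blast
  have refl: "sol l k 1 (- (parity_sign l k * \<zeta>)) ?a (- 1 * ?b) z = sol l k 1 (- \<zeta>) ?a ?b (- 1 * z)" for z
  proof (rule sol_scale(1))
    show "(- 1) ^ (2 * l + 2) * 1\<^sup>2 = (1 :: complex)\<^sup>2" by simp
    show "(- 1) ^ (l + k + 2) * (1 * - \<zeta>) = 1 * - (parity_sign l k * \<zeta>)" unfolding parity_sign_def by simp
    show "(- 1) ^ (2 * k + 2) * (- \<zeta>)\<^sup>2 = (- (parity_sign l k * \<zeta>))\<^sup>2" using parity_sign_cases[of l k] by auto
  qed
  have "norm (sol l k 1 (- \<zeta>) ?a ?b (of_real x)) \<le> max B1 B2" for x :: real
  proof (cases "x \<ge> 0")
    case False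
    then have "norm (sol l k 1 (- \<zeta>) ?a ?b (of_real x)) \<le> B2" using B2[of "- x"] refl[of "of_real (- x)"] by simp
    then show ?thesis by simp
  qed (use B1 in \<open>simp add: le_max_iff_disj\<close>)
  moreover have "(?a, ?b) \<noteq> (0, 0)" using amplitude_nontrivial[OF g1] unfolding alpha_def beta_def by auto
  ultimately show ?thesis using that by blast
qed

section \<open>Test functions and distributions\<close>

lemma partials_Nil [simp]: "partials [] \<phi> = \<phi>"
  and partials_Cons: "partials (i # is) \<phi> = partial i (partials is \<phi>)"
  and partials_snoc: "partials (is @ [i]) \<phi> = partials is (partial i \<phi>)"
  unfolding partials_def by simp_all

lemma partial_eqI:
  assumes "(f has_derivative D) (at p)"
  shows "partial i f p = D (axis i 1)"
  unfolding partial_def using frechet_derivative_at[OF assms] by simp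

lemma partial_const [simp]: "partial i (\<lambda>p. c) = (\<lambda>p. 0)"
  by (rule ext, rule partial_eqI[OF has_derivative_const])

lemma partial_add:
  assumes "f differentiable (at p)" "g differentiable (at p)"
  shows "partial i (\<lambda>p. f p + g p) p = partial i f p + partial i g p"
  using partial_eqI[OF has_derivative_add[OF assms[unfolded frechet_derivative_works]]] by (simp add: partial_def)

lemma partial_mult:
  assumes "f differentiable (at p)" "g differentiable (at p)"
  shows "partial i (\<lambda>p. f p * g p) p = f p * partial i g p + partial i f p * g p"
  using partial_eqI[OF has_derivative_mult[OF assms[unfolded frechet_derivative_works]]] by (simp add: partial_def)

lemma smooth_differentiable: "smooth \<phi> \<Longrightarrow> \<phi> differentiable (at p)"
  unfolding smooth_def by (metis partials_Nil)

lemma smooth_partial: "smooth \<phi> \<Longrightarrow> smooth (partial i \<phi>)"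
  unfolding smooth_def by (metis partials_snoc)

lemma smooth_continuous: "smooth \<phi> \<Longrightarrow> continuous_on S \<phi>"
  by (meson smooth_differentiable differentiable_imp_continuous_within continuous_at_imp_continuous_on)

lemma smooth_const: "smooth (\<lambda>p. c)"
proof -
  have "\<exists>d. partials is (\<lambda>p. c) = (\<lambda>p. d)" for "is" :: "'a list"
    by (induction "is") (auto simp: partials_Cons)
  then show ?thesis unfolding smooth_def by (metis differentiable_const)
qed

text \<open>Iterated partial derivatives of a product stay in the span of products of smooth functions.\<close>

inductive smooth_product_span :: "(real ^ 'n::finite \<Rightarrow> complex) \<Rightarrow> bool" where
  product: "smooth \<phi> \<Longrightarrow> smooth \<psi> \<Longrightarrow> smooth_product_span (\<lambda>p. \<phi> p * \<psi> p)"
| add: "smooth_product_span \<phi> \<Longrightarrow> smooth_product_span \<psi> \<Longrightarrow> smooth_product_span (\<lambda>p. \<phi> p + \<psi> p)"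

lemma smooth_product_span_partial:
  "smooth_product_span \<omega> \<Longrightarrow> (\<forall>p. \<omega> differentiable (at p)) \<and> smooth_product_span (partial i \<omega>)"
proof (induction rule: smooth_product_span.induct)
  case (product \<phi> \<psi>)
  have "partial i (\<lambda>p. \<phi> p * \<psi> p) = (\<lambda>p. \<phi> p * partial i \<psi> p + partial i \<phi> p * \<psi> p)"
    using product by (auto simp: fun_eq_iff intro!: partial_mult smooth_differentiable)
  moreover have "smooth_product_span (\<lambda>p. \<phi> p * partial i \<psi> p + partial i \<phi> p * \<psi> p)"
    using product by (intro smooth_product_span.intros smooth_partial)
  ultimately show ?case using product by (metis differentiable_mult smooth_differentiable)
next
  case (add \<phi> \<psi>)
  then have "partial i (\<lambda>p. \<phi> p + \<psi> p) = (\<lambda>p. partial i \<phi> p + partial i \<psi> p)"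
    by (auto simp: fun_eq_iff intro!: partial_add)
  then show ?case using add by (auto intro!: differentiable_add smooth_product_span.add)
qed

lemma smooth_mult:
  assumes "smooth \<phi>" "smooth \<psi>"
  shows "smooth (\<lambda>p. \<phi> p * \<psi> p)"
proof -
  have "smooth_product_span (partials is (\<lambda>p. \<phi> p * \<psi> p))" for "is"
    by (induction "is") (use assms smooth_product_span_partial in \<open>auto simp: partials_Cons intro: smooth_product_span.product\<close>)
  then show ?thesis unfolding smooth_def using smooth_product_span_partial by blast
qed

lemma smooth_coordinate: "smooth (\<lambda>p::real ^ 'n::finite. complex_of_real (p $ j))"
proof -
  have d: "((\<lambda>p::real ^ 'n. complex_of_real (p $ j)) has_derivative (\<lambda>v. complex_of_real (v $ j))) (at p)" for p
    by (intro bounded_linear_imp_has_derivative bounded_linear_compose[OF bounded_linear_of_real] bounded_linear_vec_nth)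
  have "\<exists>d. partial i (\<lambda>p::real ^ 'n. complex_of_real (p $ j)) = (\<lambda>p. d)" for i
    using partial_eqI[OF d] by blast
  then have "is = [] \<or> (\<exists>d. partials is (\<lambda>p::real ^ 'n. complex_of_real (p $ j)) = (\<lambda>p. d))" for "is"
    by (induction "is") (auto simp: partials_Cons)
  then have "partials is (\<lambda>p::real ^ 'n. complex_of_real (p $ j)) differentiable (at p)" for "is" p
    using d unfolding differentiable_def by (metis partials_Nil has_derivative_const)
  then show ?thesis unfolding smooth_def by blast
qed

lemma smooth_coordinate_power: "smooth (\<lambda>p::real ^ 'n::finite. complex_of_real ((p $ j) ^ k))"
proof (induction k)
  case (Suc k)
  then show ?case using smooth_mult[OF smooth_coordinate Suc, of j] by simp
qed (simp add: smooth_const)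

lemma not_support_zero: "p \<notin> support \<phi> \<Longrightarrow> \<phi> p = 0"
  using closure_subset[of "{p. \<phi> p \<noteq> 0}"] unfolding support_def by auto

lemma support_mult: "support (\<lambda>p. a p * \<phi> p) \<subseteq> support \<phi>"
  unfolding support_def by (intro closure_mono) auto

lemma support_partial: "support (partial i \<phi>) \<subseteq> support \<phi>"
proof -
  have "partial i \<phi> p = 0" if "p \<notin> support \<phi>" for p
  proof -
    have "open (- support \<phi>)" unfolding support_def by (rule open_Compl) simp
    then have "(\<phi> has_derivative (\<lambda>v. 0)) (at p)"
    proof (rule has_derivative_transform_within_open[rotated])
      show "((\<lambda>p. 0) has_derivative (\<lambda>v. 0)) (at p)" by (rule has_derivative_const)
    qed (use that not_support_zero in auto)
    then show ?thesis using partial_eqI by fastforce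
  qed
  then have "{p. partial i \<phi> p \<noteq> 0} \<subseteq> support \<phi>" by blast
  then show ?thesis unfolding support_def[of "partial i \<phi>"] by (intro closure_minimal) (simp_all add: support_def)
qed

lemma compact_support_subset:
  assumes "support \<phi> \<subseteq> support \<psi>" "compact (support \<psi>)" shows "compact (support \<phi>)"
proof -
  have "closed (support \<phi>)" unfolding support_def by simp
  then show ?thesis using assms by (metis compact_Int_closed inf.absorb2)
qed

lemma test_functions_partial: "\<phi> \<in> test_functions U \<Longrightarrow> partial i \<phi> \<in> test_functions U"
  unfolding test_functions_def using support_partial[of i \<phi>] smooth_partial compact_support_subset by blast

lemma test_functions_mult: "smooth a \<Longrightarrow> \<phi> \<in> test_functions U \<Longrightarrow> (\<lambda>p. a p * \<phi> p) \<in> test_functions U"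
  unfolding test_functions_def using support_mult[of a \<phi>] smooth_mult compact_support_subset by blast

section \<open>Integration by parts for regular distributions\<close>

text \<open>The test function cuts the integrand down to a compact subset of \<open>U\<close>, so
  continuity of \<open>w\<close> on \<open>U\<close> gives integrability, even where
  \<open>w\<close> is unbounded near the boundary.\<close>

lemma test_integrable:
  assumes \<phi>: "\<phi> \<in> test_functions U" and w: "continuous_on U w"
  shows "integrable lborel (\<lambda>p. indicator U p *\<^sub>R (w p * \<phi> p))"
    "(\<lambda>p. indicator U p *\<^sub>R (w p * \<phi> p)) = (\<lambda>p. indicator (support \<phi>) p *\<^sub>R (w p * \<phi> p))"
proof -
  have c: "compact (support \<phi>)" "support \<phi> \<subseteq> U" "smooth \<phi>" using \<phi> unfolding test_functions_def by auto
  show e: "(\<lambda>p. indicator U p *\<^sub>R (w p * \<phi> p)) = (\<lambda>p. indicator (support \<phi>) p *\<^sub>R (w p * \<phi> p))"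
    using c(2) not_support_zero[of _ \<phi>] by (auto simp: fun_eq_iff indicator_def)
  show "integrable lborel (\<lambda>p. indicator U p *\<^sub>R (w p * \<phi> p))"
    unfolding e by (intro borel_integrable_compact c(1) continuous_on_mult[OF continuous_on_subset[OF w c(2)] smooth_continuous[OF c(3)]])
qed

lemma distr_of_UNIV:
  assumes "\<phi> \<in> test_functions U"
  shows "distr_of U w \<phi> = (LINT p|lborel. w p * \<phi> p)"
proof -
  have "indicator U p *\<^sub>R (w p * \<phi> p) = w p * \<phi> p" for p
    using assms not_support_zero[of p \<phi>] unfolding test_functions_def by (auto simp: indicator_def)
  then show ?thesis unfolding distr_of_def set_lebesgue_integral_def by simp
qed

lemma lborel_integral_translate:
  fixes f :: "'a::euclidean_space \<Rightarrow> complex"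
  assumes "f \<in> borel_measurable borel"
  shows "(LINT p|lborel. f (c + p)) = (LINT p|lborel. f p)"
proof -
  have "(LINT p|distr lborel borel ((+) c). f p) = (LINT p|lborel. f (c + p))"
    by (rule integral_distr) (use assms in auto)
  then show ?thesis by (simp add: lborel_distr_plus)
qed

text \<open>Difference quotients in a coordinate direction integrate to 0 by translation invariance
  of the measure, and dominated convergence hands this to the derivative. No iterated integrals are
  involved.\<close>

lemma integral_partial_zero:
  fixes \<psi> :: "real ^ 'n::finite \<Rightarrow> complex"
  assumes d: "\<And>p. \<psi> differentiable (at p)" and c: "continuous_on UNIV (partial i \<psi>)" and K: "compact (support \<psi>)"
  shows "(LINT p|lborel. partial i \<psi> p) = 0"
proof -
  define e where "e = (axis i 1 :: real ^ 'n)"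
  have e1: "norm e = 1" unfolding e_def by simp
  have c\<psi>: "continuous_on UNIV \<psi>"
    using d by (meson continuous_at_imp_continuous_on differentiable_imp_continuous_within)
  obtain R0 where R0: "\<And>p. p \<in> support \<psi> \<Longrightarrow> norm p \<le> R0" using compact_imp_bounded[OF K] unfolding bounded_iff by blast
  define R where "R = max R0 0"
  have R: "\<And>p. p \<in> support \<psi> \<Longrightarrow> norm p \<le> R" "R \<ge> 0" using R0 unfolding R_def by (auto simp: le_max_iff_disj)
  have "compact (partial i \<psi> ` cball 0 (R + 2))" using c by (intro compact_continuous_image) (auto intro: continuous_on_subset)
  then have "bounded (partial i \<psi> ` cball 0 (R + 2))" by (rule compact_imp_bounded)
  then obtain M0 where M0: "\<And>p. p \<in> cball 0 (R + 2) \<Longrightarrow> norm (partial i \<psi> p) \<le> M0"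
    unfolding bounded_iff by blast
  define M where "M = max M0 0"
  have M: "norm (partial i \<psi> p) \<le> M" for p
  proof (cases "p \<in> cball 0 (R + 2)")
    case False
    then have "p \<notin> support (partial i \<psi>)" using R support_partial[of i \<psi>] by fastforce
    then show ?thesis using not_support_zero[of p "partial i \<psi>"] unfolding M_def by simp
  qed (use M0 in \<open>auto simp: M_def le_max_iff_disj\<close>)
  have line: "((\<lambda>s. \<psi> (p + s *\<^sub>R e)) has_vector_derivative partial i \<psi> (p + s *\<^sub>R e)) (at s)" for p s
  proof -
    have "(\<psi> has_derivative frechet_derivative \<psi> (at (p + s *\<^sub>R e))) (at (p + s *\<^sub>R e))" using d frechet_derivative_works by blast
    moreover have "((\<lambda>s. p + s *\<^sub>R e) has_derivative (\<lambda>h. h *\<^sub>R e)) (at s)" by (auto intro!: derivative_eq_intros)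
    ultimately have "((\<lambda>s. \<psi> (p + s *\<^sub>R e)) has_derivative (\<lambda>h. frechet_derivative \<psi> (at (p + s *\<^sub>R e)) (h *\<^sub>R e))) (at s)"
      by (rule has_derivative_compose[rotated])
    moreover have "frechet_derivative \<psi> (at (p + s *\<^sub>R e)) (h *\<^sub>R e) = h *\<^sub>R partial i \<psi> (p + s *\<^sub>R e)" for h
      unfolding partial_def e_def using d by (intro linear_cmul linear_frechet_derivative)
    ultimately show ?thesis unfolding has_vector_derivative_def by simp
  qed
  \<comment> \<open>Steps of length at most 1 keep all difference quotients supported in the ball of
    radius \<open>R + 1\<close>, so a single integrable majorant serves.\<close>
  define h where "h m = inverse (real (Suc m))" for m :: nat
  have h: "0 < h m" "h m \<le> 1" for m unfolding h_def by (auto simp: field_simps)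
  define q where "q m p = (1 / h m) *\<^sub>R (\<psi> (h m *\<^sub>R e + p) - \<psi> p)" for m p
  have m\<psi>: "\<psi> \<in> borel_measurable borel" using c\<psi> by (rule borel_measurable_continuous_onI)
  have mq: "q m \<in> borel_measurable lborel" for m
    unfolding q_def using c\<psi> by (simp, intro borel_measurable_continuous_onI continuous_intros continuous_on_compose2[OF c\<psi>]) auto
  have int\<psi>: "integrable lborel \<psi>"
  proof -
    have "\<psi> = (\<lambda>p. indicator (support \<psi>) p *\<^sub>R \<psi> p)" using not_support_zero[of _ \<psi>] by (auto simp: fun_eq_iff indicator_def)
    then show ?thesis using borel_integrable_compact[OF K continuous_on_subset[OF c\<psi>]] by simp
  qed
  have int\<psi>s: "integrable lborel (\<lambda>p. \<psi> (a + p))" for a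
    using int\<psi> integrable_distr_eq[of "(+) a" lborel borel \<psi>] m\<psi> by (simp add: lborel_distr_plus)
  have "(LINT p|lborel. q m p) = 0" for m
    unfolding q_def using int\<psi> int\<psi>s lborel_integral_translate[OF m\<psi>] by simp
  moreover have "(\<lambda>m. LINT p|lborel. q m p) \<longlonglongrightarrow> (LINT p|lborel. partial i \<psi> p)"
  proof (rule integral_dominated_convergence[where w = "\<lambda>p. indicator (cball 0 (R + 1)) p *\<^sub>R M"])
    show "partial i \<psi> \<in> borel_measurable lborel" using c by (simp add: borel_measurable_continuous_onI)
    show "integrable lborel (\<lambda>p::real ^ 'n. indicator (cball 0 (R + 1)) p *\<^sub>R M)" by (rule borel_integrable_compact) auto
    show "AE p in lborel. (\<lambda>m. q m p) \<longlonglongrightarrow> partial i \<psi> p"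
    proof (rule AE_I2)
      fix p
      have l0: "((\<lambda>s. norm (\<psi> (p + s *\<^sub>R e) - \<psi> p - s *\<^sub>R partial i \<psi> p) / norm s) \<longlongrightarrow> 0) (at 0)"
        using line[of p 0] unfolding has_vector_derivative_def has_derivative_at by simp
      have "((\<lambda>s. (1 / s) *\<^sub>R (\<psi> (p + s *\<^sub>R e) - \<psi> p) - partial i \<psi> p) \<longlongrightarrow> 0) (at 0)"
      proof (rule tendsto_norm_zero_cancel, rule Lim_transform_eventually[OF l0])
        have "norm (\<psi> (p + s *\<^sub>R e) - \<psi> p - s *\<^sub>R partial i \<psi> p) / norm s = norm ((1 / s) *\<^sub>R (\<psi> (p + s *\<^sub>R e) - \<psi> p) - partial i \<psi> p)"
          if "s \<noteq> 0" for s
        proof -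
          have "(1 / s) *\<^sub>R (\<psi> (p + s *\<^sub>R e) - \<psi> p) - partial i \<psi> p = (1 / s) *\<^sub>R (\<psi> (p + s *\<^sub>R e) - \<psi> p - s *\<^sub>R partial i \<psi> p)"
            using that by (simp add: scaleR_right_diff_distrib)
          then show ?thesis by simp
        qed
        then show "eventually (\<lambda>s. norm (\<psi> (p + s *\<^sub>R e) - \<psi> p - s *\<^sub>R partial i \<psi> p) / norm s = norm ((1 / s) *\<^sub>R (\<psi> (p + s *\<^sub>R e) - \<psi> p) - partial i \<psi> p)) (at 0)"
          by (auto simp: eventually_at_filter)
      qed
      then have "((\<lambda>s. (1 / s) *\<^sub>R (\<psi> (p + s *\<^sub>R e) - \<psi> p)) \<longlongrightarrow> partial i \<psi> p) (at 0)"
        by (simp add: LIM_zero_iff)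
      moreover have "filterlim h (at 0) sequentially"
        unfolding filterlim_at using h(1) LIMSEQ_inverse_real_of_nat unfolding h_def[abs_def] by (auto intro!: always_eventually)
      ultimately have "(\<lambda>m. (1 / h m) *\<^sub>R (\<psi> (p + h m *\<^sub>R e) - \<psi> p)) \<longlonglongrightarrow> partial i \<psi> p" by (rule filterlim_compose)
      then show "(\<lambda>m. q m p) \<longlonglongrightarrow> partial i \<psi> p" unfolding q_def by (simp add: add.commute)
    qed
    fix m
    show "q m \<in> borel_measurable lborel" by (rule mq)
    show "AE p in lborel. norm (q m p) \<le> indicator (cball 0 (R + 1)) p *\<^sub>R M"
    proof (rule AE_I2)
      fix p
      show "norm (q m p) \<le> indicator (cball 0 (R + 1)) p *\<^sub>R M"
      proof (cases "p \<in> cball 0 (R + 1)")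
        case True
        have "norm (\<psi> (p + h m *\<^sub>R e) - \<psi> (p + 0 *\<^sub>R e)) \<le> M * h m - M * 0"
        proof (rule differentiable_bound_general[where f' = "\<lambda>s. partial i \<psi> (p + s *\<^sub>R e)" and \<phi>' = "\<lambda>s. M"])
          show "continuous_on {0..h m} (\<lambda>s. \<psi> (p + s *\<^sub>R e))"
            by (intro continuous_at_imp_continuous_on ballI has_vector_derivative_continuous[OF line])
          show "((*) M has_vector_derivative M) (at x)" for x
            unfolding has_real_derivative_iff_has_vector_derivative[symmetric] by (auto intro!: derivative_eq_intros)
        qed (use h line M in \<open>auto intro!: continuous_intros\<close>)
        then have "norm (\<psi> (h m *\<^sub>R e + p) - \<psi> p) \<le> M * h m" by (simp add: add.commute)
        moreover have "norm (q m p) = norm (\<psi> (h m *\<^sub>R e + p) - \<psi> p) / h m" unfolding q_def norm_scaleR using h(1)[of m] by simp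
        ultimately show ?thesis using True h(1)[of m] by (simp add: divide_le_eq)
      next
        case False
        then have np: "norm p > R + 1" by simp
        moreover have "norm p \<le> norm (h m *\<^sub>R e + p) + norm (h m *\<^sub>R e)" using norm_triangle_ineq4[of "h m *\<^sub>R e + p" "h m *\<^sub>R e"] by simp
        ultimately have "norm (h m *\<^sub>R e + p) > R" using h[of m] e1 by simp
        then have "\<psi> (h m *\<^sub>R e + p) = 0" "\<psi> p = 0" using R np not_support_zero[of _ \<psi>] by (meson not_le less_trans less_add_one)+
        then show ?thesis unfolding q_def using False by simp
      qed
    qed
  qed
  ultimately show ?thesis by (simp add: LIMSEQ_const_iff)
qed

lemma integration_by_parts:
  fixes w :: "real ^ 'n::finite \<Rightarrow> complex"
  assumes \<phi>: "\<phi> \<in> test_functions U" and d: "\<And>p. w differentiable (at p)"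
    and c: "continuous_on UNIV (partial i w)"
  shows "distr_of U w (partial i \<phi>) = - distr_of U (partial i w) \<phi>"
proof -
  have s: "smooth \<phi>" "compact (support \<phi>)" "support \<phi> \<subseteq> U" using \<phi> unfolding test_functions_def by auto
  have cw: "continuous_on UNIV w"
    using d by (meson continuous_at_imp_continuous_on differentiable_imp_continuous_within)
  have p: "partial i (\<lambda>p. w p * \<phi> p) = (\<lambda>p. w p * partial i \<phi> p + partial i w p * \<phi> p)"
    by (rule ext, rule partial_mult[OF d smooth_differentiable[OF s(1)]])
  have cs: "compact (support (\<lambda>p. w p * \<phi> p))"
    by (rule compact_support_subset[OF support_mult s(2)])
  have "(LINT p|lborel. w p * partial i \<phi> p + partial i w p * \<phi> p) = 0"
    using integral_partial_zero[of "\<lambda>p. w p * \<phi> p" i, OF differentiable_mult[OF d smooth_differentiable[OF s(1)]] _ cs] unfolding p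
    using continuous_on_add[OF continuous_on_mult[OF cw smooth_continuous[OF smooth_partial[OF s(1)]]] continuous_on_mult[OF c smooth_continuous[OF s(1)]]] by blast
  moreover have "integrable lborel (\<lambda>p. w p * partial i \<phi> p)" "integrable lborel (\<lambda>p. partial i w p * \<phi> p)"
  proof -
    have U: "\<phi> \<in> test_functions UNIV" using \<phi> unfolding test_functions_def by auto
    show "integrable lborel (\<lambda>p. w p * partial i \<phi> p)"
      using test_integrable(1)[OF test_functions_partial[OF U] cw] by simp
    show "integrable lborel (\<lambda>p. partial i w p * \<phi> p)"
      using test_integrable(1)[OF U c] by simp
  qed
  ultimately have "(LINT p|lborel. w p * partial i \<phi> p) = - (LINT p|lborel. partial i w p * \<phi> p)"
    by (simp add: eq_neg_iff_add_eq_0)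
  then show ?thesis using distr_of_UNIV[OF \<phi>] distr_of_UNIV[OF test_functions_partial[OF \<phi>]] by simp
qed

section \<open>Plane waves and the operator\<close>

text \<open>A Fourier mode in \<open>y\<close> and \<open>t\<close> with profile \<open>G\<close> in
  \<open>x\<close>. The frequency \<open>m\<close> in \<open>y\<close> is complex because \<zeta>
  is, so the mode may grow in \<open>y\<close>; the damping \<open>c\<close> will make a
  superposition converge.\<close>

definition plane_wave :: "real \<Rightarrow> complex \<Rightarrow> real \<Rightarrow> (real \<Rightarrow> complex) \<Rightarrow> real ^ 3 \<Rightarrow> complex" where
  "plane_wave \<tau> m c G p = exp (\<i> * of_real (\<tau> * p $ 3) + \<i> * m * of_real (p $ 2) - of_real c) * G (p $ 1)"

lemma plane_wave_has_derivative:
  assumes "(G has_vector_derivative G') (at (p $ 1))"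
  shows "(plane_wave \<tau> m c G has_derivative (\<lambda>v. exp (\<i> * of_real (\<tau> * p $ 3) + \<i> * m * of_real (p $ 2) - of_real c) *
      ((\<i> * of_real (\<tau> * v $ 3) + \<i> * m * of_real (v $ 2)) * G (p $ 1) + (v $ 1) *\<^sub>R G'))) (at p)"
proof -
  let ?L = "\<lambda>p :: real ^ 3. \<i> * of_real (\<tau> * p $ 3) + \<i> * m * of_real (p $ 2) - of_real c"
  have L: "(?L has_derivative (\<lambda>v. \<i> * of_real (\<tau> * v $ 3) + \<i> * m * of_real (v $ 2))) (at p)"
    by (auto intro!: derivative_eq_intros bounded_linear.has_derivative[OF bounded_linear_vec_nth])
  have "(exp has_derivative (*) (exp (?L p))) (at (?L p))"
    using DERIV_exp[of "?L p"] unfolding has_field_derivative_def .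
  from has_derivative_compose[OF L this]
  have E: "((\<lambda>p. exp (?L p)) has_derivative (\<lambda>v. exp (?L p) * (\<i> * of_real (\<tau> * v $ 3) + \<i> * m * of_real (v $ 2)))) (at p)" .
  have G: "((\<lambda>p. G (p $ 1)) has_derivative (\<lambda>v. (v $ 1) *\<^sub>R G')) (at p)"
    using has_derivative_compose[OF bounded_linear_imp_has_derivative[OF bounded_linear_vec_nth] assms[unfolded has_vector_derivative_def]] .
  show ?thesis unfolding plane_wave_def[abs_def]
    by (rule has_derivative_eq_rhs[OF has_derivative_mult[OF E G]]) (simp add: fun_eq_iff algebra_simps)
qed

lemma axis3: "axis (1::3) (1::real) $ 1 = 1" "axis (1::3) (1::real) $ 2 = 0" "axis (1::3) (1::real) $ 3 = 0"
  "axis (2::3) (1::real) $ 1 = 0" "axis (2::3) (1::real) $ 2 = 1" "axis (2::3) (1::real) $ 3 = 0"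
  "axis (3::3) (1::real) $ 1 = 0" "axis (3::3) (1::real) $ 2 = 0" "axis (3::3) (1::real) $ 3 = 1"
  by (simp_all add: axis_def)

lemma plane_wave_partial:
  assumes "\<And>x. (G has_vector_derivative G' x) (at x)"
  shows "partial 1 (plane_wave \<tau> m c G) = plane_wave \<tau> m c G'"
    "partial 2 (plane_wave \<tau> m c G) = plane_wave \<tau> m c (\<lambda>x. \<i> * m * G x)"
    "partial 3 (plane_wave \<tau> m c G) = plane_wave \<tau> m c (\<lambda>x. \<i> * of_real \<tau> * G x)"
  "plane_wave \<tau> m c G differentiable (at p)"
proof -
  show "partial 1 (plane_wave \<tau> m c G) = plane_wave \<tau> m c G'"
    "partial 2 (plane_wave \<tau> m c G) = plane_wave \<tau> m c (\<lambda>x. \<i> * m * G x)"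
    "partial 3 (plane_wave \<tau> m c G) = plane_wave \<tau> m c (\<lambda>x. \<i> * of_real \<tau> * G x)"
    using partial_eqI[OF plane_wave_has_derivative[OF assms]] by (auto simp: fun_eq_iff plane_wave_def axis3)
  show "plane_wave \<tau> m c G differentiable (at p)"
    using plane_wave_has_derivative[OF assms] unfolding differentiable_def by blast
qed

lemma plane_wave_continuous:
  assumes "continuous_on UNIV G"
  shows "continuous_on S (plane_wave \<tau> m c G)"
  unfolding plane_wave_def[abs_def] by (intro continuous_intros continuous_on_compose2[OF assms]) auto

lemma distr_of_mult:
  "distr_of U w (\<lambda>p. a p * \<phi> p) = distr_of U (\<lambda>p. a p * w p) \<phi>"
  unfolding distr_of_def by (simp add: mult_ac)

lemma distr_of_add:
  assumes "\<phi> \<in> test_functions U" "continuous_on U v" "continuous_on U w"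
  shows "distr_of U v \<phi> + distr_of U w \<phi> = distr_of U (\<lambda>p. v p + w p) \<phi>"
  unfolding distr_of_def set_lebesgue_integral_def distrib_right scaleR_add_right
  by (rule Bochner_Integration.integral_add[symmetric]) (intro test_integrable assms)+

lemma distr_of_diff:
  assumes "\<phi> \<in> test_functions U" "continuous_on U v" "continuous_on U w"
  shows "distr_of U v \<phi> - distr_of U w \<phi> = distr_of U (\<lambda>p. v p - w p) \<phi>"
  unfolding distr_of_def set_lebesgue_integral_def left_diff_distrib scaleR_diff_right
  by (rule Bochner_Integration.integral_diff[symmetric]) (intro test_integrable assms)+

text \<open>Identities between functionals are available on test functions only; this carries them
  through a second application of the field.\<close>

lemma vector_field_cong:
  assumes "\<And>\<phi>. \<phi> \<in> test_functions U \<Longrightarrow> u \<phi> = v \<phi>" and \<phi>: "\<phi> \<in> test_functions U"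
  shows "vector_field k l u \<phi> = vector_field k l v \<phi>"
proof -
  have "partial 2 (\<lambda>p. complex_of_real ((p $ 1) ^ k) * \<phi> p) \<in> test_functions U"
    "partial 3 (\<lambda>p. complex_of_real ((p $ 1) ^ l) * \<phi> p) \<in> test_functions U"
    by (intro test_functions_partial test_functions_mult smooth_coordinate_power \<phi>)+
  then show ?thesis using assms(1) unfolding vector_field_def distr_mult_def distr_partial_def by simp
qed

lemma vector_field_plane_wave:
  assumes G: "\<And>x. (G has_vector_derivative G' x) (at x)" and \<phi>: "\<phi> \<in> test_functions U"
  shows "vector_field k l (distr_of U (plane_wave \<tau> m c G)) \<phi> =
    distr_of U (plane_wave \<tau> m c (\<lambda>x. \<i> * (of_real (x ^ k) * m - of_real (x ^ l * \<tau>)) * G x)) \<phi>"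
proof -
  have cG: "continuous_on UNIV G" using G by (intro continuous_at_imp_continuous_on ballI has_vector_derivative_continuous) auto
  have cpw: "continuous_on UNIV (plane_wave \<tau> m c (\<lambda>x. a * G x))" for a
    by (rule plane_wave_continuous) (intro continuous_intros cG)
  have 2: "distr_of U (plane_wave \<tau> m c G) (partial 2 \<psi>) = - distr_of U (plane_wave \<tau> m c (\<lambda>x. \<i> * m * G x)) \<psi>"
    and 3: "distr_of U (plane_wave \<tau> m c G) (partial 3 \<psi>) = - distr_of U (plane_wave \<tau> m c (\<lambda>x. \<i> * of_real \<tau> * G x)) \<psi>"
    if "\<psi> \<in> test_functions U" for \<psi>
    using integration_by_parts[OF that plane_wave_partial(4)[OF G], of 2 \<tau> m c] integration_by_parts[OF that plane_wave_partial(4)[OF G], of 3 \<tau> m c]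
    unfolding plane_wave_partial(2,3)[OF G] by (simp_all add: cpw)
  have "vector_field k l (distr_of U (plane_wave \<tau> m c G)) \<phi> =
     distr_of U (\<lambda>p. of_real ((p $ 1) ^ k) * plane_wave \<tau> m c (\<lambda>x. \<i> * m * G x) p) \<phi> -
     distr_of U (\<lambda>p. of_real ((p $ 1) ^ l) * plane_wave \<tau> m c (\<lambda>x. \<i> * of_real \<tau> * G x) p) \<phi>"
    unfolding vector_field_def distr_mult_def distr_partial_def
    using 2[OF test_functions_mult[OF smooth_coordinate_power \<phi>], of 1 k] 3[OF test_functions_mult[OF smooth_coordinate_power \<phi>], of 1 l]
    by (simp add: distr_of_mult)
  also have "\<dots> = distr_of U (\<lambda>p. of_real ((p $ 1) ^ k) * plane_wave \<tau> m c (\<lambda>x. \<i> * m * G x) p - of_real ((p $ 1) ^ l) * plane_wave \<tau> m c (\<lambda>x. \<i> * of_real \<tau> * G x) p) \<phi>"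
    by (rule distr_of_diff[OF \<phi>]) (intro continuous_intros plane_wave_continuous cG)+
  also have "(\<lambda>p. of_real ((p $ 1) ^ k) * plane_wave \<tau> m c (\<lambda>x. \<i> * m * G x) p - of_real ((p $ 1) ^ l) * plane_wave \<tau> m c (\<lambda>x. \<i> * of_real \<tau> * G x) p)
     = plane_wave \<tau> m c (\<lambda>x. \<i> * (of_real (x ^ k) * m - of_real (x ^ l * \<tau>)) * G x)"
    unfolding plane_wave_def by (simp add: fun_eq_iff algebra_simps)
  finally show ?thesis .
qed

text \<open>The vector field multiplies a plane wave by \<open>\<mu> x\<close>, a function of
  \<open>x\<close> alone, and so preserves its form. Applied twice it multiplies by
  \<open>(\<mu> x)^2\<close>, the negative of the potential in \<open>ode\<close>, which cancels the
  contribution of \<open>F''\<close>.\<close>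

lemma P_op_plane_wave:
  assumes F: "\<And>x. (F has_vector_derivative F' x) (at x)" and F': "\<And>x. (F' has_vector_derivative F'' x) (at x)"
    and ode: "\<And>x. F'' x = (of_real (x ^ k) * m - of_real (x ^ l * \<tau>))\<^sup>2 * F x" and \<phi>: "\<phi> \<in> test_functions U"
  shows "P_op k l (distr_of U (plane_wave \<tau> m c F)) \<phi> = 0"
proof -
  define \<mu> where "\<mu> x = \<i> * (of_real (x ^ k) * m - of_real (x ^ l * \<tau>))" for x
  have cF: "continuous_on UNIV F" "continuous_on UNIV F'"
    using F F' by (auto intro!: continuous_at_imp_continuous_on has_vector_derivative_continuous)
  have c\<mu>: "continuous_on UNIV \<mu>" unfolding \<mu>_def[abs_def] by (intro continuous_intros)
  have "F'' = (\<lambda>x. (of_real (x ^ k) * m - of_real (x ^ l * \<tau>))\<^sup>2 * F x)" using ode by auto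
  then have cF'': "continuous_on UNIV F''" by (simp, intro continuous_intros cF)
  have "(\<mu> has_vector_derivative (\<i> * (of_real (real k * x ^ (k - 1)) * m - of_real (real l * x ^ (l - 1) * \<tau>)))) (at x)" for x
    unfolding \<mu>_def[abs_def]
    by (auto intro!: derivative_eq_intros simp: has_vector_derivative_def fun_eq_iff algebra_simps scaleR_conv_of_real)
  note G' = has_vector_derivative_mult[OF this F]
  have V: "vector_field k l (distr_of U (plane_wave \<tau> m c F)) \<psi> = distr_of U (plane_wave \<tau> m c (\<lambda>x. \<mu> x * F x)) \<psi>" if "\<psi> \<in> test_functions U" for \<psi>
    unfolding \<mu>_def by (rule vector_field_plane_wave[OF F that])
  have "vector_field k l (vector_field k l (distr_of U (plane_wave \<tau> m c F))) \<phi> = distr_of U (plane_wave \<tau> m c (\<lambda>x. \<mu> x * (\<mu> x * F x))) \<phi>"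
  proof -
    have "vector_field k l (vector_field k l (distr_of U (plane_wave \<tau> m c F))) \<phi> = vector_field k l (distr_of U (plane_wave \<tau> m c (\<lambda>x. \<mu> x * F x))) \<phi>"
      by (rule vector_field_cong[OF _ \<phi>]) (rule V)
    then show ?thesis using vector_field_plane_wave[OF G' \<phi>, of k l \<tau> m c, folded \<mu>_def] by simp
  qed
  moreover have "distr_partial 1 (distr_partial 1 (distr_of U (plane_wave \<tau> m c F))) \<phi> = distr_of U (plane_wave \<tau> m c F'') \<phi>"
    using integration_by_parts[OF test_functions_partial[OF \<phi>, of 1] plane_wave_partial(4)[OF F], of 1 \<tau> m c]
      integration_by_parts[OF \<phi> plane_wave_partial(4)[OF F'], of 1 \<tau> m c]
    unfolding plane_wave_partial(1)[OF F] plane_wave_partial(1)[OF F'] distr_partial_def by (simp add: plane_wave_continuous cF cF'')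
  ultimately have "P_op k l (distr_of U (plane_wave \<tau> m c F)) \<phi> = distr_of U (\<lambda>p. plane_wave \<tau> m c F'' p + plane_wave \<tau> m c (\<lambda>x. \<mu> x * (\<mu> x * F x)) p) \<phi>"
    unfolding P_op_def using distr_of_add[OF \<phi> plane_wave_continuous[OF cF''] plane_wave_continuous[of "\<lambda>x. \<mu> x * (\<mu> x * F x)"]]
    by (simp add: continuous_on_mult c\<mu> cF)
  also have "(\<lambda>p. plane_wave \<tau> m c F'' p + plane_wave \<tau> m c (\<lambda>x. \<mu> x * (\<mu> x * F x)) p) = (\<lambda>p. 0)"
  proof
    fix p
    have "F'' x + \<mu> x * (\<mu> x * F x) = 0" for x unfolding ode \<mu>_def by (simp add: power2_eq_square algebra_simps)
    then show "plane_wave \<tau> m c F'' p + plane_wave \<tau> m c (\<lambda>x. \<mu> x * (\<mu> x * F x)) p = 0"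
      unfolding plane_wave_def by (simp flip: distrib_left)
  qed
  finally show ?thesis by (simp add: distr_of_def set_lebesgue_integral_def)
qed

text \<open>Displays the operator as a finite combination of values of \<open>v\<close> at other
  test functions; a convergent series of distributions can then be summed term by term.\<close>

lemma P_op_expand:
  "P_op k l v \<phi> = v (partial 1 (partial 1 \<phi>)) +
    (v (partial 2 (\<lambda>p. of_real ((p $ 1) ^ k) * partial 2 (\<lambda>p. of_real ((p $ 1) ^ k) * \<phi> p) p))
   - v (partial 3 (\<lambda>p. of_real ((p $ 1) ^ l) * partial 2 (\<lambda>p. of_real ((p $ 1) ^ k) * \<phi> p) p))
   - v (partial 2 (\<lambda>p. of_real ((p $ 1) ^ k) * partial 3 (\<lambda>p. of_real ((p $ 1) ^ l) * \<phi> p) p))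
   + v (partial 3 (\<lambda>p. of_real ((p $ 1) ^ l) * partial 3 (\<lambda>p. of_real ((p $ 1) ^ l) * \<phi> p) p)))"
  unfolding P_op_def vector_field_def distr_mult_def distr_partial_def by simp

section \<open>Series and continuity of regular distributions\<close>

lemma distr_of_sums:
  fixes w :: "nat \<Rightarrow> real ^ 'n::finite \<Rightarrow> complex"
  assumes \<phi>: "\<phi> \<in> test_functions U" and w: "\<And>n. continuous_on U (w n)"
    and b: "\<And>n p. p \<in> U \<Longrightarrow> norm (w n p) \<le> b n" and s: "summable b"
  shows "(\<lambda>n. distr_of U (w n) \<phi>) sums distr_of U (\<lambda>p. \<Sum>n. w n p) \<phi>"
proof -
  define f where "f n p = indicator U p *\<^sub>R (w n p * \<phi> p)" for n p
  have int\<phi>: "integrable lborel (\<lambda>p. norm (indicator U p *\<^sub>R (1 * \<phi> p)))"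
    by (intro integrable_norm test_integrable(1)[OF \<phi>] continuous_on_const)
  have fb: "norm (f n p) \<le> b n * norm (indicator U p *\<^sub>R (1 * \<phi> p))" for n p
    unfolding f_def using b[of p n] by (auto simp: indicator_def norm_mult mult_right_mono)
  have sn: "summable (\<lambda>n. norm (f n p))" for p
    by (rule summable_comparison_test'[OF summable_mult2[OF s]]) (use fb in simp)
  have "(\<lambda>n. LINT p|lborel. f n p) sums (LINT p|lborel. (\<Sum>n. f n p))"
  proof (rule sums_integral)
    show intf: "integrable lborel (f n)" for n unfolding f_def by (rule test_integrable(1)[OF \<phi> w])
    show "AE p in lborel. summable (\<lambda>n. norm (f n p))" using sn by simp
    show "summable (\<lambda>n. LINT p|lborel. norm (f n p))"
    proof (rule summable_comparison_test'[OF summable_mult2[OF s]])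
      fix n
      have "(LINT p|lborel. norm (f n p)) \<le> (LINT p|lborel. b n * norm (indicator U p *\<^sub>R (1 * \<phi> p)))"
        by (intro integral_mono integrable_norm intf integrable_mult_right int\<phi> fb)
      then show "norm (LINT p|lborel. norm (f n p)) \<le> b n * (LINT p|lborel. norm (indicator U p *\<^sub>R (1 * \<phi> p)))"
        by simp
    qed
  qed
  moreover have "(\<Sum>n. f n p) = indicator U p *\<^sub>R ((\<Sum>n. w n p) * \<phi> p)" for p
  proof (cases "p \<in> U")
    case True
    have "summable (\<lambda>n. w n p)" by (rule summable_comparison_test'[OF s]) (use b[OF True] in simp)
    then show ?thesis unfolding f_def using True by (simp add: suminf_mult2)
  qed (simp add: f_def)
  ultimately show ?thesis unfolding distr_of_def set_lebesgue_integral_def f_def by simp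
qed

lemma P_op_sums:
  fixes w :: "nat \<Rightarrow> real ^ 3 \<Rightarrow> complex"
  assumes \<phi>: "\<phi> \<in> test_functions U" and w: "\<And>n. continuous_on U (w n)"
    and b: "\<And>n p. p \<in> U \<Longrightarrow> norm (w n p) \<le> b n" and s: "summable b"
    and z: "\<And>n. P_op k l (distr_of U (w n)) \<phi> = 0"
  shows "P_op k l (distr_of U (\<lambda>p. \<Sum>n. w n p)) \<phi> = 0"
proof -
  have "(\<lambda>n. P_op k l (distr_of U (w n)) \<phi>) sums P_op k l (distr_of U (\<lambda>p. \<Sum>n. w n p)) \<phi>"
    unfolding P_op_expand
    by (intro sums_add sums_diff distr_of_sums[OF _ w b s] test_functions_partial test_functions_mult smooth_coordinate_power \<phi>)
  then show ?thesis unfolding z using sums_unique2 sums_zero by blast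
qed

lemma distribution_on_distr_of:
  fixes w :: "real ^ 'n::finite \<Rightarrow> complex"
  assumes w: "continuous_on U w"
  shows "distribution_on U (distr_of U w)"
  unfolding distribution_on_def
proof (intro conjI ballI allI impI)
  fix \<phi> \<psi> assume p: "\<phi> \<in> test_functions U" "\<psi> \<in> test_functions U"
  show "distr_of U w (\<lambda>p. \<phi> p + \<psi> p) = distr_of U w \<phi> + distr_of U w \<psi>"
    unfolding distr_of_def set_lebesgue_integral_def distrib_left scaleR_add_right
    by (intro Bochner_Integration.integral_add test_integrable p w)
next
  fix c :: complex and \<phi> :: "real ^ 'n \<Rightarrow> complex" assume "\<phi> \<in> test_functions U"
  have e: "indicator U p *\<^sub>R (w p * (c * \<phi> p)) = c * (indicator U p *\<^sub>R (w p * \<phi> p))" for p by (simp add: mult_ac)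
  show "distr_of U w (\<lambda>p. c * \<phi> p) = c * distr_of U w \<phi>"
    unfolding distr_of_def set_lebesgue_integral_def e by (rule integral_mult_right_zero)
next
  fix K assume K: "compact K \<and> K \<subseteq> U"
  define C where "C = (LINT p|lborel. norm (indicator K p *\<^sub>R w p))"
  have iw: "integrable lborel (\<lambda>p. indicator K p *\<^sub>R w p)"
    using K w by (intro borel_integrable_compact) (auto intro: continuous_on_subset)
  show "\<exists>C N. \<forall>\<phi>\<in>test_functions U. support \<phi> \<subseteq> K \<longrightarrow>
           cmod (distr_of U w \<phi>) \<le> C * (\<Sum>is | length is \<le> N. SUP p. cmod (partials is \<phi> p))"
  \<comment> \<open>A continuous function defines a distribution of order 0, bounded by its integral
    norm over \<open>K\<close>.\<close>
  proof (intro exI[of _ C] exI[of _ 0] ballI impI)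
    fix \<phi> assume \<phi>: "\<phi> \<in> test_functions U" and sK: "support \<phi> \<subseteq> K"
    define S where "S = (SUP p. cmod (\<phi> p))"
    have c: "compact (support \<phi>)" "smooth \<phi>" using \<phi> unfolding test_functions_def by auto
    have "compact (\<phi> ` support \<phi>)" using c by (intro compact_continuous_image smooth_continuous)
    then have "bounded (\<phi> ` support \<phi>)" by (rule compact_imp_bounded)
    then obtain B where B: "\<And>p. p \<in> support \<phi> \<Longrightarrow> cmod (\<phi> p) \<le> B" unfolding bounded_iff by blast
    have "cmod (\<phi> p) \<le> max B 0" for p using B[of p] not_support_zero[of p \<phi>] by (cases "p \<in> support \<phi>") auto
    \<comment> \<open>A real supremum is an upper bound only for a set known to be bounded above, so
      this must precede the use of \<open>S\<close>.\<close>
    then have bdd: "bdd_above (range (\<lambda>p. cmod (\<phi> p)))" by (intro bdd_aboveI) auto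
    have S: "cmod (\<phi> p) \<le> S" for p unfolding S_def by (rule cSUP_upper[OF _ bdd]) simp
    have S0: "S \<ge> 0" using S[of 0] norm_ge_zero order_trans by blast
    have "cmod (distr_of U w \<phi>) \<le> (LINT p|lborel. norm (indicator U p *\<^sub>R (w p * \<phi> p)))"
      unfolding distr_of_def set_lebesgue_integral_def by (rule integral_norm_bound)
    also have "\<dots> \<le> (LINT p|lborel. norm (indicator K p *\<^sub>R w p) * S)"
    proof (intro integral_mono integrable_norm test_integrable(1)[OF \<phi> w] integrable_mult_left iw)
      fix p show "norm (indicator U p *\<^sub>R (w p * \<phi> p)) \<le> norm (indicator K p *\<^sub>R w p) * S"
      proof (cases "p \<in> K")
        case False
        then have "\<phi> p = 0" using sK not_support_zero[of p \<phi>] by blast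
        then show ?thesis using S0 by simp
      next
        case True
        then show ?thesis using S[of p] S0 by (auto simp: indicator_def norm_mult mult_left_mono)
      qed
    qed
    also have "\<dots> = C * S" unfolding C_def by simp
    also have "S = (\<Sum>is | length is \<le> 0. SUP p. cmod (partials is \<phi> p))" unfolding S_def by simp
    finally show "cmod (distr_of U w \<phi>) \<le> C * (\<Sum>is | length is \<le> 0. SUP p. cmod (partials is \<phi> p))" .
  qed
qed

section \<open>Bump functions and separation of continuous functions\<close>

text \<open>The whole family is closed under differentiation: in \<open>y = 1 / x\<close> one has
  \<open>d/dx = - y^2 d/dy\<close>, so \<open>P\<close> is replaced by
  \<open>y^2 * (P - P')\<close>. One derivative formula thereby settles all orders.\<close>

definition flat_exp :: "real poly \<Rightarrow> real \<Rightarrow> real" where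
  "flat_exp P x = (if x > 0 then poly P (1 / x) * exp (- (1 / x)) else 0)"

text \<open>The power \<open>y ^ k\<close> is there for the induction on \<open>P\<close>, which
  shifts it by one. The case \<open>k = 1\<close> is the difference quotient of
  \<open>flat_exp\<close> at 0.\<close>

lemma poly_exp_decay: "((\<lambda>y::real. y ^ k * poly P y * exp (- y)) \<longlongrightarrow> 0) at_top"
proof (induction P arbitrary: k)
  case (pCons a P)
  have "((\<lambda>y::real. a * (y ^ k / exp y) + y ^ (Suc k) * poly P y * exp (- y)) \<longlongrightarrow> a * 0 + 0) at_top"
    by (intro tendsto_intros tendsto_power_div_exp_0 pCons(2))
  moreover have "(\<lambda>y::real. a * (y ^ k / exp y) + y ^ (Suc k) * poly P y * exp (- y)) = (\<lambda>y. y ^ k * poly (pCons a P) y * exp (- y))"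
    by (auto simp: fun_eq_iff exp_minus field_simps)
  ultimately show ?case by simp
qed simp

lemma flat_exp_has_derivative:
  "(flat_exp P has_real_derivative flat_exp ([:0, 0, 1:] * (P - pderiv P)) x) (at x)"
proof -
  consider "x > 0" | "x < 0" | "x = 0" by linarith
  then show ?thesis
  proof cases
    case 1
    have "((\<lambda>x. poly P (1 / x) * exp (- (1 / x))) has_real_derivative
       poly (pderiv P) (1 / x) * (- 1 / x\<^sup>2) * exp (- (1 / x)) + exp (- (1 / x)) * (1 / x\<^sup>2) * poly P (1 / x)) (at x)"
      using 1 by (auto intro!: derivative_eq_intros DERIV_chain2[OF poly_DERIV] simp: power2_eq_square)
    then have "((\<lambda>x. poly P (1 / x) * exp (- (1 / x))) has_real_derivative flat_exp ([:0, 0, 1:] * (P - pderiv P)) x) (at x)"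
      by (rule DERIV_cong) (use 1 in \<open>simp add: flat_exp_def field_simps power2_eq_square\<close>)
    then show ?thesis
    proof (rule has_field_derivative_transform_within_open[where S = "{0<..}"])
    qed (use 1 in \<open>auto simp: flat_exp_def\<close>)
  next
    case 2
    have "((\<lambda>x. 0) has_real_derivative flat_exp ([:0, 0, 1:] * (P - pderiv P)) x) (at x)"
      using 2 by (simp add: flat_exp_def)
    then show ?thesis
    proof (rule has_field_derivative_transform_within_open[where S = "{..<0}"])
    qed (use 2 in \<open>auto simp: flat_exp_def\<close>)
  next
    case 3
    have r: "((\<lambda>h. flat_exp P h / h) \<longlongrightarrow> 0) (at_right 0)"
    proof (rule Lim_transform_eventually)
      have "filterlim (\<lambda>h::real. 1 / h) at_top (at_right 0)" by real_asymp
      from filterlim_compose[OF poly_exp_decay[of 1 P] this]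
      show "((\<lambda>h. (1 / h) ^ 1 * poly P (1 / h) * exp (- (1 / h))) \<longlongrightarrow> 0) (at_right 0)" .
      show "eventually (\<lambda>h. (1 / h) ^ 1 * poly P (1 / h) * exp (- (1 / h)) = flat_exp P h / h) (at_right 0)"
        using eventually_at_right_less[of 0] by eventually_elim (simp add: flat_exp_def)
    qed
    have l: "((\<lambda>h. flat_exp P h / h) \<longlongrightarrow> 0) (at_left 0)"
    proof (rule Lim_transform_eventually)
      show "((\<lambda>h. 0) \<longlongrightarrow> 0) (at_left 0)" by simp
      show "eventually (\<lambda>h. 0 = flat_exp P h / h) (at_left (0::real))"
        by (auto simp: eventually_at_left_field flat_exp_def intro: exI[of _ "-1"])
    qed
    have "((\<lambda>h. flat_exp P h / h) \<longlongrightarrow> 0) (at 0)" using l r by (simp add: filterlim_at_split)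
    then show ?thesis unfolding has_field_derivative_iff 3 by (simp add: flat_exp_def[of _ 0])
  qed
qed

lemma smooth_flat_exp:
  fixes s c :: real
  shows "smooth (\<lambda>p::real ^ 'n::finite. complex_of_real (flat_exp P (s * p $ j + c)))"
proof -
  have d: "((\<lambda>p::real ^ 'n. complex_of_real (flat_exp P (s * p $ j + c))) has_derivative
     (\<lambda>v. complex_of_real (flat_exp ([:0, 0, 1:] * (P - pderiv P)) (s * p $ j + c) * (s * v $ j)))) (at p)" for P p
  proof -
    have "((\<lambda>p::real ^ 'n. s * p $ j + c) has_derivative (\<lambda>v. s * v $ j)) (at p)"
      by (auto intro!: derivative_eq_intros bounded_linear.has_derivative[OF bounded_linear_vec_nth])
    from has_derivative_compose[OF this flat_exp_has_derivative[of P "s * p $ j + c", unfolded has_field_derivative_def]]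
    show ?thesis by (intro bounded_linear.has_derivative[OF bounded_linear_of_real])
  qed
  have p: "partial i (\<lambda>p::real ^ 'n. e * complex_of_real (flat_exp P (s * p $ j + c))) =
     (\<lambda>p. (e * of_real (s * axis i 1 $ j)) * complex_of_real (flat_exp ([:0, 0, 1:] * (P - pderiv P)) (s * p $ j + c)))" for i P e
    using partial_eqI[OF has_derivative_mult_right[OF d]] by (simp add: fun_eq_iff mult_ac)
  have "\<exists>e Q. partials is (\<lambda>p::real ^ 'n. complex_of_real (flat_exp P (s * p $ j + c))) = (\<lambda>p. e * complex_of_real (flat_exp Q (s * p $ j + c)))" for "is"
  proof (induction "is")
    case Nil
    show ?case by (intro exI[of _ 1] exI[of _ P]) simp
  next
    case (Cons i "is")
    then show ?case unfolding partials_Cons using p by metis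
  qed
  moreover have "(\<lambda>p::real ^ 'n. e * complex_of_real (flat_exp Q (s * p $ j + c))) differentiable (at p)" for e Q p
    using has_derivative_mult_right[OF d] unfolding differentiable_def by blast
  ultimately show ?thesis unfolding smooth_def by metis
qed

text \<open>Positive exactly on the open cube of half-side \<open>\<delta>\<close> around
  \<open>q\<close>, for \<open>\<delta> > 0\<close>: each coordinate contributes one factor per
  face. The product form reduces smoothness to one variable.\<close>

definition bump :: "real ^ 'n::finite \<Rightarrow> real \<Rightarrow> real ^ 'n \<Rightarrow> real" where
  "bump q \<delta> p = (\<Prod>j\<in>UNIV. flat_exp 1 (p $ j + (\<delta> - q $ j)) * flat_exp 1 (\<delta> + q $ j - p $ j))"

lemma flat_exp_1: "flat_exp 1 x = (if x > 0 then exp (- (1 / x)) else 0)"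
  unfolding flat_exp_def by simp

lemma bump_nonneg: "bump q \<delta> p \<ge> 0"
  unfolding bump_def by (intro prod_nonneg) (simp add: flat_exp_1)

lemma bump_zero: "\<not> \<bar>p $ j - q $ j\<bar> < \<delta> \<Longrightarrow> bump q \<delta> p = 0"
proof -
  assume "\<not> \<bar>p $ j - q $ j\<bar> < \<delta>"
  then have "flat_exp 1 (p $ j + (\<delta> - q $ j)) * flat_exp 1 (\<delta> + q $ j - p $ j) = 0" by (auto simp: flat_exp_1)
  then show ?thesis unfolding bump_def by (intro prod_zero bexI[of _ j]) auto
qed

lemma smooth_prod:
  assumes "finite I" "\<And>j. j \<in> I \<Longrightarrow> smooth (f j)"
  shows "smooth (\<lambda>p. \<Prod>j\<in>I. f j p)"
  using assms by (induction I rule: finite_induct) (auto intro: smooth_const smooth_mult)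

lemma smooth_bump: "smooth (\<lambda>p. complex_of_real (bump q \<delta> p))"
proof -
  have "smooth (\<lambda>p. \<Prod>j\<in>UNIV. complex_of_real (flat_exp 1 (1 * p $ j + (\<delta> - q $ j))) * complex_of_real (flat_exp 1 (- 1 * p $ j + (\<delta> + q $ j))))"
    by (intro smooth_prod smooth_mult smooth_flat_exp) auto
  then show ?thesis unfolding bump_def by (simp add: algebra_simps)
qed

lemma bump_support: "support (\<lambda>p. complex_of_real (bump q \<delta> p)) \<subseteq> cbox (q - (\<chi> j. \<delta>)) (q + (\<chi> j. \<delta>))"
  unfolding support_def
proof (intro closure_minimal closed_cbox subsetI)
  fix p assume "p \<in> {p. complex_of_real (bump q \<delta> p) \<noteq> 0}"
  then have "\<bar>p $ j - q $ j\<bar> < \<delta>" for j using bump_zero[of p j q \<delta>] by auto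
  then show "p \<in> cbox (q - (\<chi> j. \<delta>)) (q + (\<chi> j. \<delta>))"
    unfolding mem_box_cart by (auto simp: abs_less_iff) (smt (verit))+
qed

lemma bump_integral_pos:
  fixes q :: "real ^ 'n::finite"
  assumes d: "\<delta> > 0"
  shows "integrable lborel (bump q \<delta>)" "(LINT p|lborel. bump q \<delta> p) > 0"
proof -
  let ?B = "cbox (q - (\<chi> j. \<delta>)) (q + (\<chi> j. \<delta>))" and ?b = "cbox (q - (\<chi> j. \<delta> / 2)) (q + (\<chi> j. \<delta> / 2))"
  have e: "bump q \<delta> = (\<lambda>p. indicator ?B p *\<^sub>R bump q \<delta> p)"
    using bump_support[of q \<delta>] not_support_zero[of _ "\<lambda>p. complex_of_real (bump q \<delta> p)"] by (auto simp: fun_eq_iff indicator_def)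
  have c: "continuous_on S (bump q \<delta>)" for S
    using continuous_on_Re[OF smooth_continuous[OF smooth_bump[of q \<delta>]], of S] by simp
  show i: "integrable lborel (bump q \<delta>)" by (subst e) (intro borel_integrable_compact compact_cbox c)
  \<comment> \<open>On the cube of half the size both arguments of \<open>flat_exp\<close> are at
    least \<open>\<delta> / 2\<close>, so \<open>m\<close> bounds the product from below.\<close>
  define m where "m = (\<Prod>j\<in>(UNIV :: 'n set). exp (- (2 / \<delta>)) * exp (- (2 / \<delta>)))"
  have m: "m > 0" unfolding m_def by (intro prod_pos) simp
  have ge: "indicator ?b p *\<^sub>R m \<le> bump q \<delta> p" for p
  proof (cases "p \<in> ?b")
    case True
    have "m \<le> bump q \<delta> p" unfolding m_def bump_def
    proof (intro prod_mono conjI mult_mono)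
      fix j :: 'n
      have j: "q $ j - \<delta> / 2 \<le> p $ j" "p $ j \<le> q $ j + \<delta> / 2" using True unfolding mem_box_cart by auto
      have *: "exp (- (2 / \<delta>)) \<le> flat_exp 1 y" if "y \<ge> \<delta> / 2" for y
      proof -
        have "1 / y \<le> 2 / \<delta>" using that d by (simp add: field_simps)
        then show ?thesis using that d by (simp add: flat_exp_1)
      qed
      show "exp (- (2 / \<delta>)) \<le> flat_exp 1 (p $ j + (\<delta> - q $ j))" "exp (- (2 / \<delta>)) \<le> flat_exp 1 (\<delta> + q $ j - p $ j)"
        using j by (auto intro!: * simp: field_simps)
    qed (auto simp: flat_exp_1)
    then show ?thesis using True by simp
  qed (simp add: bump_nonneg)
  have "0 < measure lborel ?b" by (rule content_pos_lt) (use d in \<open>auto simp: Basis_vec_def inner_axis\<close>)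
  then have "0 < measure lborel ?b *\<^sub>R m" using m by simp
  also have "\<dots> = (LINT p|lborel. indicator ?b p *\<^sub>R m)" by simp
  also have "\<dots> \<le> (LINT p|lborel. bump q \<delta> p)"
    by (intro integral_mono i ge borel_integrable_compact compact_cbox continuous_on_const)
  finally show "(LINT p|lborel. bump q \<delta> p) > 0" .
qed

text \<open>Near \<open>q\<close> the function stays close to \<open>c = h q\<close>, and
  multiplication by \<open>cnj c\<close> makes its real part at least half the square of
  \<open>norm c\<close>. Integration against a bump is then strictly positive.\<close>

lemma distr_of_zero_imp_zero:
  fixes h :: "real ^ 'n::finite \<Rightarrow> complex"
  assumes U: "open U" and h: "continuous_on U h" and z: "\<And>\<phi>. \<phi> \<in> test_functions U \<Longrightarrow> distr_of U h \<phi> = 0" and q: "q \<in> U"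
  shows "h q = 0"
proof (rule ccontr)
  assume nz: "h q \<noteq> 0"
  define c where "c = h q"
  obtain e1 where e1: "e1 > 0" "ball q e1 \<subseteq> U" using U q open_contains_ball by blast
  obtain e2 where e2: "e2 > 0" "\<And>p. p \<in> U \<Longrightarrow> dist p q < e2 \<Longrightarrow> dist (h p) c < norm c / 2"
    using h q nz unfolding continuous_on_iff c_def by (metis half_gt_zero zero_less_norm_iff)
  define N where "N = real CARD('n)"
  have N: "N > 0" unfolding N_def by simp
  \<comment> \<open>The Euclidean norm is bounded by the sum of the coordinates; division by twice
    the dimension puts the cube inside the ball.\<close>
  define \<delta> where "\<delta> = min e1 e2 / (2 * N)"
  have d: "\<delta> > 0" unfolding \<delta>_def using e1 e2 N by simp
  let ?B = "cbox (q - (\<chi> j. \<delta>)) (q + (\<chi> j. \<delta>))"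
  have box: "dist p q < min e1 e2" if "p \<in> ?B" for p
  proof -
    have "\<bar>(p - q) $ j\<bar> \<le> \<delta>" for j
    proof -
      have "q $ j - \<delta> \<le> p $ j" "p $ j \<le> q $ j + \<delta>" using that unfolding mem_box_cart by auto
      then show ?thesis by (simp add: abs_le_iff)
    qed
    then have "norm (p - q) \<le> (\<Sum>j\<in>(UNIV :: 'n set). \<delta>)" by (intro order_trans[OF norm_le_l1_cart] sum_mono)
    also have "\<dots> = min e1 e2 / 2" unfolding \<delta>_def using N by (simp add: N_def)
    also have "\<dots> < min e1 e2"
    proof -
      have "min e1 e2 > 0" using e1 e2 by simp
      then show ?thesis by linarith
    qed
    finally show ?thesis by (simp add: dist_norm)
  qed
  have BU: "?B \<subseteq> U" using box e1 by (auto simp: dist_commute subset_iff mem_ball)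
  have t: "(\<lambda>p. complex_of_real (bump q \<delta> p)) \<in> test_functions U"
    unfolding test_functions_def using bump_support[of q \<delta>] BU smooth_bump
    by (auto intro: compact_Int_closed) (metis (no_types, lifting) closed_closure compact_Int_closed compact_cbox inf.absorb2 support_def)
  let ?f = "\<lambda>p. cnj c * (indicator U p *\<^sub>R (h p * complex_of_real (bump q \<delta> p)))"
  have i: "integrable lborel ?f" by (intro integrable_mult_right test_integrable(1)[OF t h])
  have "(LINT p|lborel. ?f p) = 0"
    using z[OF t] unfolding distr_of_def set_lebesgue_integral_def integral_mult_right_zero by (simp only: mult_zero_right)
  then have "(LINT p|lborel. Re (?f p)) = 0" unfolding integral_Re[OF i] by (simp only: zero_complex.sel)
  moreover have "(LINT p|lborel. (norm c)\<^sup>2 / 2 * bump q \<delta> p) \<le> (LINT p|lborel. Re (?f p))"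
  proof (rule integral_mono)
    show "integrable lborel (\<lambda>p. (norm c)\<^sup>2 / 2 * bump q \<delta> p)" by (intro integrable_mult_right bump_integral_pos(1) d)
    show "integrable lborel (\<lambda>p. Re (?f p))" using i by (rule integrable_Re)
    fix p
    show "(norm c)\<^sup>2 / 2 * bump q \<delta> p \<le> Re (?f p)"
    proof (cases "p \<in> ?B")
      case False
      then have "bump q \<delta> p = 0" using bump_support[of q \<delta>] not_support_zero[of p "\<lambda>p. complex_of_real (bump q \<delta> p)"] by auto
      then show ?thesis by simp
    next
      case True
      then have pU: "p \<in> U" using BU by blast
      have "norm (h p - c) \<le> norm c / 2" using e2(2)[OF pU] box[OF True] by (simp add: dist_norm)
      then have "norm (cnj c * (h p - c)) \<le> norm c * (norm c / 2)" unfolding norm_mult complex_mod_cnj by (rule mult_left_mono) simp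
      then have "Re (cnj c * (h p - c)) \<ge> - (norm c * (norm c / 2))"
        using abs_Re_le_cmod[of "cnj c * (h p - c)"] by linarith
      moreover have "Re (cnj c * c) = (norm c)\<^sup>2" unfolding cmod_power2 by (simp add: power2_eq_square)
      moreover have "cnj c * h p = cnj c * (h p - c) + cnj c * c" by (simp add: algebra_simps)
      ultimately have ge: "Re (cnj c * h p) \<ge> (norm c)\<^sup>2 / 2" by (simp add: power2_eq_square)
      have "?f p = (cnj c * h p) * of_real (bump q \<delta> p)" using pU by simp
      then have "Re (?f p) = Re (cnj c * h p) * bump q \<delta> p" by simp
      then show ?thesis using mult_right_mono[OF ge bump_nonneg[of q \<delta> p]] by simp
    qed
  qed
  moreover have "0 < (norm c)\<^sup>2 / 2 * (LINT p|lborel. bump q \<delta> p)"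
    using bump_integral_pos(2)[OF d, of q] nz unfolding c_def by simp
  ultimately show False by simp
qed

section \<open>Real-analytic functions\<close>

text \<open>Absolute convergence at the single point \<open>q0\<close>, displaced from
  \<open>p\<close> by \<rho> in every coordinate, majorises the series on the ball of radius \<rho>;
  the sum is a uniform limit of polynomials.\<close>

lemma real_analytic_on_isCont:
  fixes g :: "real ^ 'n::finite \<Rightarrow> complex"
  assumes "real_analytic_on g U" "p \<in> U"
  shows "isCont g p"
proof -
  obtain r a where r: "r > 0" and a: "\<And>q. q \<in> ball p r \<Longrightarrow>
    ((\<lambda>\<alpha>. a \<alpha> * of_real (\<Prod>i\<in>UNIV. (q $ i - p $ i) ^ \<alpha> i)) has_sum g q) UNIV"
    using assms unfolding real_analytic_on_def by blast
  define N where "N = real CARD('n)"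
  have N: "N \<ge> 1" unfolding N_def by (simp add: Suc_leI)
  define \<rho> where "\<rho> = r / (2 * N)"
  have rho: "\<rho> > 0" "\<rho> < r" unfolding \<rho>_def using r N by (auto simp: field_simps)
  define q0 where "q0 = p + (\<chi> j. \<rho>)"
  have "norm (\<chi> j::'n. \<rho>) \<le> (\<Sum>j\<in>(UNIV :: 'n set). \<rho>)" using rho by (intro order_trans[OF norm_le_l1_cart] sum_mono) simp
  also have "\<dots> = r / 2" unfolding \<rho>_def using N by (simp add: N_def)
  finally have "q0 \<in> ball p r" unfolding q0_def using r by (simp add: dist_norm)
  from a[OF this] have "(\<lambda>\<alpha>. a \<alpha> * of_real (\<Prod>i\<in>UNIV. \<rho> ^ \<alpha> i)) summable_on UNIV"
    unfolding q0_def by (auto dest: has_sum_imp_summable)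
  then have s: "(\<lambda>\<alpha>. norm (a \<alpha> * of_real (\<Prod>i\<in>UNIV. \<rho> ^ \<alpha> i))) summable_on UNIV"
    by (simp only: summable_on_iff_abs_summable_on_complex)
  have bd: "norm (a \<alpha> * of_real (\<Prod>i\<in>UNIV. (q $ i - p $ i) ^ \<alpha> i)) \<le> norm (a \<alpha> * of_real (\<Prod>i\<in>UNIV. \<rho> ^ \<alpha> i))"
    if "q \<in> cball p \<rho>" for \<alpha> q
  proof -
    have "\<bar>q $ i - p $ i\<bar> \<le> \<rho>" for i
      using that component_le_norm_cart[of "q - p" i] by (simp add: dist_norm norm_minus_commute)
    then have "\<bar>\<Prod>i\<in>UNIV. (q $ i - p $ i) ^ \<alpha> i\<bar> \<le> (\<Prod>i\<in>UNIV. \<rho> ^ \<alpha> i)"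
      unfolding abs_prod power_abs by (intro prod_mono conjI power_mono) auto
    also have "\<dots> \<le> \<bar>\<Prod>i\<in>UNIV. \<rho> ^ \<alpha> i\<bar>" by simp
    finally show ?thesis unfolding norm_mult norm_of_real by (intro mult_left_mono) auto
  qed
  have "uniform_limit (cball p \<rho>) (\<lambda>F q. \<Sum>\<alpha>\<in>F. a \<alpha> * of_real (\<Prod>i\<in>UNIV. (q $ i - p $ i) ^ \<alpha> i))
     (\<lambda>q. \<Sum>\<^sub>\<infinity>\<alpha>. a \<alpha> * of_real (\<Prod>i\<in>UNIV. (q $ i - p $ i) ^ \<alpha> i)) (finite_subsets_at_top UNIV)"
    by (rule Weierstrass_m_test_general[OF bd s])
  then have "continuous_on (cball p \<rho>) (\<lambda>q. \<Sum>\<^sub>\<infinity>\<alpha>. a \<alpha> * of_real (\<Prod>i\<in>UNIV. (q $ i - p $ i) ^ \<alpha> i))"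
    by (rule uniform_limit_theorem[rotated]) (auto intro!: always_eventually continuous_intros)
  moreover have "(\<Sum>\<^sub>\<infinity>\<alpha>. a \<alpha> * of_real (\<Prod>i\<in>UNIV. (q $ i - p $ i) ^ \<alpha> i)) = g q" if "q \<in> cball p \<rho>" for q
    by (rule infsumI[OF a]) (use that rho in auto)
  ultimately have "continuous_on (cball p \<rho>) g" by (rule continuous_on_eq)
  then show ?thesis using rho by (intro continuous_on_interior[of "cball p \<rho>"]) (auto simp: mem_interior_cball)
qed

section \<open>Failure of analyticity\<close>

lemma prod_UNIV_3: "prod f (UNIV :: 3 set) = f 1 * f 2 * f 3"
  unfolding UNIV_3 by (simp add: ac_simps)

text \<open>On the plane \<open>y = 0\<close> only multi-indices with second entry 0 survive, thanks
  to \<open>0 ^ 0 = 1\<close>. The remaining unconditional sum is grouped by powers of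
  \<open>x\<close>, so that \<open>S 0\<close> is the trace on \<open>x = 0\<close> and
  \<open>S 1\<close> the \<open>x\<close>-derivative there, both power series in
  \<open>t\<close>.\<close>

lemma analytic_slice:
  fixes g :: "real ^ 3 \<Rightarrow> complex"
  assumes "real_analytic_on g U" "0 \<in> U"
  obtains r b S where "r > 0"
    "\<And>i t. \<bar>t\<bar> < r \<Longrightarrow> (\<lambda>j. b i j * complex_of_real t ^ j) sums S i t"
    "\<And>x t. \<bar>x\<bar> < r \<Longrightarrow> \<bar>t\<bar> < r \<Longrightarrow> (\<lambda>i. S i t * complex_of_real x ^ i) sums g (vector [x, 0, t])"
proof -
  obtain R a where R: "R > 0" and a: "\<And>q. q \<in> ball 0 R \<Longrightarrow>
    ((\<lambda>\<alpha>. a \<alpha> * of_real (\<Prod>i\<in>UNIV. (q $ i - (0 :: real ^ 3) $ i) ^ \<alpha> i)) has_sum g q) UNIV"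
    using assms unfolding real_analytic_on_def by blast
  define ix :: "nat \<times> nat \<Rightarrow> 3 \<Rightarrow> nat" where "ix = (\<lambda>(i, j) c. if c = 1 then i else if c = 3 then j else 0)"
  have ix: "ix (i, j) 1 = i" "ix (i, j) 3 = j" "ix (i, j) 2 = 0" for i j by (simp_all add: ix_def)
  have inj: "inj_on ix (UNIV \<times> UNIV)"
  proof (rule inj_onI)
    fix p q :: "nat \<times> nat" assume e: "ix p = ix q"
    show "p = q" using fun_cong[OF e, of 1] fun_cong[OF e, of 3] by (cases p; cases q) (simp add: ix)
  qed
  have img: "\<alpha> \<in> ix ` (UNIV \<times> UNIV)" if "\<alpha> 2 = 0" for \<alpha>
  proof -
    have "\<alpha> = ix (\<alpha> 1, \<alpha> 3)"
    proof
      fix c :: 3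
      show "\<alpha> c = ix (\<alpha> 1, \<alpha> 3) c" using exhaust_3[of c] that by (auto simp: ix)
    qed
    then show ?thesis by blast
  qed
  define r where "r = R / 2"
  have r: "r > 0" unfolding r_def using R by simp
  define b where "b i j = a (ix (i, j))" for i j
  have hs: "((\<lambda>(i, j). b i j * of_real x ^ i * of_real t ^ j) has_sum g (vector [x, 0, t])) (UNIV \<times> UNIV)"
    if x: "\<bar>x\<bar> < r" and t: "\<bar>t\<bar> < r" for x t
  proof -
    have "norm (vector [x, 0, t] :: real ^ 3) \<le> \<bar>x\<bar> + \<bar>t\<bar>"
      using norm_le_l1_cart[of "vector [x, 0, t] :: real ^ 3"] unfolding sum_3 vector_3 by simp
    then have "vector [x, 0, t] \<in> ball (0 :: real ^ 3) R" using x t unfolding r_def by simp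
    note h = a[OF this]
    have e: "(\<Prod>i\<in>UNIV. ((vector [x, 0, t] :: real ^ 3) $ i - 0 $ i) ^ \<alpha> i) = x ^ \<alpha> 1 * 0 ^ \<alpha> 2 * t ^ \<alpha> 3" for \<alpha> :: "3 \<Rightarrow> nat"
      unfolding prod_UNIV_3 vector_3 by simp
    have "((\<lambda>\<alpha>. a \<alpha> * of_real (x ^ \<alpha> 1 * 0 ^ \<alpha> 2 * t ^ \<alpha> 3)) has_sum g (vector [x, 0, t])) (ix ` (UNIV \<times> UNIV))"
    proof (rule has_sum_cong_neutral[THEN iffD1, OF _ _ _ h[unfolded e]])
      fix \<alpha> :: "3 \<Rightarrow> nat" assume "\<alpha> \<in> UNIV - ix ` (UNIV \<times> UNIV)"
      then have "\<alpha> 2 \<noteq> 0" using img by blast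
      then show "a \<alpha> * of_real (x ^ \<alpha> 1 * 0 ^ \<alpha> 2 * t ^ \<alpha> 3) = 0" by simp
    qed auto
    then have "((\<lambda>\<alpha>. a \<alpha> * of_real (x ^ \<alpha> 1 * 0 ^ \<alpha> 2 * t ^ \<alpha> 3)) \<circ> ix has_sum g (vector [x, 0, t])) (UNIV \<times> UNIV)"
      by (simp only: has_sum_reindex[OF inj])
    moreover have "(\<lambda>\<alpha>. a \<alpha> * of_real (x ^ \<alpha> 1 * 0 ^ \<alpha> 2 * t ^ \<alpha> 3)) \<circ> ix = (\<lambda>(i, j). b i j * of_real x ^ i * of_real t ^ j)"
      by (auto simp: fun_eq_iff ix b_def)
    ultimately show ?thesis by (simp only:)
  qed
  \<comment> \<open>A nonzero value of \<open>x\<close>: its powers can be divided out, which gives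
    convergence of each inner series in \<open>t\<close>.\<close>
  define \<rho> where "\<rho> = r / 2"
  have \<rho>: "\<rho> > 0" "\<bar>\<rho>\<bar> < r" unfolding \<rho>_def using r by auto
  define S where "S i t = (\<Sum>\<^sub>\<infinity>j. b i j * of_real t ^ j)" for i t
  have sm: "(\<lambda>j. b i j * complex_of_real t ^ j) summable_on UNIV" if t: "\<bar>t\<bar> < r" for i t
  proof -
    have "(\<lambda>(i, j). b i j * of_real \<rho> ^ i * of_real t ^ j) summable_on (UNIV \<times> UNIV)"
      using hs[OF \<rho>(2) t] by (rule has_sum_imp_summable)
    then have "(\<lambda>(i, j). b i j * of_real \<rho> ^ i * of_real t ^ j) summable_on (Pair i ` UNIV)"
      by (rule summable_on_subset_banach) auto
    then have "(\<lambda>j. b i j * of_real \<rho> ^ i * of_real t ^ j) summable_on UNIV"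
      by (subst (asm) summable_on_reindex) (auto simp: inj_on_def comp_def)
    then have "(\<lambda>j. (1 / of_real \<rho> ^ i) * (b i j * of_real \<rho> ^ i * of_real t ^ j)) summable_on UNIV"
      by (rule summable_on_cmult_right)
    then show ?thesis using \<rho>(1) by simp
  qed
  show thesis
  proof (rule that[of r b S])
    show "r > 0" by (rule r)
    show "(\<lambda>j. b i j * complex_of_real t ^ j) sums S i t" if "\<bar>t\<bar> < r" for i t
      using has_sum_imp_sums[OF has_sum_infsum[OF sm[OF that]]] unfolding S_def .
    show "(\<lambda>i. S i t * complex_of_real x ^ i) sums g (vector [x, 0, t])" if x: "\<bar>x\<bar> < r" and t: "\<bar>t\<bar> < r" for x t
    proof (rule has_sum_imp_sums, rule has_sum_SigmaD[OF hs[OF x t]])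
      fix i
      have "((\<lambda>j. of_real x ^ i * (b i j * of_real t ^ j)) has_sum (of_real x ^ i * S i t)) UNIV"
        unfolding S_def by (intro has_sum_cmult_right has_sum_infsum sm t)
      then show "((\<lambda>y. case (i, y) of (i, j) \<Rightarrow> b i j * of_real x ^ i * of_real t ^ j) has_sum S i t * of_real x ^ i) UNIV"
        by (simp add: mult_ac)
    qed
  qed
qed

section \<open>Lacunary series that are not analytic\<close>

lemma power_le_fact_exp: "y \<ge> 0 \<Longrightarrow> y ^ m \<le> fact m * exp (y :: real)"
proof -
  assume y: "y \<ge> 0"
  have "(\<Sum>n\<in>{m}. y ^ n /\<^sub>R fact n) \<le> (\<Sum>n. y ^ n /\<^sub>R fact n)"
    by (rule sum_le_suminf[OF summable_exp_generic]) (use y in auto)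
  then show ?thesis unfolding exp_def by (simp add: field_simps)
qed

text \<open>Half of the exponent \<open>M * n\<close> absorbs the power of \<open>n\<close>; the
  other half leaves a geometric series.\<close>

lemma summable_power_exp:
  fixes M :: real
  assumes M: "M > 0"
  shows "summable (\<lambda>n. real n ^ m * exp (- (M * real n ^ Suc k)))"
proof (rule summable_comparison_test'[where N = 0])
  define C where "C = fact m * (2 / M) ^ m"
  have "summable (\<lambda>n. C * exp (- (M / 2)) ^ n)" using M by (intro summable_mult summable_geometric) simp
  then show "summable (\<lambda>n. C * exp (- (M / 2)) ^ n)" .
  fix n
  have "(M / 2 * real n) ^ m \<le> fact m * exp (M / 2 * real n)" using M by (intro power_le_fact_exp) simp
  then have 1: "real n ^ m \<le> C * exp (M / 2 * real n)"
    unfolding C_def using M by (simp add: field_simps power_mult_distrib power_divide)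
  have "real n \<le> real n ^ Suc k"
  proof (cases n)
    case (Suc n')
    then have "real n * 1 \<le> real n * real n ^ k" by (intro mult_left_mono one_le_power) auto
    then show ?thesis by simp
  qed simp
  then have 2: "exp (- (M * real n ^ Suc k)) \<le> exp (- (M * real n))" using M by simp
  have "real n ^ m * exp (- (M * real n ^ Suc k)) \<le> (C * exp (M / 2 * real n)) * exp (- (M * real n))"
    using M by (intro mult_mono 1 2) (auto simp: C_def)
  also have "\<dots> = C * exp (- (M / 2)) ^ n" by (simp add: mult.assoc mult_exp_exp exp_of_nat_mult[symmetric])
  finally show "norm (real n ^ m * exp (- (M * real n ^ Suc k))) \<le> C * exp (- (M / 2)) ^ n" by simp
qed

lemma series_has_vector_derivative:
  fixes F F' :: "nat \<Rightarrow> real \<Rightarrow> complex"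
  assumes d: "\<And>n t. (F n has_vector_derivative F' n t) (at t)"
    and b: "\<And>n t. norm (F' n t) \<le> b n" and s: "summable b" and F: "\<And>t. summable (\<lambda>n. F n t)"
  shows "((\<lambda>t. \<Sum>n. F n t) has_vector_derivative (\<Sum>n. F' n t)) (at t)"
proof -
  have sF: "summable (\<lambda>n. F' n t)" for t by (rule summable_comparison_test'[OF s]) (use b in auto)
  have u: "uniform_limit UNIV (\<lambda>n t. \<Sum>i<n. F' i t) (\<lambda>t. \<Sum>i. F' i t) sequentially"
    by (rule Weierstrass_m_test[OF b s])
  have "\<exists>g. \<forall>x\<in>UNIV. (\<lambda>n. F n x) sums g x \<and> (g has_derivative (\<lambda>h. h *\<^sub>R (\<Sum>i. F' i x))) (at x within UNIV)"
  proof (rule has_derivative_series[where f' = "\<lambda>n x h. h *\<^sub>R F' n x"])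
    show "(F n has_derivative (\<lambda>h. h *\<^sub>R F' n x)) (at x within UNIV)" for n x
      using d[of n x] unfolding has_vector_derivative_def by simp
    show "(\<lambda>n. F n 0) sums (\<Sum>n. F n 0)" using F by (rule summable_sums)
    fix e :: real assume e: "e > 0"
    show "\<forall>\<^sub>F n in sequentially. \<forall>x\<in>UNIV. \<forall>h. norm ((\<Sum>i<n. h *\<^sub>R F' i x) - h *\<^sub>R (\<Sum>i. F' i x)) \<le> e * norm h"
      using uniform_limitD[OF u e]
    proof eventually_elim
      case (elim n)
      show ?case
      proof (intro ballI allI)
        fix x h :: real
        have "norm ((\<Sum>i<n. h *\<^sub>R F' i x) - h *\<^sub>R (\<Sum>i. F' i x)) = norm h * norm ((\<Sum>i<n. F' i x) - (\<Sum>i. F' i x))"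
          by (simp flip: scaleR_sum_right scaleR_diff_right)
        also have "\<dots> \<le> norm h * e" using elim by (intro mult_left_mono) (auto simp: dist_norm less_imp_le)
        finally show "norm ((\<Sum>i<n. h *\<^sub>R F' i x) - h *\<^sub>R (\<Sum>i. F' i x)) \<le> e * norm h" by (simp add: mult.commute)
      qed
    qed
  qed auto
  then obtain g where g: "\<And>x. (\<lambda>n. F n x) sums g x" "\<And>x. (g has_derivative (\<lambda>h. h *\<^sub>R (\<Sum>i. F' i x))) (at x)" by auto
  have "(\<lambda>t. \<Sum>n. F n t) = g" using g(1) by (auto simp: sums_iff)
  then show ?thesis using g(2) unfolding has_vector_derivative_def by simp
qed

lemma iterated_diffs: "fact m * (diffs ^^ j) b m = fact (m + j) * (b (m + j) :: complex)"
proof (induction j arbitrary: m)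
  case (Suc j)
  have "fact m * (diffs ^^ Suc j) b m = fact (Suc m) * (diffs ^^ j) b (Suc m)"
    by (simp add: diffs_def algebra_simps)
  then show ?case unfolding Suc by simp
qed simp

text \<open>The identity is known on a real interval only. Convergence in the complex disc, required
  for termwise differentiation, follows by comparison with a real point between
  \<open>norm z\<close> and \<open>r\<close>.\<close>

lemma power_series_deriv_eq:
  fixes b :: "nat \<Rightarrow> complex"
  assumes s: "\<And>t. \<bar>t\<bar> < r \<Longrightarrow> (\<lambda>m. b m * complex_of_real t ^ m) sums G t"
    and G: "(G has_vector_derivative D) (at t)" and t: "\<bar>t\<bar> < r"
  shows "(\<lambda>m. diffs b m * complex_of_real t ^ m) sums D"
proof -
  have sm: "summable (\<lambda>m. b m * z ^ m)" if z: "norm z < r" for z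
  proof -
    obtain s' where s': "norm z < s'" "s' < r" using dense[OF z] by blast
    have "0 \<le> s'" using s'(1) norm_ge_zero[of z] by linarith
    then show ?thesis using sums_summable[OF s[of s']] s' by (intro powser_inside[of b "of_real s'" z]) auto
  qed
  have nt: "norm (complex_of_real t) < r" using t by simp
  have "((\<lambda>z. \<Sum>m. b m * z ^ m) has_field_derivative (\<Sum>m. diffs b m * of_real t ^ m)) (at (of_real t))"
    by (rule termdiffs_strong'[OF sm nt])
  from has_vector_derivative_real_field[OF this]
  have "((\<lambda>t. \<Sum>m. b m * complex_of_real t ^ m) has_vector_derivative (\<Sum>m. diffs b m * of_real t ^ m)) (at t)" .
  then have "(G has_vector_derivative (\<Sum>m. diffs b m * of_real t ^ m)) (at t)"
  proof (rule has_vector_derivative_transform_within_open[where S = "{-r<..<r}"])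
    show "(\<Sum>m. b m * complex_of_real t ^ m) = G t" if "t \<in> {-r<..<r}" for t
      using s[of t] that by (simp add: sums_iff abs_less_iff)
  qed (use t in auto)
  then have "(\<Sum>m. diffs b m * of_real t ^ m) = D" using G vector_derivative_unique_at by blast
  moreover have "summable (\<lambda>m. diffs b m * of_real t ^ m)" by (rule termdiff_converges[OF nt sm])
  ultimately show ?thesis by (simp add: sums_iff)
qed

text \<open>At \<open>t = 0\<close> all terms of the \<open>j\<close>-th derivative carry the same
  phase, so the derivative is at least as large as any single term. For \<open>j = n ^ Suc k\<close>
  the damping is only \<open>exp (- M) ^ j\<close>, while \<open>n ^ Suc l \<ge> n * j\<close>
  because \<open>k < l\<close>; so the term is at least \<open>(exp (- M) * n * j) ^ j\<close>. An
  analytic function allows at most a constant times \<open>fact j / r1 ^ j\<close>, and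
  \<open>n\<close> is arbitrary. The exponent \<open>e\<close> is 0 for the trace and 1 for the
  \<open>x\<close>-derivative of the superposition.\<close>

lemma lacunary_not_power_series:
  fixes \<kappa> :: complex and b :: "nat \<Rightarrow> complex"
  assumes \<kappa>: "\<kappa> \<noteq> 0" and kl: "k < l" and M: "M > 0" and r: "r > 0"
    and s: "\<And>t. \<bar>t\<bar> < r \<Longrightarrow> (\<lambda>j. b j * complex_of_real t ^ j) sums
      (\<kappa> * (\<Sum>n. of_real (real n ^ e * exp (- (M * real n ^ Suc k))) * exp (\<i> * of_real (real n ^ Suc l * t))))"
  shows False
proof -
  \<comment> \<open>The absolute value at \<open>t = 0\<close> of the \<open>j\<close>-th derivative
    of the \<open>n\<close>-th term.\<close>
  define v where "v j n = real n ^ e * exp (- (M * real n ^ Suc k)) * (real n ^ Suc l) ^ j" for j n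
  define c where "c j n t = \<i> ^ j * of_real (v j n) * exp (\<i> * of_real (real n ^ Suc l * t))" for j n t
  define \<Psi> where "\<Psi> j t = (\<Sum>n. c j n t)" for j t
  have v0: "v j n \<ge> 0" for j n unfolding v_def by simp
  have sv: "summable (v j)" for j
  proof -
    have "v j = (\<lambda>n. real n ^ (e + Suc l * j) * exp (- (M * real n ^ Suc k)))"
      unfolding v_def power_add power_mult by (simp add: fun_eq_iff mult_ac)
    then show ?thesis using summable_power_exp[OF M] by simp
  qed
  have cn: "norm (c j n t) \<le> v j n" for j n t
    unfolding c_def norm_mult norm_power norm_of_real norm_exp_i_times using v0[of j n] by simp
  have sc: "summable (\<lambda>n. c j n t)" for j t by (rule summable_comparison_test'[OF sv[of j]]) (use cn in auto)
  have d: "(\<Psi> j has_vector_derivative \<Psi> (Suc j) t) (at t)" for j t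
    unfolding \<Psi>_def[abs_def]
  proof (rule series_has_vector_derivative[OF _ cn sv sc])
    fix n t
    have "((\<lambda>z. \<i> ^ j * of_real (v j n) * exp (\<i> * (of_real (real n ^ Suc l) * z))) has_field_derivative c (Suc j) n t) (at (of_real t))"
      by (auto intro!: derivative_eq_intros simp: c_def v_def algebra_simps)
    from has_vector_derivative_real_field[OF this]
    show "(c j n has_vector_derivative c (Suc j) n t) (at t)" unfolding c_def[of j, abs_def] by simp
  qed
  have ps: "(\<lambda>m. (diffs ^^ j) b m * complex_of_real t ^ m) sums (\<kappa> * \<Psi> j t)" if "\<bar>t\<bar> < r" for j t
    using that
  proof (induction j arbitrary: t)
    case 0
    then show ?case using s[OF 0] by (simp add: \<Psi>_def c_def v_def)
  next
    case (Suc j)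
    have "(\<lambda>m. diffs ((diffs ^^ j) b) m * complex_of_real t ^ m) sums (\<kappa> * \<Psi> (Suc j) t)"
      by (rule power_series_deriv_eq[OF Suc.IH has_vector_derivative_mult_right[OF d] Suc.prems])
    then show ?case by simp
  qed
  have b: "fact j * b j = \<kappa> * \<Psi> j 0" for j
  proof -
    have "(diffs ^^ j) b 0 = \<kappa> * \<Psi> j 0" using ps[of 0 j] r sums_unique2[OF powser_sums_zero] by fastforce
    then show ?thesis using iterated_diffs[of 0 j b] by simp
  qed
  have Psi: "norm (\<Psi> j 0) = (\<Sum>n. v j n)" for j
  proof -
    have "\<Psi> j 0 = \<i> ^ j * (\<Sum>n. of_real (v j n))"
      unfolding \<Psi>_def c_def using suminf_mult[OF summable_of_real[OF sv[of j]], of "\<i> ^ j"] by simp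
    also have "(\<Sum>n. complex_of_real (v j n)) = of_real (\<Sum>n. v j n)" by (rule suminf_of_real[symmetric, OF sv])
    finally show ?thesis using suminf_nonneg[OF sv v0, of j] by (simp add: norm_mult norm_power)
  qed
  have vb: "norm \<kappa> * v j n \<le> fact j * norm (b j)" for j n
  proof -
    have "v j n \<le> (\<Sum>n. v j n)" using sum_le_suminf[OF sv, of "{n}" j] v0 by simp
    then have "norm \<kappa> * v j n \<le> norm \<kappa> * norm (\<Psi> j 0)" unfolding Psi by (rule mult_left_mono) simp
    also have "\<dots> = norm (fact j * b j)" unfolding b norm_mult ..
    finally show ?thesis by (simp add: norm_mult)
  qed
  define r1 where "r1 = r / 2"
  have r1: "r1 > 0" "\<bar>r1\<bar> < r" unfolding r1_def using r by auto
  have "Bseq (\<lambda>j. b j * complex_of_real r1 ^ j)"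
    using summable_LIMSEQ_zero[OF sums_summable[OF s[OF r1(2)]]] by (intro convergent_imp_Bseq) (auto simp: convergent_def)
  then obtain C where C: "\<And>j. norm (b j * complex_of_real r1 ^ j) \<le> C" unfolding Bseq_def by blast
  \<comment> \<open>The first bound makes the base in the final power at least 2, the second makes
    \<open>real n\<close>, and with it \<open>2 ^ j\<close>, exceed the constant.\<close>
  obtain n where n: "max (max (2 * exp M / r1) (C / norm \<kappa>)) 1 < real n" using reals_Archimedean2 by blast
  have n1: "real n \<ge> 1" and n2: "2 * exp M / r1 < real n" and n3: "C / norm \<kappa> < real n" using n by auto
  \<comment> \<open>The order of differentiation is chosen so that the damping of the
    \<open>n\<close>-th term is exactly geometric in \<open>j\<close>.\<close>
  define j where "j = n ^ Suc k"
  have jr: "real j = real n ^ Suc k" unfolding j_def by simp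
  have jn: "real j \<ge> real n"
  proof -
    have "real n * 1 \<le> real n * real n ^ k" using n1 by (intro mult_left_mono one_le_power) auto
    then show ?thesis unfolding jr by simp
  qed
  have "real n * real n ^ Suc k \<le> real n ^ Suc l"
  proof -
    have "real n ^ Suc (Suc k) \<le> real n ^ Suc l" using n1 kl by (intro power_increasing) auto
    then show ?thesis by simp
  qed
  then have "(real n * real n ^ Suc k) ^ j \<le> (real n ^ Suc l) ^ j" by (rule power_mono) simp
  then have "real n ^ j * real j ^ j \<le> (real n ^ Suc l) ^ j" unfolding jr power_mult_distrib .
  then have "exp (- M) ^ j * (real n ^ j * real j ^ j) \<le> exp (- M) ^ j * (real n ^ Suc l) ^ j"
    by (rule mult_left_mono) simp
  also have "exp (- M) ^ j = exp (- (M * real n ^ Suc k))" unfolding jr[symmetric] by (simp add: exp_of_nat_mult[symmetric] mult.commute)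
  also have "exp (- (M * real n ^ Suc k)) * (real n ^ Suc l) ^ j \<le> v j n"
  proof -
    have "1 * (exp (- (M * real n ^ Suc k)) * (real n ^ Suc l) ^ j) \<le> real n ^ e * (exp (- (M * real n ^ Suc k)) * (real n ^ Suc l) ^ j)"
      using n1 by (intro mult_right_mono one_le_power) auto
    then show ?thesis unfolding v_def by (simp only: mult_1 mult.assoc)
  qed
  finally have 1: "exp (- M) ^ j * (real n ^ j * real j ^ j) \<le> v j n"
    unfolding jr[symmetric] by (simp add: exp_of_nat_mult[symmetric] mult.commute)
  have "norm \<kappa> * (exp (- M) ^ j * (real n ^ j * real j ^ j)) * r1 ^ j \<le> norm \<kappa> * v j n * r1 ^ j"
    using 1 r1 by (intro mult_right_mono mult_left_mono) auto
  also have "\<dots> \<le> fact j * norm (b j) * r1 ^ j" using vb r1 by (intro mult_right_mono) auto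
  also have "\<dots> = fact j * norm (b j * complex_of_real r1 ^ j)" using r1 by (simp add: norm_mult norm_power)
  also have "\<dots> \<le> fact j * C" using C by (intro mult_left_mono) auto
  also have "\<dots> \<le> real j ^ j * C"
  proof -
    have "(fact j :: real) \<le> real j ^ j" using fact_le_power[of j, where 'a = real] by simp
    moreover have "C \<ge> 0" using C[of 0] norm_ge_zero order_trans by blast
    ultimately show ?thesis by (rule mult_right_mono)
  qed
  finally have "real j ^ j * (norm \<kappa> * (exp (- M) * real n * r1) ^ j) \<le> real j ^ j * C"
    by (simp add: power_mult_distrib mult_ac)
  moreover have "real j ^ j > 0" using jn n1 by simp
  ultimately have 2: "norm \<kappa> * (exp (- M) * real n * r1) ^ j \<le> C" by (rule mult_le_cancel_left_pos[THEN iffD1, rotated])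
  have "2 \<le> exp (- M) * real n * r1" using n2 r1 by (simp add: exp_minus field_simps)
  then have "2 ^ j \<le> (exp (- M) * real n * r1) ^ j" by (rule power_mono) simp
  then have "norm \<kappa> * 2 ^ j \<le> norm \<kappa> * (exp (- M) * real n * r1) ^ j" by (rule mult_left_mono) simp
  with 2 have "norm \<kappa> * 2 ^ j \<le> C" by linarith
  then have "2 ^ j \<le> C / norm \<kappa>" using \<kappa> by (simp add: field_simps)
  moreover have "real j < 2 ^ j" by (rule of_nat_less_two_power)
  ultimately show False using n3 jn by linarith
qed

section \<open>The derivative across the plane of the slice\<close>

lemma has_vector_derivative_slope_at_0:
  fixes f :: "real \<Rightarrow> 'a::real_normed_vector"
  shows "(f has_vector_derivative D) (at 0) \<longleftrightarrow> ((\<lambda>x. inverse x *\<^sub>R (f x - f 0)) \<longlongrightarrow> D) (at 0)"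
proof -
  have *: "inverse x *\<^sub>R (f x - f 0 - x *\<^sub>R D) = inverse x *\<^sub>R (f x - f 0) - D" if "x \<noteq> 0" for x
    using that by (simp add: scaleR_diff_right)
  have "norm (f (0 + x) - f 0 - x *\<^sub>R D) / norm x = norm (inverse x *\<^sub>R (f x - f 0) - D)" if "x \<noteq> 0" for x
  proof -
    have "norm (inverse x *\<^sub>R (f x - f 0 - x *\<^sub>R D)) = norm (f (0 + x) - f 0 - x *\<^sub>R D) / norm x"
      by (simp add: divide_inverse mult.commute)
    then show ?thesis using *[OF that] by simp
  qed
  then have "((\<lambda>h. norm (f (0 + h) - f 0 - h *\<^sub>R D) / norm h) \<longlongrightarrow> 0) (at 0) \<longleftrightarrow>
     ((\<lambda>x. norm (inverse x *\<^sub>R (f x - f 0) - D)) \<longlongrightarrow> 0) (at 0)"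
    by (intro tendsto_cong) (simp add: eventually_at_filter)
  then show ?thesis
    unfolding has_vector_derivative_def has_derivative_at tendsto_norm_zero_iff LIM_zero_iff
    by (simp add: bounded_linear_scaleR_left)
qed

text \<open>Near 0 differentiability gives a linear bound, and away from 0 the constant
  \<open>B\<close> is at most \<open>B / \<delta>\<close> times the distance.\<close>

lemma bounded_differentiable_linear_bound:
  fixes f :: "real \<Rightarrow> complex"
  assumes d: "(f has_vector_derivative D) (at 0)" and f0: "f 0 = 0" and B: "\<And>x. norm (f x) \<le> B"
  obtains C where "\<And>x. norm (f x) \<le> C * \<bar>x\<bar>"
proof -
  have "((\<lambda>h. norm (f (0 + h) - f 0 - h *\<^sub>R D) / norm h) \<longlongrightarrow> 0) (at 0)"
    using d unfolding has_vector_derivative_def has_derivative_at by blast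
  then have "eventually (\<lambda>h. norm (f (0 + h) - f 0 - h *\<^sub>R D) / norm h < 1) (at 0)"
    by (rule order_tendstoD) simp
  then obtain \<delta> where \<delta>: "\<delta> > 0" "\<And>h. h \<noteq> 0 \<Longrightarrow> \<bar>h\<bar> < \<delta> \<Longrightarrow> norm (f h - h *\<^sub>R D) / \<bar>h\<bar> < 1"
    unfolding eventually_at dist_real_def using f0 by auto
  have B0: "B \<ge> 0" using B[of 0] norm_ge_zero order_trans by blast
  have "norm (f x) \<le> (1 + norm D + B / \<delta>) * \<bar>x\<bar>" for x
  proof (cases "x = 0 \<or> \<bar>x\<bar> \<ge> \<delta>")
    case True
    then show ?thesis
    proof
      assume "\<bar>x\<bar> \<ge> \<delta>"
      then have "B / \<delta> * \<delta> \<le> (1 + norm D + B / \<delta>) * \<bar>x\<bar>" using \<delta>(1) B0 by (intro mult_mono) auto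
      then show ?thesis using B[of x] \<delta>(1) by simp
    qed (simp add: f0)
  next
    case False
    then have "norm (f x - x *\<^sub>R D) < \<bar>x\<bar>" using \<delta>(2)[of x] by (simp add: field_simps)
    moreover have "norm (f x) \<le> norm (f x - x *\<^sub>R D) + norm (x *\<^sub>R D)" using norm_triangle_sub[of "f x" "x *\<^sub>R D"] by simp
    ultimately have "norm (f x) \<le> (1 + norm D) * \<bar>x\<bar>" by (simp add: algebra_simps)
    also have "\<dots> \<le> (1 + norm D + B / \<delta>) * \<bar>x\<bar>" using B0 \<delta>(1) by (intro mult_right_mono) auto
    finally show ?thesis .
  qed
  then show thesis by (rule that)
qed

text \<open>No bound on the derivative of \<open>f\<close> away from 0 is available, so termwise
  differentiation is replaced by dominated convergence of the difference quotients: the linear bound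
  on \<open>f\<close> dominates them by \<open>C * n * norm (c n)\<close>, uniformly in
  \<open>x\<close>.\<close>

lemma series_dilation_derivative:
  fixes f :: "real \<Rightarrow> complex" and c :: "nat \<Rightarrow> complex"
  assumes d: "(f has_vector_derivative D) (at 0)" and f0: "f 0 = 0" and B: "\<And>x. norm (f x) \<le> B"
    and s: "summable (\<lambda>n. real n * norm (c n))"
  shows "((\<lambda>x. \<Sum>n. c n * f (real n * x)) has_vector_derivative D * (\<Sum>n. of_nat n * c n)) (at 0)"
proof -
  obtain C where C: "\<And>x. norm (f x) \<le> C * \<bar>x\<bar>" using bounded_differentiable_linear_bound[OF d f0 B] by blast
  define a where "a n x = inverse x *\<^sub>R (c n * f (real n * x))" for n x
  have lim: "((\<lambda>x. a n x) \<longlongrightarrow> D * (of_nat n * c n)) (at 0)" for n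
  proof -
    have "((\<lambda>x. real n * x) has_vector_derivative real n) (at 0)" by (auto intro!: derivative_eq_intros)
    from vector_diff_chain_at[OF this, of f D] d
    have "((\<lambda>x. f (real n * x)) has_vector_derivative (real n *\<^sub>R D)) (at 0)" by (simp add: comp_def)
    from has_vector_derivative_mult_right[OF this, of "c n"]
    have "((\<lambda>x. c n * f (real n * x)) has_vector_derivative (D * (of_nat n * c n))) (at 0)"
      by (simp add: scaleR_conv_of_real mult_ac)
    then show ?thesis unfolding has_vector_derivative_slope_at_0 a_def
      by (simp add: f0)
  qed
  have bd: "norm (a n x) \<le> C * (real n * norm (c n))" if "x \<noteq> 0" for n x
  proof -
    have "norm (a n x) = norm (c n) * norm (f (real n * x)) / \<bar>x\<bar>" unfolding a_def by (simp add: norm_mult field_simps)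
    also have "\<dots> \<le> norm (c n) * (C * \<bar>real n * x\<bar>) / \<bar>x\<bar>" by (intro divide_right_mono mult_left_mono C) auto
    also have "\<dots> = C * (real n * norm (c n))" using that by (simp add: abs_mult)
    finally show ?thesis .
  qed
  have ev: "eventually (\<lambda>x::real. x \<noteq> 0) (at 0)" by (simp add: eventually_at_filter)
  have "eventually (\<lambda>(n, x). norm (a n x) \<le> C * (real n * norm (c n))) (at_top \<times>\<^sub>F at 0)"
    by (rule eventually_mono[OF eventually_prodI[OF eventually_True ev]]) (auto intro: bd)
  from tannerys_theorem[OF lim this summable_mult[OF s]]
  have "((\<lambda>x. \<Sum>n. a n x) \<longlongrightarrow> (\<Sum>n. D * (of_nat n * c n))) (at 0)" by simp
  also have "(\<Sum>n. D * (of_nat n * c n)) = D * (\<Sum>n. of_nat n * c n)"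
    by (rule suminf_mult, rule summable_norm_cancel) (simp add: norm_mult s)
  finally have T: "((\<lambda>x. \<Sum>n. a n x) \<longlongrightarrow> D * (\<Sum>n. of_nat n * c n)) (at 0)" .
  have sm: "summable (\<lambda>n. c n * f (real n * x))" for x
  proof (rule summable_comparison_test'[OF summable_mult[OF s, of "C * \<bar>x\<bar>"]])
    fix n
    have "norm (c n) * norm (f (real n * x)) \<le> norm (c n) * (C * \<bar>real n * x\<bar>)" by (intro mult_left_mono C) auto
    then show "norm (c n * f (real n * x)) \<le> C * \<bar>x\<bar> * (real n * norm (c n))" by (simp add: norm_mult abs_mult mult_ac)
  qed
  show ?thesis unfolding has_vector_derivative_slope_at_0
  proof (rule Lim_transform_eventually[OF T])
    show "\<forall>\<^sub>F x in at 0. (\<Sum>n. a n x) = inverse x *\<^sub>R ((\<Sum>n. c n * f (real n * x)) - (\<Sum>n. c n * f (real n * 0)))"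
      unfolding a_def by (simp add: f0 suminf_scaleR_right[OF sm])
  qed
qed

lemma vec3_slab: "(vector [x, 0, t] :: real ^ 3) \<in> {p. \<bar>p $ 2\<bar> < 1}"
  by simp

text \<open>Hypoellipticity yields an analytic \<open>g\<close> equal to \<open>u\<close> only as a
  distribution. Continuity of both upgrades this to equality at every point of the slab, as is
  necessary because the contradiction is read off on the line \<open>x = y = 0\<close>, a null
  set.\<close>

theorem not_analytic_hypoelliptic:
  fixes f f' :: "real \<Rightarrow> complex"
  assumes kl: "k < l" and f: "\<And>x. (f has_vector_derivative f' x) (at x)"
    and f': "\<And>x. (f' has_vector_derivative (of_real (x ^ l) - of_real (x ^ k) * \<zeta>)\<^sup>2 * f x) (at x)"
    and B: "\<And>x. norm (f x) \<le> B" and nz: "f 0 \<noteq> 0 \<or> f' 0 \<noteq> 0"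
  shows "\<not> analytic_hypoelliptic_on (P_op k l) (UNIV :: (real ^ 3) set)"
proof
  assume H: "analytic_hypoelliptic_on (P_op k l) (UNIV :: (real ^ 3) set)"
  define U where "U = {p :: real ^ 3. \<bar>p $ 2\<bar> < 1}"
  \<comment> \<open>On the slab the mode in \<open>y\<close> grows at most like
    \<open>exp (norm \<zeta> * n ^ Suc k)\<close>; the extra 1 leaves a summable bound independent
    of the point.\<close>
  define M where "M = norm \<zeta> + 1"
  have M: "M > 0" unfolding M_def using norm_ge_zero[of \<zeta>] by linarith
  \<comment> \<open>The exponents are dictated by the dilation \<open>f (n * x)\<close>: with
    frequencies \<open>n ^ Suc l\<close> in \<open>t\<close> and \<open>\<zeta> * n ^ Suc k\<close>
    in \<open>y\<close>, both terms of the frequency in \<open>x\<close> acquire one and the same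
    factor \<open>n\<close>.\<close>
  define w where "w n = plane_wave (real n ^ Suc l) (\<zeta> * of_real (real n ^ Suc k)) (M * real n ^ Suc k) (\<lambda>x. f (real n * x))" for n
  define u where "u p = (\<Sum>n. w n p)" for p
  have oU: "open U" unfolding U_def by (intro open_Collect_less continuous_intros)
  have sol_coeff: "continuous_on UNIV f" using f by (intro continuous_at_imp_continuous_on ballI has_vector_derivative_continuous) auto
  have B0: "B \<ge> 0" using B[of 0] norm_ge_zero order_trans by blast
  have cw: "continuous_on S (w n)" for S n
    unfolding w_def by (intro plane_wave_continuous continuous_on_compose2[OF sol_coeff] continuous_intros) auto
  have bw: "norm (w n p) \<le> B * exp (- (1 * real n ^ Suc k))" if p: "p \<in> U" for n p
  proof -
    define N where "N = real n ^ Suc k"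
    have N: "N \<ge> 0" unfolding N_def by simp
    have y: "\<bar>p $ 2\<bar> \<le> 1" using p unfolding U_def by simp
    have "- (Im \<zeta> * p $ 2) \<le> \<bar>Im \<zeta>\<bar> * \<bar>p $ 2\<bar>" using abs_ge_minus_self[of "Im \<zeta> * p $ 2"] by (simp add: abs_mult)
    also have "\<dots> \<le> norm \<zeta> * 1" using y abs_Im_le_cmod[of \<zeta>] by (intro mult_mono) auto
    finally have "- (Im \<zeta> * p $ 2) * N \<le> norm \<zeta> * N" using N by (intro mult_right_mono) auto
    then have "- (Im \<zeta> * N * p $ 2) - M * N \<le> - (1 * N)" unfolding M_def by (simp add: algebra_simps)
    then have "exp (- (Im \<zeta> * N * p $ 2) - M * N) * norm (f (real n * p $ 1)) \<le> exp (- (1 * N)) * B"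
      using B by (intro mult_mono) auto
    moreover have "norm (w n p) = exp (- (Im \<zeta> * N * p $ 2) - M * N) * norm (f (real n * p $ 1))"
      unfolding w_def plane_wave_def norm_mult norm_exp_eq_Re N_def[symmetric] by (simp add: algebra_simps)
    ultimately show ?thesis unfolding N_def by (simp add: mult.commute)
  qed
  have sb: "summable (\<lambda>n. B * exp (- (1 * real n ^ Suc k)))"
    using summable_mult[OF summable_power_exp[of 1 0 k], of B] by simp
  have cu: "continuous_on U u"
  proof -
    have "uniform_limit U (\<lambda>n p. \<Sum>i<n. w i p) u sequentially"
      unfolding u_def[abs_def] by (rule Weierstrass_m_test[OF bw sb])
    then show ?thesis
      by (rule uniform_limit_theorem[rotated]) (auto intro!: always_eventually continuous_intros cw)
  qed
  have Pw: "P_op k l (distr_of U (w n)) \<phi> = 0" if "\<phi> \<in> test_functions U" for n \<phi>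
    unfolding w_def
  proof (rule P_op_plane_wave[OF _ _ _ that])
    fix x :: real
    have h: "((\<lambda>x. real n * x) has_vector_derivative real n) (at x)" by (auto intro!: derivative_eq_intros)
    from vector_diff_chain_at[OF h f]
    show "((\<lambda>x. f (real n * x)) has_vector_derivative (real n *\<^sub>R f' (real n * x))) (at x)" by (simp add: comp_def)
    show "((\<lambda>x. real n *\<^sub>R f' (real n * x)) has_vector_derivative (real n *\<^sub>R (real n *\<^sub>R ((of_real ((real n * x) ^ l) - of_real ((real n * x) ^ k) * \<zeta>)\<^sup>2 * f (real n * x))))) (at x)"
      using has_vector_derivative_scaleR[OF _ vector_diff_chain_at[OF h f'], of "\<lambda>_. real n" 0]
      by (simp add: comp_def)
    show "real n *\<^sub>R (real n *\<^sub>R ((of_real ((real n * x) ^ l) - of_real ((real n * x) ^ k) * \<zeta>)\<^sup>2 * f (real n * x))) =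
      (of_real (x ^ k) * (\<zeta> * of_real (real n ^ Suc k)) - of_real (x ^ l * real n ^ Suc l))\<^sup>2 * f (real n * x)"
      by (simp add: scaleR_conv_of_real power_mult_distrib power2_eq_square algebra_simps)
  qed
  have "P_op k l (distr_of U u) \<phi> = 0" if "\<phi> \<in> test_functions U" for \<phi>
    unfolding u_def by (rule P_op_sums[OF that cw bw sb Pw[OF that]])
  then have "eq_distr_on U (P_op k l (distr_of U u)) (distr_of U (\<lambda>_. 0))"
    unfolding eq_distr_on_def by (simp add: distr_of_def set_lebesgue_integral_def)
  moreover have "real_analytic_on (\<lambda>_. 0) U"
    unfolding real_analytic_on_def by (intro ballI exI[of _ 1] conjI exI[of _ "\<lambda>_. 0"]) auto
  ultimately obtain g where g: "real_analytic_on g U" "eq_distr_on U (distr_of U u) (distr_of U g)"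
    using H oU distribution_on_distr_of[OF cu] unfolding analytic_hypoelliptic_on_def by blast
  have cg: "continuous_on U g" using real_analytic_on_isCont[OF g(1)] by (simp add: continuous_at_imp_continuous_on)
  have "u q - g q = 0" if "q \<in> U" for q
  proof (rule distr_of_zero_imp_zero[OF oU _ _ that])
    show "continuous_on U (\<lambda>p. u p - g p)" by (intro continuous_intros cu cg)
    show "distr_of U (\<lambda>p. u p - g p) \<phi> = 0" if "\<phi> \<in> test_functions U" for \<phi>
      using distr_of_diff[OF that cu cg] g(2) that unfolding eq_distr_on_def by simp
  qed
  then have ug: "g (vector [x, 0, t]) = u (vector [x, 0, t])" for x t
    using vec3_slab[of x t, folded U_def] by simp
  have "0 \<in> U" unfolding U_def by simp
  with g(1) obtain r b S where r: "r > 0"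
    and S: "\<And>i t. \<bar>t\<bar> < r \<Longrightarrow> (\<lambda>j. b i j * complex_of_real t ^ j) sums S i t"
    and gs: "\<And>x t. \<bar>x\<bar> < r \<Longrightarrow> \<bar>t\<bar> < r \<Longrightarrow> (\<lambda>i. S i t * complex_of_real x ^ i) sums g (vector [x, 0, t])"
    by (rule analytic_slice) (rule that)
  define c where "c n t = of_real (exp (- (M * real n ^ Suc k))) * exp (\<i> * of_real (real n ^ Suc l * t))" for n t
  have cnorm: "norm (c n t) = exp (- (M * real n ^ Suc k))" for n t
    unfolding c_def norm_mult norm_of_real norm_exp_i_times by simp
  have uc: "u (vector [x, 0, t]) = (\<Sum>n. c n t * f (real n * x))" for x t
  proof -
    have e: "exp (X - complex_of_real y) = of_real (exp (- y)) * exp X" for X y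
      unfolding exp_of_real[symmetric] exp_add[symmetric] by simp
    have "w n (vector [x, 0, t]) = c n t * f (real n * x)" for n
      unfolding w_def plane_wave_def c_def vector_3 e by simp
    then show ?thesis unfolding u_def by simp
  qed
  show False
  proof (cases "f 0 = 0")
    case False
    show False
    proof (rule lacunary_not_power_series[OF False kl M r, of "b 0" 0])
      fix t assume t: "\<bar>t\<bar> < r"
      have "S 0 t = (\<Sum>n. c n t * f 0)" using gs[of 0 t] t r unfolding ug uc by simp
      also have "\<dots> = f 0 * (\<Sum>n. c n t)"
      proof -
        have "summable (\<lambda>n. c n t)"
          by (rule summable_norm_cancel) (use summable_power_exp[OF M, of 0 k] in \<open>simp add: cnorm\<close>)
        then show ?thesis using suminf_mult[of "\<lambda>n. c n t" "f 0"] by (simp add: mult.commute)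
      qed
      finally show "(\<lambda>j. b 0 j * complex_of_real t ^ j) sums
         (f 0 * (\<Sum>n. of_real (real n ^ 0 * exp (- (M * real n ^ Suc k))) * exp (\<i> * of_real (real n ^ Suc l * t))))"
        using S[OF t, of 0] unfolding c_def by simp
    qed
  next
    case True
    then have nz': "f' 0 \<noteq> 0" using nz by simp
    show False
    proof (rule lacunary_not_power_series[OF nz' kl M r, of "b 1" 1])
      \<comment> \<open>Dilation turns the \<open>x\<close>-derivative at 0 into a factor
        \<open>n\<close>, which is the exponent \<open>e = 1\<close> of the lacunary series.\<close>
      fix t assume t: "\<bar>t\<bar> < r"
      have "((\<lambda>x. g (vector [x, 0, t])) has_vector_derivative f' 0 * (\<Sum>n. of_nat n * c n t)) (at 0)"
        unfolding ug uc using series_dilation_derivative[OF f True B, of "\<lambda>n. c n t"] summable_power_exp[OF M, of 1 k]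
        by (simp add: cnorm)
      from power_series_deriv_eq[OF gs[OF _ t] this]
      have "S 1 t = f' 0 * (\<Sum>n. of_nat n * c n t)" using r by (simp add: diffs_def)
      then show "(\<lambda>j. b 1 j * complex_of_real t ^ j) sums
         (f' 0 * (\<Sum>n. of_real (real n ^ 1 * exp (- (M * real n ^ Suc k))) * exp (\<i> * of_real (real n ^ Suc l * t))))"
        using S[OF t, of 1] unfolding c_def by (simp add: mult.assoc)
    qed
  qed
qed

theorem theorem2:
  fixes k l :: nat
  assumes "k < l" and "(k, l) \<noteq> (0, 1)"
  shows "(\<exists>\<zeta>::complex. \<exists>f\<in>L_infinity. classical_solution k l \<zeta> f \<and> f \<noteq> (\<lambda>x. 0)) \<and>
         \<not> analytic_hypoelliptic_on (P_op k l) (UNIV :: (real ^ 3) set)"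
proof -
  obtain \<zeta> c0 c1 B where c: "(c0, c1) \<noteq> (0, 0)"
    and B: "\<And>x::real. norm (sol l k 1 (- \<zeta>) c0 c1 (of_real x)) \<le> B"
    using bounded_solution_exists[OF assms] by metis
  define f where "f x = sol l k 1 (- \<zeta>) c0 c1 (of_real x)" for x :: real
  define f' where "f' x = dsol l k 1 (- \<zeta>) c0 c1 (of_real x)" for x :: real
  have f: "(f has_vector_derivative f' x) (at x)" for x
    unfolding f_def[abs_def] f'_def by (rule has_vector_derivative_real_field[OF sol_has_field_derivative])
  have f': "(f' has_vector_derivative (of_real (x ^ l) - of_real (x ^ k) * \<zeta>)\<^sup>2 * f x) (at x)" for x
    using has_vector_derivative_real_field[OF dsol_has_field_derivative[of l k 1 "- \<zeta>" c0 c1 "of_real x"]]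
    unfolding f_def f'_def[abs_def] by (simp add: mult.commute)
  have nz: "f 0 \<noteq> 0 \<or> f' 0 \<noteq> 0" using c unfolding f_def f'_def by (simp add: sol_0 dsol_0)
  have Bf: "norm (f x) \<le> B" for x unfolding f_def by (rule B)
  have "continuous_on UNIV f"
    using f by (intro continuous_at_imp_continuous_on ballI has_vector_derivative_continuous) auto
  then have m: "f \<in> borel_measurable lborel" by (simp add: borel_measurable_continuous_onI)
  then have "esssup lborel (\<lambda>x. ereal (cmod (f x))) \<le> ereal B"
    using Bf by (intro esssup_I) auto
  then have L: "f \<in> L_infinity" unfolding L_infinity_def using m le_less_trans by auto
  have "classical_solution k l \<zeta> f"
    unfolding classical_solution_def using f f' by (intro exI[of _ f'] exI[of _ "\<lambda>x. (of_real (x ^ l) - of_real (x ^ k) * \<zeta>)\<^sup>2 * f x"]) auto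
  moreover have "f \<noteq> (\<lambda>x. 0)"
  proof
    assume 0: "f = (\<lambda>x. 0)"
    then have "f' 0 = 0" using f[of 0] vector_derivative_unique_at[of f _ 0 0] has_vector_derivative_const by metis
    with nz 0 show False by simp
  qed
  ultimately show ?thesis using L not_analytic_hypoelliptic[OF assms(1) f f' Bf nz] by blast
qed

end
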